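(* Let $G$ be a group, let $A$ be a $G$-cograded multiplier Hopf algebra with a crossing $\pi$ of $G$ on $A$, and suppose that $A$ is $\pi$-quasitriangular with generalized $\pi$-matrix $R\in M(A\otimes A)$. Let $\widetilde u\in M(A)$ be the multiplier determined by $\widetilde u a=\sum\widetilde S(R^{(2)})R^{(1)}a$ for all $a\in A$ (it is an invertible two-sided multiplier). Then $S^4$ is an inner automorphism: for all $p\in G$ and $a\in A_p$, $$S^4(a)=\widetilde uS(\widetilde u)^{-1}\,a\,S(\widetilde u)\widetilde u^{-1}.$$
   Context: Algebras are associative over $\mathbb{C}$, possibly without unit, with non-degenerate product; $M(A)$ is the multiplier algebra of $A$. A multiplier Hopf algebra $(A,\Delta)$ is such an algebra with a homomorphism $\Delta:A\to M(A\otimes A)$ such that $a\otimes b\mapsto\Delta(a)(1\otimes b)$ and $a\otimes b\mapsto(a\otimes 1)\Delta(b)$ are bijections of $A\otimes A$ onto itself and $\Delta$ is coassociative: $(a\otimes1\otimes1)(\Delta\otimes\iota)(\Delta(b)(1\otimes c))=(\iota\otimes\Delta)((a\otimes1)\Delta(b))(1\otimes1\otimes c)$. It has a unique counit $\varepsilon$ and antipode $S$; it is regular if $(A,\Delta^{cop})$ is also a multiplier Hopf algebra, equivalently $S:A\to A$ is a bijection. All multiplier Hopf algebras are assumed regular. $\sigma$ is the flip, $\Delta^{cop}=\sigma\circ\Delta$ (similarly $\widetilde\Delta^{cop}$), $\iota=i$ is the identity map. Non-degenerate homomorphisms and antipodes are extended uniquely to multiplier algebras, denoted by the same symbols. $A$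 is $G$-cograded if $A=\bigoplus_{p\in G}A_p$ with subalgebras $A_p$ satisfying $A_pA_q=0$ for $p\ne q$, and $\Delta(A_{pq})(1\otimes A_q)=A_p\otimes A_q$, $(A_p\otimes1)\Delta(A_{pq})=A_p\otimes A_q$ for all $p,q\in G$. A crossing of $G$ on $A$ is a group homomorphism $\pi:G\to\mathrm{Aut}(A)$ (algebra automorphisms) with $\Delta(\pi_p(a))=(\pi_p\otimes\pi_p)\Delta(a)$ and $\pi_p(A_q)=A_{pqp^{-1}}$ for all $p,q\in G$, $a\in A$. The deformation $\widetilde A$ of $A$ is the multiplier Hopf algebra equal to $A$ as an algebra, with coproduct $\widetilde\Delta(a)(1\otimes a')=(\pi_{q^{-1}}\otimes\iota)(\Delta(a)(1\otimes a'))$ for $a\in A$, $a'\in A_q$, counit $\varepsilon$, and antipode $\widetilde S(a)=\pi_{p^{-1}}(S(a))$ for $a\in A_p$. $A$ is $\pi$-quasitriangular, with generalized $\pi$-matrix $R$, if $R\in M(A\otimes A)$ is invertible and (1) $(\pi_p\otimes\pi_p)(R)=R$ for all $p\in G$; (2) $R\Delta(a)=\widetilde\Delta^{cop}(a)R$ for all $a\in A$; (3) $(\widetilde\Delta\otimes i)(R)=R^{13}R^{23}$; (4) $(i\otimes\Delta)(R)=R^{13}R^{12}$; and moreover $R(a\otimes1),(a\otimes1)R\in A\otimes M(A)$ for all $a\in A$. One writes $R(a\otimes1)=\sum R^{(1)}a\otimes R^{(2)}$ in $A\otimes M(A)$. *)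

theory Defs
  imports Complex_Main "HOL-Library.Poly_Mapping" "HOL-Algebra.Group"
begin

section \<open>Complex vector spaces and complex algebras (possibly without unit)\<close>

class complex_vector = ab_group_add +
  fixes scaleC :: "complex \<Rightarrow> 'a \<Rightarrow> 'a" (infixr "*\<^sub>C" 75)
  assumes scaleC_add_right: "c *\<^sub>C (x + y) = c *\<^sub>C x + c *\<^sub>C y"
    and scaleC_add_left: "(c + d) *\<^sub>C x = c *\<^sub>C x + d *\<^sub>C x"
    and scaleC_scaleC: "c *\<^sub>C d *\<^sub>C x = (c * d) *\<^sub>C x"
    and scaleC_one: "1 *\<^sub>C x = x"

class complex_algebra = complex_vector + ring +
  assumes mult_scaleC_left: "(c *\<^sub>C x) * y = c *\<^sub>C (x * y)"
    and mult_scaleC_right: "x * (c *\<^sub>C y) = c *\<^sub>C (x * y)"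

global_interpretation complex_vector: vector_space "scaleC :: complex \<Rightarrow> 'a \<Rightarrow> 'a::complex_vector"
  by unfold_locales (simp_all add: scaleC_add_right scaleC_add_left scaleC_scaleC scaleC_one)

abbreviation cspan :: "'a::complex_vector set \<Rightarrow> 'a set"
  where "cspan \<equiv> module.span scaleC"

abbreviation csubspace :: "'a::complex_vector set \<Rightarrow> bool"
  where "csubspace \<equiv> module.subspace scaleC"

abbreviation clinear :: "('a::complex_vector \<Rightarrow> 'b::complex_vector) \<Rightarrow> bool"
  where "clinear \<equiv> Vector_Spaces.linear scaleC scaleC"

definition cbilinear :: "('a::complex_vector \<Rightarrow> 'b::complex_vector \<Rightarrow> 'c::complex_vector) \<Rightarrow> bool"
  where "cbilinear f \<longleftrightarrow> (\<forall>b. clinear (\<lambda>a. f a b)) \<and> (\<forall>a. clinear (f a))"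

definition algebra_hom :: "('a::complex_algebra \<Rightarrow> 'b::complex_algebra) \<Rightarrow> bool"
  where "algebra_hom f \<longleftrightarrow> clinear f \<and> (\<forall>a b. f (a * b) = f a * f b)"

definition algebra_antihom :: "('a::complex_algebra \<Rightarrow> 'b::complex_algebra) \<Rightarrow> bool"
  where "algebra_antihom f \<longleftrightarrow> clinear f \<and> (\<forall>a b. f (a * b) = f b * f a)"

lemma clinear_iff:
  "clinear f \<longleftrightarrow> (\<forall>x y. f (x + y) = f x + f y) \<and> (\<forall>c x. f (c *\<^sub>C x) = c *\<^sub>C f x)"
  by (simp add: linear_iff_module_hom module_hom_iff complex_vector.module_axioms)

lemma cbilinear_iff:
  "cbilinear f \<longleftrightarrow> (\<forall>a a' b. f (a + a') b = f a b + f a' b) \<and> (\<forall>a b b'. f a (b + b') = f a b + f a b')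
    \<and> (\<forall>c a b. f (c *\<^sub>C a) b = c *\<^sub>C f a b) \<and> (\<forall>c a b. f a (c *\<^sub>C b) = c *\<^sub>C f a b)"
  unfolding cbilinear_def clinear_iff by blast

instantiation complex :: complex_algebra
begin
definition scaleC_complex :: "complex \<Rightarrow> complex \<Rightarrow> complex" where "scaleC_complex = (*)"
instance by standard (simp_all add: scaleC_complex_def algebra_simps)
end

section \<open>The algebraic tensor product\<close>

text \<open>The free complex vector space on a set, modulo the bilinearity relations.\<close>

definition free_scale :: "complex \<Rightarrow> ('k \<Rightarrow>\<^sub>0 complex) \<Rightarrow> ('k \<Rightarrow>\<^sub>0 complex)"
  where "free_scale c = Poly_Mapping.map ((*) c)"

lemma lookup_free_scale [simp]: "Poly_Mapping.lookup (free_scale c x) k = c * Poly_Mapping.lookup x k"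
  by (simp add: free_scale_def Poly_Mapping.map.rep_eq when_def)

global_interpretation free: vector_space free_scale
  by unfold_locales (auto intro!: poly_mapping_eqI simp: lookup_add algebra_simps)

abbreviation free_of :: "'k \<Rightarrow> ('k \<Rightarrow>\<^sub>0 complex)"
  where "free_of k \<equiv> Poly_Mapping.single k 1"

definition tensor_relations :: "('a::complex_vector \<times> 'b::complex_vector \<Rightarrow>\<^sub>0 complex) set"
  where "tensor_relations =
      {free_of (a + a', b) - free_of (a, b) - free_of (a', b) | a a' b. True}
    \<union> {free_of (a, b + b') - free_of (a, b) - free_of (a, b') | a b b'. True}
    \<union> {free_of (c *\<^sub>C a, b) - free_scale c (free_of (a, b)) | c a b. True}
    \<union> {free_of (a, c *\<^sub>C b) - free_scale c (free_of (a, b)) | c a b. True}"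

quotient_type (overloaded) ('a, 'b) tensor = "('a::complex_vector \<times> 'b::complex_vector) \<Rightarrow>\<^sub>0 complex" /
  "\<lambda>x y. x - y \<in> free.span tensor_relations"
proof (rule equivpI)
  show "reflp (\<lambda>x y. x - y \<in> free.span (tensor_relations :: ('a \<times> 'b \<Rightarrow>\<^sub>0 complex) set))"
    by (simp add: reflp_def free.span_zero)
  show "symp (\<lambda>x y. x - y \<in> free.span (tensor_relations :: ('a \<times> 'b \<Rightarrow>\<^sub>0 complex) set))"
    unfolding symp_def using free.span_neg by fastforce
  show "transp (\<lambda>x y. x - y \<in> free.span (tensor_relations :: ('a \<times> 'b \<Rightarrow>\<^sub>0 complex) set))"
    unfolding transp_def using free.span_add by fastforce
qed

instantiation tensor :: (complex_vector, complex_vector) complex_vector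
begin

lift_definition zero_tensor :: "('a, 'b) tensor" is 0 .
lift_definition plus_tensor :: "('a, 'b) tensor \<Rightarrow> ('a, 'b) tensor \<Rightarrow> ('a, 'b) tensor" is "(+)"
proof -
  fix x x' y y' :: "'a \<times> 'b \<Rightarrow>\<^sub>0 complex"
  assume "x - x' \<in> free.span tensor_relations" "y - y' \<in> free.span tensor_relations"
  then have "(x - x') + (y - y') \<in> free.span tensor_relations" by (rule free.span_add)
  then show "x + y - (x' + y') \<in> free.span tensor_relations" by (simp add: algebra_simps)
qed
lift_definition uminus_tensor :: "('a, 'b) tensor \<Rightarrow> ('a, 'b) tensor" is uminus
proof -
  fix x x' :: "'a \<times> 'b \<Rightarrow>\<^sub>0 complex"
  assume "x - x' \<in> free.span tensor_relations"
  then have "- (x - x') \<in> free.span tensor_relations" by (rule free.span_neg)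
  then show "- x - - x' \<in> free.span tensor_relations" by simp
qed
lift_definition minus_tensor :: "('a, 'b) tensor \<Rightarrow> ('a, 'b) tensor \<Rightarrow> ('a, 'b) tensor" is "(-)"
proof -
  fix x x' y y' :: "'a \<times> 'b \<Rightarrow>\<^sub>0 complex"
  assume "x - x' \<in> free.span tensor_relations" "y - y' \<in> free.span tensor_relations"
  then have "(x - x') - (y - y') \<in> free.span tensor_relations" by (rule free.span_diff)
  then show "x - y - (x' - y') \<in> free.span tensor_relations" by (simp add: algebra_simps)
qed
lift_definition scaleC_tensor :: "complex \<Rightarrow> ('a, 'b) tensor \<Rightarrow> ('a, 'b) tensor" is free_scale
  by (simp add: free.scale_right_diff_distrib[symmetric] free.span_scale)

instance
proof
  fix x y z :: "('a, 'b) tensor" and c d :: complex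
  show "x + y + z = x + (y + z)" by transfer (simp add: add.assoc free.span_zero)
  show "x + y = y + x" by transfer (simp add: add.commute free.span_zero)
  show "0 + x = x" by transfer (simp add: free.span_zero)
  show "- x + x = 0" by transfer (simp add: free.span_zero)
  show "x - y = x + - y" by transfer (simp add: free.span_zero)
  show "c *\<^sub>C (x + y) = c *\<^sub>C x + c *\<^sub>C y"
    by transfer (simp add: free.scale_right_distrib free.span_zero)
  show "(c + d) *\<^sub>C x = c *\<^sub>C x + d *\<^sub>C x"
    by transfer (simp add: free.scale_left_distrib free.span_zero)
  show "c *\<^sub>C d *\<^sub>C x = (c * d) *\<^sub>C x" by transfer (simp add: free.span_zero)
  show "1 *\<^sub>C x = x" by transfer (simp add: free.span_zero)
qed

end

lift_definition tensor :: "'a::complex_vector \<Rightarrow> 'b::complex_vector \<Rightarrow> ('a, 'b) tensor" (infixl "\<otimes>\<^sub>t" 70)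
  is "\<lambda>a b. free_of (a, b)" .

lemma cbilinear_tensor: "cbilinear (tensor :: 'a::complex_vector \<Rightarrow> 'b::complex_vector \<Rightarrow> _)"
  unfolding cbilinear_iff
  by (intro conjI allI; transfer; rule free.span_base;
      unfold tensor_relations_def diff_diff_eq[symmetric]; blast)

text \<open>The linear map on the tensor product induced by a bilinear map.\<close>

definition free_eval :: "('k \<Rightarrow> 'c::complex_vector) \<Rightarrow> ('k \<Rightarrow>\<^sub>0 complex) \<Rightarrow> 'c"
  where "free_eval f x = (\<Sum>k\<in>Poly_Mapping.keys x. Poly_Mapping.lookup x k *\<^sub>C f k)"

definition tensor_lift ::
    "('a::complex_vector \<Rightarrow> 'b::complex_vector \<Rightarrow> 'c::complex_vector) \<Rightarrow> ('a, 'b) tensor \<Rightarrow> 'c"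
  where "tensor_lift f t = free_eval (\<lambda>(a, b). f a b) (rep_tensor t)"

lemma free_eval_superset:
  "finite K \<Longrightarrow> Poly_Mapping.keys x \<subseteq> K \<Longrightarrow> free_eval f x = (\<Sum>k\<in>K. Poly_Mapping.lookup x k *\<^sub>C f k)"
  unfolding free_eval_def by (rule sum.mono_neutral_left) (auto simp: in_keys_iff)

lemma free_eval_linear: "Vector_Spaces.linear free_scale scaleC (free_eval f)"
proof -
  have "free_eval f (x + y) = free_eval f x + free_eval f y" for x y
  proof -
    let ?K = "Poly_Mapping.keys x \<union> Poly_Mapping.keys y"
    have "Poly_Mapping.keys (x + y) \<subseteq> ?K" by (rule keys_add)
    then show ?thesis
      by (simp add: free_eval_superset[of ?K] lookup_add scaleC_add_left sum.distrib)
  qed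
  moreover have "free_eval f (free_scale c x) = c *\<^sub>C free_eval f x" for c x
  proof -
    have "Poly_Mapping.keys (free_scale c x) \<subseteq> Poly_Mapping.keys x"
      by (auto simp: in_keys_iff)
    then show ?thesis
      by (simp add: free_eval_superset[of "Poly_Mapping.keys x"] complex_vector.scale_sum_right scaleC_scaleC)
  qed
  ultimately show ?thesis
    by (simp add: linear_iff_module_hom module_hom_iff complex_vector.module_axioms free.module_axioms)
qed

lemma free_eval_of [simp]: "free_eval f (free_of k) = f k"
  by (simp add: free_eval_def scaleC_one)

lemma free_eval_relations:
  assumes f: "cbilinear f" and x: "x \<in> free.span tensor_relations"
  shows "free_eval (\<lambda>(a, b). f a b) x = 0"
proof -
  interpret E: Vector_Spaces.linear free_scale scaleC "free_eval (\<lambda>(a, b). f a b)"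
    by (rule free_eval_linear)
  show ?thesis using x
  proof (rule E.eq_0_on_span[rotated])
    fix y :: "'a \<times> 'b \<Rightarrow>\<^sub>0 complex" assume "y \<in> tensor_relations"
    then show "free_eval (\<lambda>(a, b). f a b) y = 0"
      using f unfolding tensor_relations_def cbilinear_iff
      by (auto simp: E.diff E.scale)
  qed
qed

lemma tensor_lift_abs:
  assumes "cbilinear f"
  shows "tensor_lift f (abs_tensor x) = free_eval (\<lambda>(a, b). f a b) x"
proof -
  interpret E: Vector_Spaces.linear free_scale scaleC "free_eval (\<lambda>(a, b). f a b)"
    by (rule free_eval_linear)
  have "rep_tensor (abs_tensor x) - x \<in> free.span tensor_relations"
    by (rule Quotient3_rep_abs[OF Quotient3_tensor]) (simp add: free.span_zero)
  from free_eval_relations[OF assms this] show ?thesis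
    by (simp add: tensor_lift_def E.diff)
qed

lemma tensor_lift_tensor [simp]: "cbilinear f \<Longrightarrow> tensor_lift f (a \<otimes>\<^sub>t b) = f a b"
  by (simp add: tensor.abs_eq tensor_lift_abs)

lemma tensor_lift_linear: "cbilinear f \<Longrightarrow> clinear (tensor_lift f)"
proof -
  assume f: "cbilinear f"
  interpret E: Vector_Spaces.linear free_scale scaleC "free_eval (\<lambda>(a, b). f a b)"
    by (rule free_eval_linear)
  have "tensor_lift f (x + y) = tensor_lift f x + tensor_lift f y" for x y
    by (induct x rule: tensor.abs_induct, induct y rule: tensor.abs_induct)
      (simp add: plus_tensor.abs_eq tensor_lift_abs[OF f] E.add)
  moreover have "tensor_lift f (c *\<^sub>C x) = c *\<^sub>C tensor_lift f x" for c x
    by (induct x rule: tensor.abs_induct) (simp add: scaleC_tensor.abs_eq tensor_lift_abs[OF f] E.scale)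
  ultimately show ?thesis by (simp add: clinear_iff)
qed

lemma free_induct:
  fixes x :: "'k \<Rightarrow>\<^sub>0 complex"
  shows "x \<in> free.span (range free_of)"
proof -
  have "x = (\<Sum>k\<in>Poly_Mapping.keys x. free_scale (Poly_Mapping.lookup x k) (free_of k))"
    by (rule poly_mapping_eqI)
      (simp add: lookup_sum lookup_single when_def sum.delta in_keys_iff if_distrib
        cong: if_cong)
  also have "\<dots> \<in> free.span (range free_of)"
    by (intro free.span_sum free.span_scale free.span_base) auto
  finally show ?thesis .
qed

lemma tensor_induct [case_names tensor add]:
  fixes t :: "('a::complex_vector, 'b::complex_vector) tensor"
  assumes T: "\<And>a b. P (a \<otimes>\<^sub>t b)" and A: "\<And>s t. P s \<Longrightarrow> P t \<Longrightarrow> P (s + t)"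
  shows "P t"
proof (induct t rule: tensor.abs_induct)
  fix y :: "'a \<times> 'b \<Rightarrow>\<^sub>0 complex"
  show "P (abs_tensor y)"
    using free_induct[of y]
  proof (induct rule: free.span_induct_alt)
    case base
    have "abs_tensor 0 = (0 \<otimes>\<^sub>t 0 :: ('a, 'b) tensor)"
      using cbilinear_tensor[where 'a='a and 'b='b, unfolded cbilinear_iff]
      by (metis add_cancel_right_left zero_tensor.abs_eq)
    then show ?case using T by metis
  next
    case (step c x y)
    obtain a b where x: "x = free_of (a, b)" using step(1) by auto
    have "abs_tensor (free_scale c x) = (c *\<^sub>C a) \<otimes>\<^sub>t b"
      using cbilinear_tensor[where 'a='a and 'b='b, unfolded cbilinear_iff]
      by (simp add: x tensor.abs_eq[symmetric] scaleC_tensor.abs_eq[symmetric])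
    then have "abs_tensor (free_scale c x + y) = (c *\<^sub>C a) \<otimes>\<^sub>t b + abs_tensor y"
      by (simp add: plus_tensor.abs_eq[symmetric])
    then show ?case using T A step by metis
  qed
qed

lemma clinear_eq_tensorI:
  assumes "clinear f" "clinear g" "\<And>a b. f (a \<otimes>\<^sub>t b) = g (a \<otimes>\<^sub>t b)"
  shows "f t = g t"
  by (induct t rule: tensor_induct) (use assms in \<open>auto simp: clinear_iff\<close>)

lemmas tensor_bilin = cbilinear_tensor[unfolded cbilinear_iff, THEN conjunct1, rule_format]
  cbilinear_tensor[unfolded cbilinear_iff, THEN conjunct2, THEN conjunct1, rule_format]
  cbilinear_tensor[unfolded cbilinear_iff, THEN conjunct2, THEN conjunct2, THEN conjunct1, rule_format]
  cbilinear_tensor[unfolded cbilinear_iff, THEN conjunct2, THEN conjunct2, THEN conjunct2, rule_format]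

definition tensor_map ::
    "('a::complex_vector \<Rightarrow> 'c::complex_vector) \<Rightarrow> ('b::complex_vector \<Rightarrow> 'd::complex_vector)
      \<Rightarrow> ('a, 'b) tensor \<Rightarrow> ('c, 'd) tensor"
  where "tensor_map f g = tensor_lift (\<lambda>a b. f a \<otimes>\<^sub>t g b)"

lemma tensor_map_bilin:
  "clinear f \<Longrightarrow> clinear g \<Longrightarrow> cbilinear (\<lambda>a b. f a \<otimes>\<^sub>t g b)"
  by (simp add: cbilinear_iff clinear_iff tensor_bilin)

lemma tensor_map_tensor [simp]:
  "clinear f \<Longrightarrow> clinear g \<Longrightarrow> tensor_map f g (a \<otimes>\<^sub>t b) = f a \<otimes>\<^sub>t g b"
  by (simp add: tensor_map_def tensor_map_bilin)

lemma tensor_map_linear: "clinear f \<Longrightarrow> clinear g \<Longrightarrow> clinear (tensor_map f g)"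
  by (simp add: tensor_map_def tensor_map_bilin tensor_lift_linear)

lemma clinear_mult_left: "clinear ((*) a)" for a :: "'a::complex_algebra"
  by (simp add: clinear_iff algebra_simps mult_scaleC_right)

lemma clinear_mult_right: "clinear (\<lambda>b. b * a)" for a :: "'a::complex_algebra"
  by (simp add: clinear_iff algebra_simps mult_scaleC_left)

lemma clinear_compose: "clinear f \<Longrightarrow> clinear g \<Longrightarrow> clinear (\<lambda>x. f (g x))"
  by (simp add: clinear_iff)

lemma tensor_map_bilin2:
  assumes "\<And>a. clinear (F a)" "\<And>b. clinear (H b)" "cbilinear F" "cbilinear H"
  shows "cbilinear (\<lambda>a b. tensor_map (F a) (H b) t)"
proof -
  note L = tensor_map_linear[OF assms(1,2), unfolded clinear_iff, THEN conjunct1, rule_format]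
  note T = tensor_map_tensor[OF assms(1,2)]
  note F = assms(3)[unfolded cbilinear_iff]
  note H = assms(4)[unfolded cbilinear_iff]
  have "tensor_map (F (a + a')) (H b) t = tensor_map (F a) (H b) t + tensor_map (F a') (H b) t" for a a' b
  proof (induct t rule: tensor_induct)
    case (tensor x y)
    show ?case unfolding T by (simp only: F H tensor_bilin)
  next
    case (add s t)
    then show ?case by (simp add: L)
  qed
  moreover  have "tensor_map (F a) (H (b + b')) t = tensor_map (F a) (H b) t + tensor_map (F a) (H b') t" for a b b'
  proof (induct t rule: tensor_induct)
    case (tensor x y)
    show ?case unfolding T by (simp only: F H tensor_bilin)
  next
    case (add s t)
    then show ?case by (simp add: L)
  qed
  moreover  have "tensor_map (F (c *\<^sub>C a)) (H b) t = c *\<^sub>C tensor_map (F a) (H b) t" for a b c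
  proof (induct t rule: tensor_induct)
    case (tensor x y)
    show ?case unfolding T by (simp only: F H tensor_bilin)
  next
    case (add s t)
    then show ?case by (simp add: L scaleC_add_right)
  qed
  moreover  have "tensor_map (F a) (H (c *\<^sub>C b)) t = c *\<^sub>C tensor_map (F a) (H b) t" for a b c
  proof (induct t rule: tensor_induct)
    case (tensor x y)
    show ?case unfolding T by (simp only: F H tensor_bilin)
  next
    case (add s t)
    then show ?case by (simp add: L scaleC_add_right)
  qed
  ultimately show ?thesis by (simp add: cbilinear_iff)
qed

lemma cbilinear_mult: "cbilinear ((*) :: 'a::complex_algebra \<Rightarrow> 'a \<Rightarrow> 'a)"
  by (simp add: cbilinear_iff algebra_simps mult_scaleC_left mult_scaleC_right)

instantiation tensor :: (complex_algebra, complex_algebra) complex_algebra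
begin

definition times_tensor :: "('a, 'b) tensor \<Rightarrow> ('a, 'b) tensor \<Rightarrow> ('a, 'b) tensor"
  where "s * t = tensor_lift (\<lambda>a b. tensor_map ((*) a) ((*) b) t) s"

lemma times_tensor_bilin: "cbilinear (\<lambda>a b. tensor_map ((*) a) ((*) b) t)"
    for t :: "('a, 'b) tensor"
  by (intro tensor_map_bilin2 clinear_mult_left cbilinear_mult)

lemma times_tensor_linear1: "clinear (\<lambda>s. s * t)" for t :: "('a, 'b) tensor"
  unfolding times_tensor_def by (rule tensor_lift_linear[OF times_tensor_bilin])

lemma tensor_times_left: "(a \<otimes>\<^sub>t b) * t = tensor_map ((*) a) ((*) b) t" for t :: "('a, 'b) tensor"
  by (simp add: times_tensor_def times_tensor_bilin)

lemma tensor_times_tensor [simp]: "(a \<otimes>\<^sub>t b) * (c \<otimes>\<^sub>t d) = (a * c) \<otimes>\<^sub>t (b * d)" for a c :: 'a and b d :: 'b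
  by (simp add: tensor_times_left clinear_mult_left)

lemma times_tensor_linear2: "clinear (\<lambda>t. s * t)" for s :: "('a, 'b) tensor"
proof (induct s rule: tensor_induct)
  case (tensor a b)
  show ?case unfolding tensor_times_left by (intro tensor_map_linear clinear_mult_left)
next
  case (add s s')
  then show ?case
    using times_tensor_linear1 by (simp add: clinear_iff algebra_simps scaleC_add_right)
qed

instance
proof
  fix s t u :: "('a, 'b) tensor" and c
  note L = times_tensor_linear1[unfolded clinear_iff] times_tensor_linear2[unfolded clinear_iff]
  show "(s + t) * u = s * u + t * u" "s * (t + u) = s * t + s * u" using L by blast+
  show "(c *\<^sub>C s) * t = c *\<^sub>C (s * t)" "s * (c *\<^sub>C t) = c *\<^sub>C (s * t)" using L by blast+
  show "s * t * u = s * (t * u)"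
  proof (induct s rule: tensor_induct)
    case (tensor a b)
    show ?case
    proof (induct t rule: tensor_induct)
      case (tensor a' b')
      show ?case by (induct u rule: tensor_induct) (simp_all add: L mult.assoc)
    qed (simp add: L)
  qed (simp add: L)
qed

end

section \<open>The multiplier algebra\<close>

text \<open>
  A multiplier \<open>m\<close> of \<open>A\<close> is given by its left and right actions \<open>a \<mapsto> m a\<close> and
  \<open>a \<mapsto> a m\<close>, which are compatible in the sense that \<open>a (m b) = (a m) b\<close>.
\<close>

typedef (overloaded) ('a::complex_algebra) multiplier =
  "{(l :: 'a \<Rightarrow> 'a, r :: 'a \<Rightarrow> 'a). clinear l \<and> clinear r
     \<and> (\<forall>a b. l (a * b) = l a * b) \<and> (\<forall>a b. r (a * b) = a * r b) \<and> (\<forall>a b. a * l b = r a * b)}"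
  by (rule exI[of _ "(id, id)"]) (simp add: clinear_iff)

setup_lifting type_definition_multiplier

lift_definition lact :: "'a::complex_algebra multiplier \<Rightarrow> 'a \<Rightarrow> 'a" is fst .
lift_definition ract :: "'a::complex_algebra multiplier \<Rightarrow> 'a \<Rightarrow> 'a" is snd .

lemma multiplier_eqI: "lact m = lact n \<Longrightarrow> ract m = ract n \<Longrightarrow> m = n"
  by transfer (auto simp: prod_eq_iff)

lemma lact_linear: "clinear (lact m)"
  by transfer auto

lemma ract_linear: "clinear (ract m)"
  by transfer auto

instantiation multiplier :: (complex_algebra) "{complex_algebra, monoid_mult}"
begin

lift_definition zero_multiplier :: "'a multiplier" is "(\<lambda>_. 0, \<lambda>_. 0)"
  by (simp add: clinear_iff)
lift_definition one_multiplier :: "'a multiplier" is "(\<lambda>a. a, \<lambda>a. a)"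
  by (simp add: clinear_iff)
lift_definition plus_multiplier :: "'a multiplier \<Rightarrow> 'a multiplier \<Rightarrow> 'a multiplier"
  is "\<lambda>(l, r) (l', r'). (\<lambda>a. l a + l' a, \<lambda>a. r a + r' a)"
  by (auto simp: clinear_iff algebra_simps scaleC_add_right)
lift_definition uminus_multiplier :: "'a multiplier \<Rightarrow> 'a multiplier"
  is "\<lambda>(l, r). (\<lambda>a. - l a, \<lambda>a. - r a)"
  by (auto simp: clinear_iff algebra_simps)
lift_definition minus_multiplier :: "'a multiplier \<Rightarrow> 'a multiplier \<Rightarrow> 'a multiplier"
  is "\<lambda>(l, r) (l', r'). (\<lambda>a. l a - l' a, \<lambda>a. r a - r' a)"
  by (auto simp: clinear_iff algebra_simps complex_vector.scale_right_diff_distrib)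
lift_definition scaleC_multiplier :: "complex \<Rightarrow> 'a multiplier \<Rightarrow> 'a multiplier"
  is "\<lambda>c (l, r). (\<lambda>a. c *\<^sub>C l a, \<lambda>a. c *\<^sub>C r a)"
  by (auto simp: clinear_iff scaleC_add_right scaleC_scaleC mult.commute
      mult_scaleC_left mult_scaleC_right)
lift_definition times_multiplier :: "'a multiplier \<Rightarrow> 'a multiplier \<Rightarrow> 'a multiplier"
  is "\<lambda>(l, r) (l', r'). (\<lambda>a. l (l' a), \<lambda>a. r' (r a))"
  by (auto simp: clinear_iff)

lemma lact_simps [simp]:
  "lact 0 = (\<lambda>_. 0)" "lact 1 = (\<lambda>a. a)" "lact (m + n) = (\<lambda>a. lact m a + lact n a)"
  "lact (- m) = (\<lambda>a. - lact m a)" "lact (m - n) = (\<lambda>a. lact m a - lact n a)"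
  "lact (c *\<^sub>C m) = (\<lambda>a. c *\<^sub>C lact m a)" "lact (m * n) = (\<lambda>a. lact m (lact n a))"
  for m n :: "'a multiplier"
  by (transfer, simp add: split_beta)+

lemma ract_simps [simp]:
  "ract 0 = (\<lambda>_. 0)" "ract 1 = (\<lambda>a. a)" "ract (m + n) = (\<lambda>a. ract m a + ract n a)"
  "ract (- m) = (\<lambda>a. - ract m a)" "ract (m - n) = (\<lambda>a. ract m a - ract n a)"
  "ract (c *\<^sub>C m) = (\<lambda>a. c *\<^sub>C ract m a)" "ract (m * n) = (\<lambda>a. ract n (ract m a))"
  for m n :: "'a multiplier"
  by (transfer, simp add: split_beta)+

instance
  by standard
    (rule multiplier_eqI;
      simp add: fun_eq_iff add.assoc add.commute scaleC_add_right scaleC_add_left scaleC_scaleC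
        scaleC_one lact_linear[unfolded clinear_iff] ract_linear[unfolded clinear_iff])+

end

text \<open>The canonical map from \<open>A\<close> to \<open>M(A)\<close>; it is injective if the product of \<open>A\<close> is
  non-degenerate, and then \<open>unembed\<close> is its inverse.\<close>

lift_definition embed :: "'a::complex_algebra \<Rightarrow> 'a multiplier"
  is "\<lambda>a. (\<lambda>b. a * b, \<lambda>b. b * a)"
  by (simp add: clinear_mult_left clinear_mult_right mult.assoc)

definition unembed :: "'a::complex_algebra multiplier \<Rightarrow> 'a"
  where "unembed = the_inv embed"

text \<open>The canonical map from \<open>M(A) \<times> M(B)\<close> to \<open>M(A \<otimes> B)\<close>.\<close>

lemma tensor_map_multiplier:
  fixes l r :: "'a::complex_algebra \<Rightarrow> 'a" and l' r' :: "'b::complex_algebra \<Rightarrow> 'b"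
  assumes l: "clinear l" "clinear r" "\<And>a b. l (a * b) = l a * b" "\<And>a b. r (a * b) = a * r b"
      "\<And>a b. a * l b = r a * b"
    and l': "clinear l'" "clinear r'" "\<And>a b. l' (a * b) = l' a * b" "\<And>a b. r' (a * b) = a * r' b"
      "\<And>a b. a * l' b = r' a * b"
  shows "clinear (tensor_map l l')" "clinear (tensor_map r r')"
    "tensor_map l l' (s * t) = tensor_map l l' s * t"
    "tensor_map r r' (s * t) = s * tensor_map r r' t"
    "s * tensor_map l l' t = tensor_map r r' s * t"
proof -
  show L: "clinear (tensor_map l l')" "clinear (tensor_map r r')"
    using l l' by (simp_all add: tensor_map_linear)
  note L' = L[unfolded clinear_iff]
  show "tensor_map l l' (s * t) = tensor_map l l' s * t"
  proof (induct s rule: tensor_induct)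
    case (tensor a b)
    show ?case by (induct t rule: tensor_induct) (use l l' in \<open>simp_all add: L' distrib_left\<close>)
  qed (simp add: L' distrib_right)
  show "tensor_map r r' (s * t) = s * tensor_map r r' t"
  proof (induct s rule: tensor_induct)
    case (tensor a b)
    show ?case by (induct t rule: tensor_induct) (use l l' in \<open>simp_all add: L' distrib_left\<close>)
  qed (simp add: L' distrib_right)
  show "s * tensor_map l l' t = tensor_map r r' s * t"
  proof (induct s rule: tensor_induct)
    case (tensor a b)
    show ?case by (induct t rule: tensor_induct) (use l l' in \<open>simp_all add: L' distrib_left\<close>)
  qed (simp add: L' distrib_right)
qed

lift_definition multiplier_tensor ::
    "'a::complex_algebra multiplier \<Rightarrow> 'b::complex_algebra multiplier \<Rightarrow> ('a, 'b) tensor multiplier"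
    (infixl "\<otimes>\<^sub>M" 70)
  is "\<lambda>(l, r) (l', r'). (tensor_map l l', tensor_map r r')"
  by (clarsimp simp: tensor_map_linear; intro conjI allI; rule tensor_map_multiplier(3-5); blast)

definition invertible :: "'a::monoid_mult \<Rightarrow> bool"
  where "invertible m \<longleftrightarrow> (\<exists>n. m * n = 1 \<and> n * m = 1)"

definition minverse :: "'a::monoid_mult \<Rightarrow> 'a"
  where "minverse m = (THE n. m * n = 1 \<and> n * m = 1)"

text \<open>
  The extension to \<open>M(A)\<close> of a non-degenerate homomorphism \<open>f : A \<rightarrow> M(B)\<close>, and of an
  anti-automorphism of \<open>A\<close>: the multiplier \<open>f m\<close> is determined by \<open>f m f a = f (m a)\<close> and
  \<open>f a f m = f (a m)\<close>, respectively by \<open>f m f a = f (a m)\<close> and \<open>f a f m = f (m a)\<close>.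
\<close>

definition mult_ext :: "('a::complex_algebra \<Rightarrow> 'b::complex_algebra multiplier) \<Rightarrow> 'a multiplier \<Rightarrow> 'b multiplier"
  where "mult_ext f m = (THE n. \<forall>a. n * f a = f (lact m a) \<and> f a * n = f (ract m a))"

definition mult_antiext :: "('a::complex_algebra \<Rightarrow> 'a) \<Rightarrow> 'a multiplier \<Rightarrow> 'a multiplier"
  where "mult_antiext f m = (THE n. \<forall>a. lact n (f a) = f (ract m a) \<and> ract n (f a) = f (lact m a))"

text \<open>\<open>f \<otimes> g\<close> for maps \<open>f : A \<rightarrow> M(C)\<close> and \<open>g : B \<rightarrow> M(D)\<close>, as a map \<open>A \<otimes> B \<rightarrow> M(C \<otimes> D)\<close>.\<close>

definition mult_tensor_map ::
    "('a::complex_vector \<Rightarrow> 'c::complex_algebra multiplier) \<Rightarrow> ('b::complex_vector \<Rightarrow> 'd::complex_algebra multiplier)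
      \<Rightarrow> ('a, 'b) tensor \<Rightarrow> ('c, 'd) tensor multiplier"
  where "mult_tensor_map f g = tensor_lift (\<lambda>a b. f a \<otimes>\<^sub>M g b)"

definition tensor_flip :: "('a::complex_vector, 'b::complex_vector) tensor \<Rightarrow> ('b, 'a) tensor"
  where "tensor_flip = tensor_lift (\<lambda>a b. b \<otimes>\<^sub>t a)"

definition tensor_reassoc ::
    "('a::complex_vector, ('b::complex_vector, 'c::complex_vector) tensor) tensor \<Rightarrow> (('a, 'b) tensor, 'c) tensor"
  where "tensor_reassoc = tensor_lift (\<lambda>a. tensor_lift (\<lambda>b c. (a \<otimes>\<^sub>t b) \<otimes>\<^sub>t c))"

abbreviation mult_flip :: "('a::complex_algebra, 'b::complex_algebra) tensor multiplier \<Rightarrow> ('b, 'a) tensor multiplier"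
  where "mult_flip \<equiv> mult_ext (\<lambda>t. embed (tensor_flip t))"

abbreviation mult_reassoc ::
    "('a::complex_algebra, ('b::complex_algebra, 'c::complex_algebra) tensor) tensor multiplier
      \<Rightarrow> (('a, 'b) tensor, 'c) tensor multiplier"
  where "mult_reassoc \<equiv> mult_ext (\<lambda>t. embed (tensor_reassoc t))"

text \<open>Triple tensor products are written as \<open>(A \<otimes> A) \<otimes> A\<close>.\<close>

definition leg12 :: "('a::complex_algebra, 'a) tensor multiplier \<Rightarrow> (('a, 'a) tensor, 'a) tensor multiplier"
  where "leg12 = mult_ext (tensor_lift (\<lambda>a b. (embed a \<otimes>\<^sub>M embed b) \<otimes>\<^sub>M 1))"

definition leg13 :: "('a::complex_algebra, 'a) tensor multiplier \<Rightarrow> (('a, 'a) tensor, 'a) tensor multiplier"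
  where "leg13 = mult_ext (tensor_lift (\<lambda>a b. (embed a \<otimes>\<^sub>M 1) \<otimes>\<^sub>M embed b))"

definition leg23 :: "('a::complex_algebra, 'a) tensor multiplier \<Rightarrow> (('a, 'a) tensor, 'a) tensor multiplier"
  where "leg23 = mult_ext (tensor_lift (\<lambda>a b. (1 \<otimes>\<^sub>M embed a) \<otimes>\<^sub>M embed b))"

section \<open>Multiplier Hopf algebras\<close>

type_synonym 'a coproduct = "'a \<Rightarrow> ('a, 'a) tensor multiplier"

definition nondegenerate_product :: "'a::complex_algebra itself \<Rightarrow> bool"
  where "nondegenerate_product _ \<longleftrightarrow>
    (\<forall>a::'a. (\<forall>b. a * b = 0) \<longrightarrow> a = 0) \<and> (\<forall>a::'a. (\<forall>b. b * a = 0) \<longrightarrow> a = 0)"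

definition multiplier_hopf_algebra :: "'a::complex_algebra coproduct \<Rightarrow> bool"
  where "multiplier_hopf_algebra \<Delta> \<longleftrightarrow>
    nondegenerate_product TYPE('a) \<and> algebra_hom \<Delta>
    \<and> bij_betw (tensor_lift (\<lambda>a b. \<Delta> a * (1 \<otimes>\<^sub>M embed b))) UNIV (range embed)
    \<and> bij_betw (tensor_lift (\<lambda>a b. (embed a \<otimes>\<^sub>M 1) * \<Delta> b)) UNIV (range embed)
    \<and> (\<forall>a b c.
          ((embed a \<otimes>\<^sub>M 1) \<otimes>\<^sub>M 1) * mult_tensor_map \<Delta> embed (unembed (\<Delta> b * (1 \<otimes>\<^sub>M embed c)))
        = mult_reassoc (mult_tensor_map embed \<Delta> (unembed ((embed a \<otimes>\<^sub>M 1) * \<Delta> b)))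
            * ((1 \<otimes>\<^sub>M 1) \<otimes>\<^sub>M embed c))"

definition coproduct_cop :: "'a::complex_algebra coproduct \<Rightarrow> 'a coproduct"
  where "coproduct_cop \<Delta> a = mult_flip (\<Delta> a)"

definition regular_multiplier_hopf_algebra :: "'a::complex_algebra coproduct \<Rightarrow> bool"
  where "regular_multiplier_hopf_algebra \<Delta> \<longleftrightarrow>
    multiplier_hopf_algebra \<Delta> \<and> multiplier_hopf_algebra (coproduct_cop \<Delta>)"

text \<open>
  By Van Daele's theorems a multiplier Hopf algebra has exactly one counit and one antipode;
  in the regular case, the only one considered here, the antipode maps \<open>A\<close> to \<open>A\<close>.
\<close>

definition is_counit :: "'a::complex_algebra coproduct \<Rightarrow> ('a \<Rightarrow> complex) \<Rightarrow> bool"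
  where "is_counit \<Delta> \<epsilon> \<longleftrightarrow> algebra_hom \<epsilon>
    \<and> (\<forall>a b. tensor_lift (\<lambda>x y. \<epsilon> x *\<^sub>C y) (unembed (\<Delta> a * (1 \<otimes>\<^sub>M embed b))) = a * b)
    \<and> (\<forall>a b. tensor_lift (\<lambda>x y. \<epsilon> y *\<^sub>C x) (unembed ((embed a \<otimes>\<^sub>M 1) * \<Delta> b)) = a * b)"

definition is_antipode :: "'a::complex_algebra coproduct \<Rightarrow> ('a \<Rightarrow> complex) \<Rightarrow> ('a \<Rightarrow> 'a) \<Rightarrow> bool"
  where "is_antipode \<Delta> \<epsilon> S \<longleftrightarrow> algebra_antihom S
    \<and> (\<forall>a b. tensor_lift (\<lambda>x y. S x * y) (unembed (\<Delta> a * (1 \<otimes>\<^sub>M embed b))) = \<epsilon> a *\<^sub>C b)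
    \<and> (\<forall>a b. tensor_lift (\<lambda>x y. x * S y) (unembed ((embed a \<otimes>\<^sub>M 1) * \<Delta> b)) = \<epsilon> b *\<^sub>C a)"

section \<open>Group-cogradings, crossings and the deformed structure\<close>

definition cograded ::
    "('g, 'm) monoid_scheme \<Rightarrow> 'a::complex_algebra coproduct \<Rightarrow> ('g \<Rightarrow> 'a set) \<Rightarrow> bool"
  where "cograded G \<Delta> A \<longleftrightarrow>
    (\<forall>p\<in>carrier G. csubspace (A p) \<and> (\<forall>a\<in>A p. \<forall>b\<in>A p. a * b \<in> A p))
    \<and> (\<forall>a. \<exists>!f. (\<forall>p\<in>carrier G. f p \<in> A p) \<and> (\<forall>p. p \<notin> carrier G \<longrightarrow> f p = 0)
          \<and> finite {p. f p \<noteq> 0} \<and> a = (\<Sum>p | f p \<noteq> 0. f p))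
    \<and> (\<forall>p\<in>carrier G. \<forall>q\<in>carrier G. p \<noteq> q \<longrightarrow> (\<forall>a\<in>A p. \<forall>b\<in>A q. a * b = 0))
    \<and> (\<forall>p\<in>carrier G. \<forall>q\<in>carrier G.
          cspan {\<Delta> a * (1 \<otimes>\<^sub>M embed b) | a b. a \<in> A (p \<otimes>\<^bsub>G\<^esub> q) \<and> b \<in> A q}
            = embed ` cspan {x \<otimes>\<^sub>t y | x y. x \<in> A p \<and> y \<in> A q}
        \<and> cspan {(embed a \<otimes>\<^sub>M 1) * \<Delta> b | a b. a \<in> A p \<and> b \<in> A (p \<otimes>\<^bsub>G\<^esub> q)}
            = embed ` cspan {x \<otimes>\<^sub>t y | x y. x \<in> A p \<and> y \<in> A q})"

abbreviation mult_diag :: "('a::complex_algebra \<Rightarrow> 'a) \<Rightarrow> ('a, 'a) tensor multiplier \<Rightarrow> ('a, 'a) tensor multiplier"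
  where "mult_diag f \<equiv> mult_ext (\<lambda>t. embed (tensor_map f f t))"

definition crossing ::
    "('g, 'm) monoid_scheme \<Rightarrow> 'a::complex_algebra coproduct \<Rightarrow> ('g \<Rightarrow> 'a set) \<Rightarrow> ('g \<Rightarrow> 'a \<Rightarrow> 'a) \<Rightarrow> bool"
  where "crossing G \<Delta> A \<pi> \<longleftrightarrow>
    (\<forall>p\<in>carrier G. algebra_hom (\<pi> p) \<and> bij (\<pi> p))
    \<and> (\<forall>p\<in>carrier G. \<forall>q\<in>carrier G. \<pi> (p \<otimes>\<^bsub>G\<^esub> q) = \<pi> p \<circ> \<pi> q)
    \<and> (\<forall>p\<in>carrier G. \<forall>a. \<Delta> (\<pi> p a) = mult_diag (\<pi> p) (\<Delta> a))
    \<and> (\<forall>p\<in>carrier G. \<forall>q\<in>carrier G. \<pi> p ` A q = A (p \<otimes>\<^bsub>G\<^esub> q \<otimes>\<^bsub>G\<^esub> inv\<^bsub>G\<^esub> p))"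

definition deformed_coproduct ::
    "('g, 'm) monoid_scheme \<Rightarrow> 'a::complex_algebra coproduct \<Rightarrow> ('g \<Rightarrow> 'a set) \<Rightarrow> ('g \<Rightarrow> 'a \<Rightarrow> 'a)
      \<Rightarrow> 'a coproduct"
  where "deformed_coproduct G \<Delta> A \<pi> a =
    (THE m. \<forall>q\<in>carrier G. \<forall>a'\<in>A q.
        m * (1 \<otimes>\<^sub>M embed a')
      = embed (tensor_map (\<pi> (inv\<^bsub>G\<^esub> q)) id (unembed (\<Delta> a * (1 \<otimes>\<^sub>M embed a')))))"

definition deformed_antipode ::
    "('g, 'm) monoid_scheme \<Rightarrow> ('g \<Rightarrow> 'a::complex_algebra set) \<Rightarrow> ('g \<Rightarrow> 'a \<Rightarrow> 'a) \<Rightarrow> ('a \<Rightarrow> 'a) \<Rightarrow> ('a \<Rightarrow> 'a)"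
  where "deformed_antipode G A \<pi> S =
    (THE T. clinear T \<and> (\<forall>p\<in>carrier G. \<forall>a\<in>A p. T a = \<pi> (inv\<^bsub>G\<^esub> p) (S a)))"

section \<open>Quasitriangular structures\<close>

text \<open>The canonical map from \<open>A \<otimes> M(A)\<close> to \<open>M(A \<otimes> A)\<close>; its range is \<open>A \<otimes> M(A)\<close> viewed inside
  \<open>M(A \<otimes> A)\<close>.\<close>

definition half_embed :: "('a::complex_algebra, 'a multiplier) tensor \<Rightarrow> ('a, 'a) tensor multiplier"
  where "half_embed = tensor_lift (\<lambda>a m. embed a \<otimes>\<^sub>M m)"

definition generalized_matrix ::
    "('g, 'm) monoid_scheme \<Rightarrow> 'a::complex_algebra coproduct \<Rightarrow> ('g \<Rightarrow> 'a set) \<Rightarrow> ('g \<Rightarrow> 'a \<Rightarrow> 'a)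
      \<Rightarrow> ('a, 'a) tensor multiplier \<Rightarrow> bool"
  where "generalized_matrix G \<Delta> A \<pi> R \<longleftrightarrow>
    invertible R
    \<and> (\<forall>p\<in>carrier G. mult_diag (\<pi> p) R = R)
    \<and> (\<forall>a. R * \<Delta> a = coproduct_cop (deformed_coproduct G \<Delta> A \<pi>) a * R)
    \<and> mult_ext (mult_tensor_map (deformed_coproduct G \<Delta> A \<pi>) embed) R = leg13 R * leg23 R
    \<and> mult_reassoc (mult_ext (mult_tensor_map embed \<Delta>) R) = leg13 R * leg12 R
    \<and> (\<forall>a. R * (embed a \<otimes>\<^sub>M 1) \<in> range half_embed)
    \<and> (\<forall>a. (embed a \<otimes>\<^sub>M 1) * R \<in> range half_embed)"

text \<open>The multiplier \<open>u\<close> with \<open>u a = \<Sum> \<S>(R\<^sup>2) R\<^sup>1 a\<close>, where \<open>R (a \<otimes> 1) = \<Sum> R\<^sup>1 a \<otimes> R\<^sup>2\<close> in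
  \<open>A \<otimes> M(A)\<close> and \<open>\<S>\<close> is the deformed antipode, extended to \<open>M(A)\<close>.\<close>

definition is_drinfeld_multiplier ::
    "('g, 'm) monoid_scheme \<Rightarrow> ('g \<Rightarrow> 'a::complex_algebra set) \<Rightarrow> ('g \<Rightarrow> 'a \<Rightarrow> 'a) \<Rightarrow> ('a \<Rightarrow> 'a)
      \<Rightarrow> ('a, 'a) tensor multiplier \<Rightarrow> 'a multiplier \<Rightarrow> bool"
  where "is_drinfeld_multiplier G A \<pi> S R u \<longleftrightarrow>
    (\<forall>a t. half_embed t = R * (embed a \<otimes>\<^sub>M 1) \<longrightarrow>
       lact u a = tensor_lift (\<lambda>x m. lact (mult_antiext (deformed_antipode G A \<pi> S) m) x) t)"

end

(*
  Let T be the deformed antipode and psi(t) = Theta(R t), where Theta(x (x) y) = T(y) x.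
  The antipode axiom turns the relation R Delta(a) = Delta~cop(a) R into psi(Delta(a) t) = eps(a) psi(t), and bijectivity of
  a (x) b -> Delta(a)(1 (x) b) turns this into psi(a x (x) y) = psi(x (x) S(a) y).  Since
  psi(x (x) y) = T(y) (u x), it says u a = T(S(a)) u, where T(S(a)) = pi_p(S^2(a)) for a in A_p.
  The same identity provides the right action of u, and invertibility of R makes x -> u x bijective.
  Applying S to u a = T(S(a)) u yields a S(u) = S(u) pi_{p^-1}(S^2(a)); comparing both
  for d = pi_{p^-1}(S^2(a)) gives the formula for S^4.

  S is bijective because the same shift, applied to x (x) y -> S(y) x for the co-opposite structure,
  gives S(S'(a) b) = S(b) a, where S' is the (a priori left-multiplier-valued) co-opposite antipode;
  exchanging the roles of S and S' gives injectivity.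
*)
theory Submission
  imports Defs
begin

section \<open>Tensor products of non-degenerate algebras\<close>

text \<open>\<open>\<Delta>\<close>, \<open>R\<close> and the deformed coproduct have multiplier
  values, so Sweedler sums are not directly available: identities are tested on elements of A
  \<otimes> A, with spare factors that non-degeneracy cancels afterwards. The antipode enters as
  \<open>left_antipode\<close>, which is read off the inverse of \<open>T1\<close> and therefore
  makes sense for the co-opposite coproduct before an antipode with values in A is known for it. The
  deformation is carried by one automorphism of A \<otimes> A, \<open>deform\<close>, and the
  deformed coproduct is \<open>\<Delta>\<close> conjugated by it. Invariance of
  \<open>\<psi>\<close> is then inherited from \<open>left_antipode\<close>: since S maps A_p into
  A_{p^-1}, only those components survive in \<open>\<Theta>\<close> after flip and
  \<open>deform\<close> on which the automorphism inside T cancels the one inside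
  \<open>deform\<close>. Conjugation by u gives only pi_p(S^2(a)); the crossing leaves the final
  formula because the relation for S(u) carries pi_{p^-1}. The zero algebra is treated apart,
  because elements of counit 1 are used throughout.\<close>

lemma clinear_add: "clinear f \<Longrightarrow> f (x + y) = f x + f y"
  by (simp add: clinear_iff)

lemma clinear_scale: "clinear f \<Longrightarrow> f (c *\<^sub>C x) = c *\<^sub>C f x"
  by (simp add: clinear_iff)

lemma clinear_zero: "clinear f \<Longrightarrow> f 0 = 0"
  by (metis clinear_add add_cancel_right_right)

lemma clinear_diff: "clinear f \<Longrightarrow> f (x - y) = f x - f y"
  by (metis clinear_add add_diff_cancel diff_add_cancel)

lemma clinear_sum: "clinear f \<Longrightarrow> f (sum g K) = (\<Sum>k\<in>K. f (g k))"
  by (induct K rule: infinite_finite_induct) (simp_all add: clinear_add clinear_zero)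

lemma clinear_id: "clinear (\<lambda>x. x)"
  by (simp add: clinear_iff)

lemma tensor_lift_add: "cbilinear f \<Longrightarrow> tensor_lift f (s + t) = tensor_lift f s + tensor_lift f t"
  by (rule clinear_add[OF tensor_lift_linear])

lemma tensor_lift_scale: "cbilinear f \<Longrightarrow> tensor_lift f (c *\<^sub>C t) = c *\<^sub>C tensor_lift f t"
  by (rule clinear_scale[OF tensor_lift_linear])

lemma tensor_zero [simp]: "0 \<otimes>\<^sub>t b = 0" "a \<otimes>\<^sub>t 0 = 0"
  using tensor_bilin(1)[of 0 0 b] tensor_bilin(2)[of a 0 0] by simp_all

lemma tensor_sum_left: "(\<Sum>k\<in>K. f k) \<otimes>\<^sub>t b = (\<Sum>k\<in>K. f k \<otimes>\<^sub>t b)"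
  by (induct K rule: infinite_finite_induct) (simp_all add: tensor_bilin)

abbreviation basis :: "'a::complex_vector set"
  where "basis \<equiv> complex_vector.extend_basis {}"

section \<open>Coordinates, slice maps and non-degeneracy of tensor products\<close>

abbreviation coord :: "'a::complex_vector \<Rightarrow> 'a \<Rightarrow> complex"
  where "coord e x \<equiv> complex_vector.representation basis x e"

lemma scaleC_complex: "c *\<^sub>C (d::complex) = c * d"
  by (simp add: scaleC_complex_def)

lemma basis:
  "complex_vector.independent (basis :: 'a::complex_vector set)"
  "x \<in> cspan (basis :: 'a::complex_vector set)"
  by (rule complex_vector.independent_extend_basis[OF complex_vector.independent_empty])
    (simp only: complex_vector.span_extend_basis[OF complex_vector.independent_empty] UNIV_I)

lemma clinear_coord: "clinear (coord e)"
  unfolding clinear_iff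
  by (simp add: complex_vector.representation_add[OF basis(1) basis(2) basis(2)] complex_vector.representation_scale[OF basis]
      scaleC_complex)

lemma coord_basis: "b \<in> basis \<Longrightarrow> coord e b = (if e = b then 1 else 0)"
  by (subst complex_vector.representation_basis[OF basis(1)]) simp_all

lemma coord_expansion: "(\<Sum>e | coord e x \<noteq> 0. coord e x *\<^sub>C e) = x"
  by (rule complex_vector.sum_nonzero_representation_eq[OF basis])

lemma functionals_separate:
  assumes "\<And>\<phi>::'a::complex_vector \<Rightarrow> complex. clinear \<phi> \<Longrightarrow> \<phi> x = 0"
  shows "x = 0"
  using coord_expansion[of x] assms[OF clinear_coord] by simp

text \<open>Only the first legs are expanded in the basis; the second legs absorb the coordinates,
  so that a coordinate functional recovers each of them.\<close>

lemma tensor_basis_expansion: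
  "\<exists>E b. finite E \<and> E \<subseteq> basis \<and> t = (\<Sum>e\<in>E. e \<otimes>\<^sub>t b e)"
proof (induct t rule: tensor_induct)
  case (tensor a c)
  let ?E = "{e. coord e a \<noteq> 0}"
  have "a \<otimes>\<^sub>t c = (\<Sum>e\<in>?E. e \<otimes>\<^sub>t (coord e a *\<^sub>C c))"
    by (subst (1) coord_expansion[of a, symmetric], unfold tensor_sum_left) (simp add: tensor_bilin)
  moreover have "finite ?E" "?E \<subseteq> basis"
    using complex_vector.finite_representation complex_vector.representation_ne_zero by blast+
  ultimately show ?case by (intro exI[of _ ?E] exI[of _ "\<lambda>e. coord e a *\<^sub>C c"]) simp
next
  case (add s t)
  then obtain E b F c where s: "finite E" "E \<subseteq> basis" "s = (\<Sum>e\<in>E. e \<otimes>\<^sub>t b e)"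
    and t: "finite F" "F \<subseteq> basis" "t = (\<Sum>e\<in>F. e \<otimes>\<^sub>t c e)" by blast
  \<comment> \<open>Extension by zero lets both sums run over \<open>E \<union> F\<close>.\<close>
  define b' where "b' e = (if e \<in> E then b e else 0)" for e
  define c' where "c' e = (if e \<in> F then c e else 0)" for e
  have "s = (\<Sum>e\<in>E \<union> F. e \<otimes>\<^sub>t b' e)"
    unfolding s(3) b'_def using s(1) t(1) by (intro sum.mono_neutral_cong_left) auto
  moreover have "t = (\<Sum>e\<in>E \<union> F. e \<otimes>\<^sub>t c' e)"
    unfolding t(3) c'_def using s(1) t(1) by (intro sum.mono_neutral_cong_left) auto
  ultimately have "s + t = (\<Sum>e\<in>E \<union> F. e \<otimes>\<^sub>t (b' e + c' e))"
    by (simp add: tensor_bilin sum.distrib)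
  then show ?case using s(1,2) t(1,2) by (intro exI[of _ "E \<union> F"] exI[of _ "\<lambda>e. b' e + c' e"]) simp
qed

abbreviation slice_left :: "('a::complex_vector \<Rightarrow> complex) \<Rightarrow> ('a, 'b::complex_vector) tensor \<Rightarrow> 'b"
  where "slice_left \<phi> \<equiv> tensor_lift (\<lambda>x y. \<phi> x *\<^sub>C y)"

abbreviation slice_right :: "('b::complex_vector \<Rightarrow> complex) \<Rightarrow> ('a::complex_vector, 'b) tensor \<Rightarrow> 'a"
  where "slice_right \<phi> \<equiv> tensor_lift (\<lambda>x y. \<phi> y *\<^sub>C x)"

lemma slice_bilin:
  assumes "clinear (\<phi> :: 'a::complex_vector \<Rightarrow> complex)"
  shows "cbilinear (\<lambda>x (y::'b::complex_vector). \<phi> x *\<^sub>C y)"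
    "cbilinear (\<lambda>(y::'b::complex_vector) x. \<phi> x *\<^sub>C y)"
  using assms by (simp_all add: cbilinear_iff clinear_iff scaleC_add_left scaleC_add_right
      scaleC_scaleC scaleC_complex mult.commute)

lemma tensor_eq_0_slice_left:
  assumes "\<And>\<phi>. clinear \<phi> \<Longrightarrow> slice_left \<phi> t = 0"
  shows "t = 0"
proof -
  obtain E b where t: "finite E" "E \<subseteq> basis" "t = (\<Sum>e\<in>E. e \<otimes>\<^sub>t b e)"
    using tensor_basis_expansion by blast
  have "b e = 0" if "e \<in> E" for e
  proof -
    note l = slice_bilin(1)[OF clinear_coord[of e]]
    have "slice_left (coord e) t = (\<Sum>e'\<in>E. coord e e' *\<^sub>C b e')"
      unfolding t(3) by (simp add: clinear_sum[OF tensor_lift_linear[OF l]] l)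
    also have "\<dots> = (\<Sum>e'\<in>E. if e = e' then b e else 0)"
      using t(2) by (intro sum.cong) (auto simp: coord_basis scaleC_one)
    finally show ?thesis using assms[OF clinear_coord] that t(1) by simp
  qed
  then show ?thesis using t(3) by simp
qed

text \<open>Slicing both legs gives the same number in either order, and functionals separate
  points, so right slices reduce to left slices.\<close>

lemma tensor_eq_0_slice_right:
  assumes "\<And>\<phi>. clinear \<phi> \<Longrightarrow> slice_right \<phi> t = 0"
  shows "t = 0"
proof (rule tensor_eq_0_slice_left)
  fix \<phi> :: "'b \<Rightarrow> complex" assume \<phi>: "clinear \<phi>"
  show "slice_left \<phi> t = 0"
  proof (rule functionals_separate)
    fix \<psi> :: "'a \<Rightarrow> complex" assume \<psi>: "clinear \<psi>"
    note b = slice_bilin(1)[OF \<phi>] slice_bilin(2)[OF \<psi>]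
    have "\<psi> (slice_left \<phi> t) = \<phi> (slice_right \<psi> t)"
      by (induct t rule: tensor_induct)
        (simp_all add: b tensor_lift_add clinear_add[OF \<phi>] clinear_add[OF \<psi>]
          clinear_scale[OF \<phi>] clinear_scale[OF \<psi>] scaleC_complex mult.commute)
    then show "\<psi> (slice_left \<phi> t) = 0" by (simp add: assms[OF \<psi>] clinear_zero[OF \<phi>])
  qed
qed

lemma nondegenerate_productD:
  fixes a :: "'a::complex_algebra"
  assumes "nondegenerate_product TYPE('a)"
  shows "(\<And>b. a * b = 0) \<Longrightarrow> a = 0" "(\<And>b. b * a = 0) \<Longrightarrow> a = 0"
  using assms unfolding nondegenerate_product_def by blast+

lemma nondegenerate_product_eqI:
  fixes a a' :: "'a::complex_algebra"
  assumes "nondegenerate_product TYPE('a)"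
  shows "(\<And>b. a * b = a' * b) \<Longrightarrow> a = a'" "(\<And>b. b * a = b * a') \<Longrightarrow> a = a'"
  using nondegenerate_productD[OF assms, of "a - a'"] by (simp_all add: algebra_simps)

lemma slice_left_times:
  fixes t :: "('a::complex_algebra, 'b::complex_algebra) tensor"
  assumes \<psi>: "clinear \<psi>"
  shows "slice_left \<psi> (tensor_map (\<lambda>z. z * x) (\<lambda>y. y) t) * y = slice_left \<psi> (t * (x \<otimes>\<^sub>t y))"
    "y * slice_left \<psi> (tensor_map (\<lambda>z. x * z) (\<lambda>y. y) t) = slice_left \<psi> ((x \<otimes>\<^sub>t y) * t)"
proof -
  note l = clinear_add[OF tensor_lift_linear[OF slice_bilin(1)[OF \<psi>]]]
    clinear_add[OF tensor_map_linear[OF clinear_mult_right[of x] clinear_id]]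
    clinear_add[OF tensor_map_linear[OF clinear_mult_left[of x] clinear_id]]
  note t = tensor_lift_tensor[OF slice_bilin(1)[OF \<psi>]]
    tensor_map_tensor[OF clinear_mult_right[of x] clinear_id]
    tensor_map_tensor[OF clinear_mult_left[of x] clinear_id]
  show "slice_left \<psi> (tensor_map (\<lambda>z. z * x) (\<lambda>y. y) t) * y = slice_left \<psi> (t * (x \<otimes>\<^sub>t y))"
    by (induct t rule: tensor_induct)
      (simp_all only: t l distrib_left distrib_right mult_scaleC_left tensor_times_tensor)
  show "y * slice_left \<psi> (tensor_map (\<lambda>z. x * z) (\<lambda>y. y) t) = slice_left \<psi> ((x \<otimes>\<^sub>t y) * t)"
    by (induct t rule: tensor_induct)
      (simp_all only: t l distrib_left distrib_right mult_scaleC_right tensor_times_tensor)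
qed

lemma slice_right_times:
  fixes t :: "('a::complex_algebra, 'b::complex_vector) tensor"
  assumes \<phi>: "clinear \<phi>"
  shows "slice_right \<phi> t * x = slice_right \<phi> (tensor_map (\<lambda>z. z * x) (\<lambda>y. y) t)"
    "x * slice_right \<phi> t = slice_right \<phi> (tensor_map (\<lambda>z. x * z) (\<lambda>y. y) t)"
proof -
  note l = clinear_add[OF tensor_lift_linear[OF slice_bilin(2)[OF \<phi>]]]
    clinear_add[OF tensor_map_linear[OF clinear_mult_right[of x] clinear_id]]
    clinear_add[OF tensor_map_linear[OF clinear_mult_left[of x] clinear_id]]
  note t = tensor_lift_tensor[OF slice_bilin(2)[OF \<phi>]]
    tensor_map_tensor[OF clinear_mult_right[of x] clinear_id]
    tensor_map_tensor[OF clinear_mult_left[of x] clinear_id]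
  show "slice_right \<phi> t * x = slice_right \<phi> (tensor_map (\<lambda>z. z * x) (\<lambda>y. y) t)"
    by (induct t rule: tensor_induct)
      (simp_all only: t l distrib_left distrib_right mult_scaleC_left)
  show "x * slice_right \<phi> t = slice_right \<phi> (tensor_map (\<lambda>z. x * z) (\<lambda>y. y) t)"
    by (induct t rule: tensor_induct)
      (simp_all only: t l distrib_left distrib_right mult_scaleC_right)
qed

text \<open>Two slices are taken: a functional on the second leg reduces to A, where non-degeneracy
  supplies a factor x; with x inserted in the first leg, a functional on that leg reduces to
  B.\<close>

lemma nondegenerate_tensor:
  assumes A: "nondegenerate_product TYPE('a::complex_algebra)"
    and B: "nondegenerate_product TYPE('b::complex_algebra)"
  shows "nondegenerate_product TYPE(('a, 'b) tensor)"
  unfolding nondegenerate_product_def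
proof (intro conjI allI impI)
  fix t :: "('a, 'b) tensor" assume t: "\<forall>s. t * s = 0"
  show "t = 0"
  proof (rule tensor_eq_0_slice_right)
    fix \<phi> :: "'b \<Rightarrow> complex" assume \<phi>: "clinear \<phi>"
    have "tensor_map (\<lambda>z. z * x) (\<lambda>y. y) t = 0" for x
    proof (rule tensor_eq_0_slice_left, rule nondegenerate_productD(1)[OF B])
      fix \<psi> :: "'a \<Rightarrow> complex" and y assume \<psi>: "clinear \<psi>"
      show "slice_left \<psi> (tensor_map (\<lambda>z. z * x) (\<lambda>y. y) t) * y = 0"
        unfolding slice_left_times[OF \<psi>]
        by (simp add: t clinear_zero[OF tensor_lift_linear[OF slice_bilin(1)[OF \<psi>]]])
    qed
    with \<phi> show "slice_right \<phi> t = 0"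
      using nondegenerate_productD(1)[OF A, of "slice_right \<phi> t"]
      by (simp add: slice_right_times[OF \<phi>] clinear_zero[OF tensor_lift_linear[OF slice_bilin(2)[OF \<phi>]]])
  qed
next
  fix t :: "('a, 'b) tensor" assume t: "\<forall>s. s * t = 0"
  show "t = 0"
  proof (rule tensor_eq_0_slice_right)
    fix \<phi> :: "'b \<Rightarrow> complex" assume \<phi>: "clinear \<phi>"
    have "tensor_map (\<lambda>z. x * z) (\<lambda>y. y) t = 0" for x
    proof (rule tensor_eq_0_slice_left, rule nondegenerate_productD(2)[OF B])
      fix \<psi> :: "'a \<Rightarrow> complex" and y assume \<psi>: "clinear \<psi>"
      show "y * slice_left \<psi> (tensor_map (\<lambda>z. x * z) (\<lambda>y. y) t) = 0"
        unfolding slice_left_times[OF \<psi>]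
        by (simp add: t clinear_zero[OF tensor_lift_linear[OF slice_bilin(1)[OF \<psi>]]])
    qed
    with \<phi> show "slice_right \<phi> t = 0"
      using nondegenerate_productD(2)[OF A, of "slice_right \<phi> t"]
      by (simp add: slice_right_times[OF \<phi>] clinear_zero[OF tensor_lift_linear[OF slice_bilin(2)[OF \<phi>]]])
  qed
qed

section \<open>Multipliers\<close>

text \<open>Linearity in a parameter of the bilinear map, needed wherever one
  \<open>tensor_lift\<close> is nested in another.\<close>

lemma clinear_tensor_lift_param:
  assumes "\<And>a. cbilinear (F a)" "\<And>b c. clinear (\<lambda>a. F a b c)"
  shows "clinear (\<lambda>a. tensor_lift (F a) t)"
proof (induct t rule: tensor_induct)
  case (tensor b c)
  then show ?case using assms by simp
next
  case (add s t)
  then show ?case using assms(1) by (simp add: clinear_iff tensor_lift_add scaleC_add_right)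
qed

lemma lact_add: "lact m (x + y) = lact m x + lact m y"
  and lact_scale: "lact m (c *\<^sub>C x) = c *\<^sub>C lact m x"
  and ract_add: "ract m (x + y) = ract m x + ract m y"
  and ract_scale: "ract m (c *\<^sub>C x) = c *\<^sub>C ract m x"
  using lact_linear[of m] ract_linear[of m] by (simp_all add: clinear_iff)

lemma lact_mult: "lact m (a * b) = lact m a * b"
  and ract_mult: "ract m (a * b) = a * ract m b"
  and lact_ract: "a * lact m b = ract m a * b"
  by (transfer; auto)+

lemma lact_embed [simp]: "lact (embed a) b = a * b"
  and ract_embed [simp]: "ract (embed a) b = b * a"
  by (transfer; simp)+

lemma multiplier_exists:
  assumes "clinear l" "clinear r" "\<And>a b. l (a * b) = l a * b" "\<And>a b. r (a * b) = a * r b"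
    "\<And>a b. a * l b = r a * b"
  obtains m where "lact m = l" "ract m = r"
proof
  have *: "(l, r) \<in> {(l, r). clinear l \<and> clinear r
     \<and> (\<forall>a b. l (a * b) = l a * b) \<and> (\<forall>a b. r (a * b) = a * r b) \<and> (\<forall>a b. a * l b = r a * b)}"
    using assms by blast
  show "lact (Abs_multiplier (l, r)) = l" "ract (Abs_multiplier (l, r)) = r"
    by (simp_all add: lact.rep_eq ract.rep_eq Abs_multiplier_inverse[OF *])
qed

text \<open>The compatibility a (m b) = (a m) b recovers the right action from the left one as soon
  as b can be cancelled.\<close>

lemma multiplier_eq_lactI:
  fixes m n :: "'a::complex_algebra multiplier"
  assumes "nondegenerate_product TYPE('a)" "\<And>a. lact m a = lact n a"
  shows "m = n"
  by (rule multiplier_eqI; rule ext)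
    (use assms(2) in simp, rule nondegenerate_product_eqI(1)[OF assms(1)],
      simp add: lact_ract[symmetric] assms(2))

lemma lact_multiplier_tensor: "lact (m \<otimes>\<^sub>M n) = tensor_map (lact m) (lact n)"
  and ract_multiplier_tensor: "ract (m \<otimes>\<^sub>M n) = tensor_map (ract m) (ract n)"
  by (transfer; auto)+

lemma lact_multiplier_tensor_tensor [simp]: "lact (m \<otimes>\<^sub>M n) (x \<otimes>\<^sub>t y) = lact m x \<otimes>\<^sub>t lact n y"
  and ract_multiplier_tensor_tensor [simp]: "ract (m \<otimes>\<^sub>M n) (x \<otimes>\<^sub>t y) = ract m x \<otimes>\<^sub>t ract n y"
  by (simp_all add: lact_multiplier_tensor ract_multiplier_tensor lact_linear ract_linear)

lemma multiplier_tensor_eqI: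
  fixes m n :: "('a::complex_algebra, 'b::complex_algebra) tensor multiplier"
  assumes "\<And>x y. lact m (x \<otimes>\<^sub>t y) = lact n (x \<otimes>\<^sub>t y)" "\<And>x y. ract m (x \<otimes>\<^sub>t y) = ract n (x \<otimes>\<^sub>t y)"
  shows "m = n"
  by (rule multiplier_eqI; rule ext; rule clinear_eq_tensorI)
    (simp_all add: lact_linear ract_linear assms)

lemma cbilinear_multiplier_tensor: "cbilinear (\<otimes>\<^sub>M)"
  unfolding cbilinear_iff
  by (intro conjI allI; rule multiplier_tensor_eqI; simp add: tensor_bilin)

lemmas multiplier_tensor_bilin = cbilinear_multiplier_tensor[unfolded cbilinear_iff, THEN conjunct1, rule_format]
  cbilinear_multiplier_tensor[unfolded cbilinear_iff, THEN conjunct2, THEN conjunct1, rule_format]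
  cbilinear_multiplier_tensor[unfolded cbilinear_iff, THEN conjunct2, THEN conjunct2, THEN conjunct1, rule_format]
  cbilinear_multiplier_tensor[unfolded cbilinear_iff, THEN conjunct2, THEN conjunct2, THEN conjunct2, rule_format]

lemma clinear_embed: "clinear embed"
  unfolding clinear_iff
  by (intro conjI allI; rule multiplier_eqI; rule ext;
      simp add: distrib_left distrib_right mult_scaleC_left mult_scaleC_right)

lemma times_embed: "m * embed a = embed (lact m a)"
  by (rule multiplier_eqI; rule ext; simp add: lact_mult lact_ract)

lemma embed_times: "embed a * m = embed (ract m a)"
  by (rule multiplier_eqI; rule ext; simp add: ract_mult lact_ract)

lemma embed_tensor: "embed a \<otimes>\<^sub>M embed b = embed (a \<otimes>\<^sub>t b)"
  by (rule multiplier_tensor_eqI; simp)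

lemma embed_inject:
  fixes a b :: "'a::complex_algebra"
  assumes "nondegenerate_product TYPE('a)"
  shows "embed a = embed b \<longleftrightarrow> a = b"
  using nondegenerate_product_eqI(1)[OF assms] by (metis lact_embed)

lemma unembed_embed:
  fixes a :: "'a::complex_algebra"
  assumes "nondegenerate_product TYPE('a)"
  shows "unembed (embed a) = a"
  unfolding unembed_def by (rule the_inv_f_f) (simp_all add: inj_def embed_inject[OF assms])

section \<open>Extension of homomorphisms and anti-homomorphisms to multipliers\<close>

lemma clinear_inv:
  assumes "clinear f" "bij f"
  shows "clinear (inv_into UNIV f)"
  unfolding clinear_iff
  by (intro conjI allI; rule inv_f_eq[OF bij_is_inj[OF assms(2)]])
    (simp_all add: clinear_add[OF assms(1)] clinear_scale[OF assms(1)]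
      surj_f_inv_f[OF bij_is_surj[OF assms(2)]])

text \<open>Conjugating both actions of m by f yields a multiplier, and surjectivity of f makes it
  the only solution of the defining equations. This evaluates \<open>mult_ext\<close> for the flip,
  the reassociation, pi_p \<otimes> pi_p and \<open>deform\<close>.\<close>

lemma mult_ext_hom:
  fixes f :: "'a::complex_algebra \<Rightarrow> 'b::complex_algebra"
  assumes B: "nondegenerate_product TYPE('b)" and f: "algebra_hom f" "bij f"
  shows "lact (mult_ext (\<lambda>t. embed (f t)) m) (f a) = f (lact m a)"
    "ract (mult_ext (\<lambda>t. embed (f t)) m) (f a) = f (ract m a)"
proof -
  have fm: "f (a * b) = f a * f b" and fl: "clinear f" for a b
    using f(1) by (simp_all add: algebra_hom_def)
  define g where "g = inv_into UNIV f"
  have gf: "g (f a) = a" and fg: "f (g b) = b" for a b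
    using f(2) by (simp_all add: g_def bij_is_inj bij_is_surj surj_f_inv_f)
  have gm: "g (a * b) = g a * g b" for a b using gf[of "g a * g b"] by (simp add: fm fg)
  have gl: "clinear g" unfolding g_def by (rule clinear_inv[OF fl f(2)])
  have comp: "a * f (lact m (g b)) = f (ract m (g a)) * b" for a b
    using lact_ract[of "g a" m "g b"] by (metis fm fg)
  obtain n where n: "lact n = (\<lambda>b. f (lact m (g b)))" "ract n = (\<lambda>b. f (ract m (g b)))"
    by (rule multiplier_exists[of "\<lambda>b. f (lact m (g b))" "\<lambda>b. f (ract m (g b))"])
      (simp add: clinear_iff clinear_add[OF fl] clinear_add[OF gl] clinear_scale[OF fl]
        clinear_scale[OF gl] lact_add lact_scale,
       simp add: clinear_iff clinear_add[OF fl] clinear_add[OF gl] clinear_scale[OF fl]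
        clinear_scale[OF gl] ract_add ract_scale,
       simp add: gm lact_mult fm fg, simp add: gm ract_mult fm fg, rule comp)
  have "mult_ext (\<lambda>t. embed (f t)) m = n"
    unfolding mult_ext_def
  proof (rule the_equality)
    show "\<forall>a. n * embed (f a) = embed (f (lact m a)) \<and> embed (f a) * n = embed (f (ract m a))"
      by (simp add: times_embed embed_times n gf)
    fix n' assume "\<forall>a. n' * embed (f a) = embed (f (lact m a)) \<and> embed (f a) * n' = embed (f (ract m a))"
    then have "lact n' (f a) = f (lact m a)" "ract n' (f a) = f (ract m a)" for a
      by (simp_all add: times_embed embed_times embed_inject[OF B])
    then have "lact n' b = lact n b" "ract n' b = ract n b" for b
      using fg[of b] by (metis gf n)+
    then show "n' = n" by (intro multiplier_eqI ext)
  qed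
  then show "lact (mult_ext (\<lambda>t. embed (f t)) m) (f a) = f (lact m a)"
    "ract (mult_ext (\<lambda>t. embed (f t)) m) (f a) = f (ract m a)" by (simp_all add: n gf)
qed

text \<open>As for homomorphisms, except that reversing products makes the left action of the
  extension come from the right action of m.\<close>

lemma mult_antiext_antihom:
  fixes f :: "'a::complex_algebra \<Rightarrow> 'a"
  assumes f: "algebra_antihom f" "bij f"
  shows "lact (mult_antiext f m) (f a) = f (ract m a)"
    "ract (mult_antiext f m) (f a) = f (lact m a)"
proof -
  have fm: "f (a * b) = f b * f a" and fl: "clinear f" for a b
    using f(1) by (simp_all add: algebra_antihom_def)
  define g where "g = inv_into UNIV f"
  have gf: "g (f a) = a" and fg: "f (g b) = b" for a b
    using f(2) by (simp_all add: g_def bij_is_inj bij_is_surj surj_f_inv_f)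
  have gm: "g (a * b) = g b * g a" for a b using gf[of "g b * g a"] by (simp add: fm fg)
  have gl: "clinear g" unfolding g_def by (rule clinear_inv[OF fl f(2)])
  have comp: "a * f (ract m (g b)) = f (lact m (g a)) * b" for a b
    using lact_ract[of "g b" m "g a"] by (metis fm fg)
  obtain n where n: "lact n = (\<lambda>b. f (ract m (g b)))" "ract n = (\<lambda>b. f (lact m (g b)))"
    by (rule multiplier_exists[of "\<lambda>b. f (ract m (g b))" "\<lambda>b. f (lact m (g b))"])
      (simp add: clinear_iff clinear_add[OF fl] clinear_add[OF gl] clinear_scale[OF fl]
        clinear_scale[OF gl] ract_add ract_scale,
       simp add: clinear_iff clinear_add[OF fl] clinear_add[OF gl] clinear_scale[OF fl]
        clinear_scale[OF gl] lact_add lact_scale,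
       simp add: gm ract_mult fm fg, simp add: gm lact_mult fm fg, rule comp)
  have "mult_antiext f m = n"
    unfolding mult_antiext_def
  proof (rule the_equality)
    show "\<forall>a. lact n (f a) = f (ract m a) \<and> ract n (f a) = f (lact m a)" by (simp add: n gf)
    fix n' assume "\<forall>a. lact n' (f a) = f (ract m a) \<and> ract n' (f a) = f (lact m a)"
    then have "lact n' b = lact n b" "ract n' b = ract n b" for b
      using fg[of b] by (metis gf n)+
    then show "n' = n" by (intro multiplier_eqI ext)
  qed
  then show "lact (mult_antiext f m) (f a) = f (ract m a)"
    "ract (mult_antiext f m) (f a) = f (lact m a)" by (simp_all add: n gf)
qed

lemma mult_antiext_hom:
  fixes f :: "'a::complex_algebra \<Rightarrow> 'a"
  assumes f: "algebra_antihom f" "bij f"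
  shows "mult_antiext f (m * n) = mult_antiext f n * mult_antiext f m"
    "mult_antiext f 1 = 1" "mult_antiext f (embed a) = embed (f a)"
proof -
  have fm: "f (a * b) = f b * f a" for a b using f(1) by (simp add: algebra_antihom_def)
  have s: "\<exists>a. b = f a" for b using f(2) by (metis bij_pointE)
  have eqI: "k = l" if "\<And>a. lact k (f a) = lact l (f a)" "\<And>a. ract k (f a) = ract l (f a)" for k l
    by (intro multiplier_eqI ext) (metis s that)+
  show "mult_antiext f (m * n) = mult_antiext f n * mult_antiext f m"
    "mult_antiext f 1 = 1" "mult_antiext f (embed a) = embed (f a)"
    by (rule eqI; simp add: mult_antiext_antihom[OF f] fm)+
qed

section \<open>Flip and reassociation\<close>

lemma tensor_flip_bilin: "cbilinear (\<lambda>a b. b \<otimes>\<^sub>t a)"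
  by (simp add: cbilinear_iff tensor_bilin)

lemma tensor_flip_tensor [simp]: "tensor_flip (a \<otimes>\<^sub>t b) = b \<otimes>\<^sub>t a"
  by (simp add: tensor_flip_def tensor_flip_bilin)

lemma tensor_flip_linear: "clinear tensor_flip"
  unfolding tensor_flip_def by (rule tensor_lift_linear[OF tensor_flip_bilin])

lemmas tensor_flip_add = clinear_add[OF tensor_flip_linear]

lemma tensor_flip_flip [simp]: "tensor_flip (tensor_flip t) = t"
  by (induct t rule: tensor_induct) (simp_all add: tensor_flip_add)

lemma bij_tensor_flip: "bij tensor_flip"
  by (rule o_bij[of tensor_flip]) (simp_all add: fun_eq_iff)

lemma tensor_flip_mult: "tensor_flip (s * t) = tensor_flip s * tensor_flip t"
proof (induct s rule: tensor_induct)
  case (tensor a b)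
  show ?case by (induct t rule: tensor_induct) (simp_all add: tensor_flip_add distrib_left)
qed (simp add: tensor_flip_add distrib_right)

lemma algebra_hom_tensor_flip: "algebra_hom tensor_flip"
  by (simp add: algebra_hom_def tensor_flip_linear tensor_flip_mult)

lemma cbilinear_tensor_reassoc:
  "cbilinear (\<lambda>b c. (a \<otimes>\<^sub>t b) \<otimes>\<^sub>t c)"
  "cbilinear (\<lambda>a. tensor_lift (\<lambda>b c. (a \<otimes>\<^sub>t b) \<otimes>\<^sub>t c))"
proof -
  show 1: "cbilinear (\<lambda>b c. (a \<otimes>\<^sub>t b) \<otimes>\<^sub>t c)" for a by (simp add: cbilinear_iff tensor_bilin)
  show "cbilinear (\<lambda>a. tensor_lift (\<lambda>b c. (a \<otimes>\<^sub>t b) \<otimes>\<^sub>t c))"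
    unfolding cbilinear_def
    by (intro conjI allI clinear_tensor_lift_param tensor_lift_linear 1)
      (simp add: clinear_iff tensor_bilin)
qed

lemma tensor_reassoc_tensor: "tensor_reassoc (a \<otimes>\<^sub>t t) = tensor_lift (\<lambda>b c. (a \<otimes>\<^sub>t b) \<otimes>\<^sub>t c) t"
  by (simp add: tensor_reassoc_def cbilinear_tensor_reassoc)

lemma tensor_reassoc_tensor_tensor [simp]: "tensor_reassoc (a \<otimes>\<^sub>t (b \<otimes>\<^sub>t c)) = (a \<otimes>\<^sub>t b) \<otimes>\<^sub>t c"
  by (simp add: tensor_reassoc_tensor cbilinear_tensor_reassoc)

lemma tensor_reassoc_linear: "clinear tensor_reassoc"
  unfolding tensor_reassoc_def by (intro tensor_lift_linear cbilinear_tensor_reassoc)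

lemmas tensor_reassoc_add = clinear_add[OF tensor_reassoc_linear]

lemma tensor_induct_right [case_names tensor add]:
  fixes t :: "('a::complex_vector, ('b::complex_vector, 'c::complex_vector) tensor) tensor"
  assumes T: "\<And>a b c. P (a \<otimes>\<^sub>t (b \<otimes>\<^sub>t c))" and A: "\<And>s t. P s \<Longrightarrow> P t \<Longrightarrow> P (s + t)"
  shows "P t"
proof (induct t rule: tensor_induct)
  case (tensor a s)
  show ?case by (induct s rule: tensor_induct) (simp_all add: T A tensor_bilin)
qed (rule A)

lemma tensor_induct_left [case_names tensor add]:
  fixes t :: "(('a::complex_vector, 'b::complex_vector) tensor, 'c::complex_vector) tensor"
  assumes T: "\<And>a b c. P ((a \<otimes>\<^sub>t b) \<otimes>\<^sub>t c)" and A: "\<And>s t. P s \<Longrightarrow> P t \<Longrightarrow> P (s + t)"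
  shows "P t"
proof (induct t rule: tensor_induct)
  case (tensor s c)
  show ?case by (induct s rule: tensor_induct) (simp_all add: T A tensor_bilin)
qed (rule A)

lemma bij_tensor_reassoc: "bij tensor_reassoc"
proof (rule o_bij)
  \<comment> \<open>The inverse is reassociation itself between flips: (a \<otimes> b) \<otimes> c
    becomes c \<otimes> (b \<otimes> a), then (c \<otimes> b) \<otimes> a, then a \<otimes> (c
    \<otimes> b), and an inner flip finishes.\<close>
  define g :: "(('a::complex_vector, 'b::complex_vector) tensor, 'c::complex_vector) tensor
      \<Rightarrow> ('a, ('b, 'c) tensor) tensor"
    where "g t = tensor_map (\<lambda>x. x) tensor_flip
      (tensor_flip (tensor_reassoc (tensor_flip (tensor_map tensor_flip (\<lambda>x. x) t))))" for t
  note l = tensor_map_linear[OF tensor_flip_linear clinear_id]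
    tensor_map_linear[OF clinear_id tensor_flip_linear]
  have "clinear g"
    unfolding g_def by (simp add: clinear_iff tensor_flip_add clinear_add[OF l(1)] clinear_add[OF l(2)]
        tensor_reassoc_add clinear_scale[OF l(1)] clinear_scale[OF l(2)] clinear_scale[OF tensor_flip_linear] clinear_scale[OF tensor_reassoc_linear])
  moreover have "g ((a \<otimes>\<^sub>t b) \<otimes>\<^sub>t c) = a \<otimes>\<^sub>t (b \<otimes>\<^sub>t c)" for a b c
    by (simp add: g_def tensor_flip_linear clinear_id)
  ultimately show "g \<circ> tensor_reassoc = id" "tensor_reassoc \<circ> g = id"
  proof -
    assume g: "clinear g" "\<And>a b c. g ((a \<otimes>\<^sub>t b) \<otimes>\<^sub>t c) = a \<otimes>\<^sub>t (b \<otimes>\<^sub>t c)"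
    have "g (tensor_reassoc t) = t" for t
      by (induct t rule: tensor_induct_right) (simp_all add: g(2) clinear_add[OF g(1)] tensor_reassoc_add)
    moreover have "tensor_reassoc (g t) = t" for t
      by (induct t rule: tensor_induct_left) (simp_all add: g(2) clinear_add[OF g(1)] tensor_reassoc_add)
    ultimately show "g \<circ> tensor_reassoc = id" "tensor_reassoc \<circ> g = id" by auto
  qed
qed

lemma tensor_reassoc_mult: "tensor_reassoc (s * t) = tensor_reassoc s * tensor_reassoc t"
proof (induct s rule: tensor_induct_right)
  case (tensor a b c)
  show ?case by (induct t rule: tensor_induct_right) (simp_all add: tensor_reassoc_add distrib_left)
qed (simp add: tensor_reassoc_add distrib_right)

lemma algebra_hom_tensor_reassoc: "algebra_hom tensor_reassoc"
  by (simp add: algebra_hom_def tensor_reassoc_linear tensor_reassoc_mult)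

lemma coproduct_cop_act:
  fixes D :: "'a::complex_algebra coproduct"
  assumes "nondegenerate_product TYPE('a)"
  shows "lact (coproduct_cop D a) t = tensor_flip (lact (D a) (tensor_flip t))"
    "ract (coproduct_cop D a) t = tensor_flip (ract (D a) (tensor_flip t))"
  unfolding coproduct_cop_def
  using mult_ext_hom[OF nondegenerate_tensor[OF assms assms] algebra_hom_tensor_flip bij_tensor_flip,
      of "D a" "tensor_flip t"]
  by simp_all

lemma mult_antiext_linear:
  assumes f: "algebra_antihom f" "bij f"
  shows "clinear (mult_antiext f)"
proof -
  have fl: "clinear f" using f(1) by (simp add: algebra_antihom_def)
  have s: "\<exists>a. b = f a" for b using f(2) by (metis bij_pointE)
  have eqI: "k = l" if "\<And>a. lact k (f a) = lact l (f a)" "\<And>a. ract k (f a) = ract l (f a)" for k l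
    by (intro multiplier_eqI ext) (metis s that)+
  show ?thesis
    unfolding clinear_iff
    by (intro conjI allI; rule eqI;
        simp add: mult_antiext_antihom[OF f] clinear_add[OF fl] clinear_scale[OF fl])
qed

text \<open>The inverses of the two actions satisfy the multiplier laws again, so together they form
  an inverse multiplier.\<close>

lemma multiplier_invertible:
  fixes m :: "'a::complex_algebra multiplier"
  assumes "bij (lact m)" "bij (ract m)"
  shows "invertible m"
proof -
  define l where "l = inv_into UNIV (lact m)"
  define r where "r = inv_into UNIV (ract m)"
  have l: "lact m (l x) = x" "l (lact m x) = x" and r: "ract m (r x) = x" "r (ract m x) = x" for x
    using assms by (simp_all add: l_def r_def bij_is_inj bij_is_surj surj_f_inv_f)
  obtain n where n: "lact n = l" "ract n = r"
  proof (rule multiplier_exists[of l r])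
    show "clinear l" "clinear r"
      unfolding l_def r_def by (intro clinear_inv lact_linear ract_linear assms)+
    show "l (a * b) = l a * b" for a b using l(2)[of "l a * b"] by (simp add: lact_mult l)
    show "r (a * b) = a * r b" for a b using r(2)[of "a * r b"] by (simp add: ract_mult r)
    show "a * l b = r a * b" for a b using lact_ract[of "r a" m "l b"] by (simp add: l r)
  qed
  have "m * n = 1" "n * m = 1" by (auto intro!: multiplier_eqI simp: l r n)
  then show ?thesis unfolding invertible_def by blast
qed

lemma minverse_eq:
  assumes "m * n = 1" "n * m = 1"
  shows "minverse m = n"
  unfolding minverse_def by (rule the_equality) (metis assms mult.assoc mult_1_left mult_1_right)+

lemma tensor_map_hom:
  assumes f: "algebra_hom f" and g: "algebra_hom g"
  shows "algebra_hom (tensor_map f g)"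
proof -
  have l: "clinear f" "clinear g" "f (a * b) = f a * f b" "g (c * d) = g c * g d" for a b c d
    using f g by (simp_all add: algebra_hom_def)
  note ll = tensor_map_linear[OF l(1,2)]
  have "tensor_map f g (s * t) = tensor_map f g s * tensor_map f g t" for s t
  proof (induct s rule: tensor_induct)
    case (tensor a b)
    show ?case by (induct t rule: tensor_induct) (simp_all add: l clinear_add[OF ll] distrib_left)
  qed (simp add: clinear_add[OF ll] distrib_right)
  then show ?thesis by (simp add: algebra_hom_def ll)
qed

lemma tensor_map_inverse:
  assumes "clinear f" "clinear g" "clinear f'" "clinear g'" "\<And>x. f' (f x) = x" "\<And>x. g' (g x) = x"
  shows "tensor_map f' g' (tensor_map f g t) = t"
  by (induct t rule: tensor_induct)
    (simp_all add: assms clinear_add[OF tensor_map_linear[OF assms(1,2)]]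
      clinear_add[OF tensor_map_linear[OF assms(3,4)]])

section \<open>Regular multiplier Hopf algebras\<close>

text \<open>No antipode is fixed, so that the co-opposite coproduct can be an instance as well.
  Non-triviality is what forces the counit to be nonzero.\<close>

locale mult_hopf =
  fixes \<Delta> :: "'a::complex_algebra coproduct" and \<epsilon> :: "'a \<Rightarrow> complex"
  assumes mha: "multiplier_hopf_algebra \<Delta>"
    and counit: "is_counit \<Delta> \<epsilon>"
    and nontrivial: "\<exists>x::'a. x \<noteq> 0"
begin

lemma nondegenerate: "nondegenerate_product TYPE('a)"
  using mha by (simp add: multiplier_hopf_algebra_def)

lemma nondegenerate2: "nondegenerate_product TYPE(('a, 'a) tensor)"
  by (intro nondegenerate_tensor nondegenerate)

lemma nondegenerate3: "nondegenerate_product TYPE((('a, 'a) tensor, 'a) tensor)"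
  by (intro nondegenerate_tensor nondegenerate)

lemma coprod_linear: "clinear \<Delta>" and coprod_mult: "\<Delta> (a * b) = \<Delta> a * \<Delta> b"
  using mha by (simp_all add: multiplier_hopf_algebra_def algebra_hom_def)

lemma eps_linear: "clinear \<epsilon>" and eps_mult: "\<epsilon> (a * b) = \<epsilon> a * \<epsilon> b"
  using counit by (simp_all add: is_counit_def algebra_hom_def)

lemmas slice_eps_bilin = slice_bilin[OF eps_linear]

lemma slice_eps_add:
  "slice_left \<epsilon> (s + t) = slice_left \<epsilon> s + slice_left \<epsilon> t"
  "slice_right \<epsilon> (s + t) = slice_right \<epsilon> s + slice_right \<epsilon> t"
  by (simp_all add: tensor_lift_add slice_eps_bilin)

lemma slice_eps_mult:
  fixes s t :: "('a, 'a) tensor"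
  shows "slice_left \<epsilon> (s * t) = slice_left \<epsilon> s * slice_left \<epsilon> t"
    "slice_right \<epsilon> (s * t) = slice_right \<epsilon> s * slice_right \<epsilon> t"
proof -
  show "slice_left \<epsilon> (s * t) = slice_left \<epsilon> s * slice_left \<epsilon> t"
  proof (induct s rule: tensor_induct)
    case (tensor a b)
    show ?case
      by (induct t rule: tensor_induct)
        (simp_all add: slice_eps_add slice_eps_bilin distrib_left eps_mult mult_scaleC_left
          mult_scaleC_right scaleC_scaleC mult.commute)
  qed (simp add: slice_eps_add distrib_right)
  show "slice_right \<epsilon> (s * t) = slice_right \<epsilon> s * slice_right \<epsilon> t"
  proof (induct s rule: tensor_induct)
    case (tensor a b)
    show ?case
      by (induct t rule: tensor_induct)
        (simp_all add: slice_eps_add slice_eps_bilin distrib_left eps_mult mult_scaleC_left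
          mult_scaleC_right scaleC_scaleC mult.commute)
  qed (simp add: slice_eps_add distrib_right)
qed

section \<open>The canonical maps and the counit\<close>

lemma cbilinear_canonical:
  "cbilinear (\<lambda>a b. \<Delta> a * (1 \<otimes>\<^sub>M embed b))" "cbilinear (\<lambda>a b. (embed a \<otimes>\<^sub>M 1) * \<Delta> b)"
  by (simp_all add: cbilinear_iff multiplier_tensor_bilin clinear_add[OF coprod_linear] clinear_scale[OF coprod_linear]
      clinear_add[OF clinear_embed] clinear_scale[OF clinear_embed] distrib_left distrib_right
      mult_scaleC_left mult_scaleC_right)

definition T1 :: "('a, 'a) tensor \<Rightarrow> ('a, 'a) tensor"
  where "T1 t = unembed (tensor_lift (\<lambda>a b. \<Delta> a * (1 \<otimes>\<^sub>M embed b)) t)"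

definition T2 :: "('a, 'a) tensor \<Rightarrow> ('a, 'a) tensor"
  where "T2 t = unembed (tensor_lift (\<lambda>a b. (embed a \<otimes>\<^sub>M 1) * \<Delta> b) t)"

lemma bij_betw_canonical:
  "bij_betw (tensor_lift (\<lambda>a b. \<Delta> a * (1 \<otimes>\<^sub>M embed b))) UNIV (range embed)"
  "bij_betw (tensor_lift (\<lambda>a b. (embed a \<otimes>\<^sub>M 1) * \<Delta> b)) UNIV (range embed)"
  using mha by (simp_all add: multiplier_hopf_algebra_def)

lemma embed_T1: "embed (T1 t) = tensor_lift (\<lambda>a b. \<Delta> a * (1 \<otimes>\<^sub>M embed b)) t"
proof -
  have "tensor_lift (\<lambda>a b. \<Delta> a * (1 \<otimes>\<^sub>M embed b)) t \<in> range embed"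
    using bij_betw_canonical(1) by (auto simp: bij_betw_def)
  then show ?thesis unfolding T1_def by (auto simp: unembed_embed[OF nondegenerate2])
qed

lemma embed_T2: "embed (T2 t) = tensor_lift (\<lambda>a b. (embed a \<otimes>\<^sub>M 1) * \<Delta> b) t"
proof -
  have "tensor_lift (\<lambda>a b. (embed a \<otimes>\<^sub>M 1) * \<Delta> b) t \<in> range embed"
    using bij_betw_canonical(2) by (auto simp: bij_betw_def)
  then show ?thesis unfolding T2_def by (auto simp: unembed_embed[OF nondegenerate2])
qed

lemma embed_T1_tensor: "\<Delta> a * (1 \<otimes>\<^sub>M embed b) = embed (T1 (a \<otimes>\<^sub>t b))"
  by (simp add: embed_T1 cbilinear_canonical)

lemma embed_T2_tensor: "(embed a \<otimes>\<^sub>M 1) * \<Delta> b = embed (T2 (a \<otimes>\<^sub>t b))"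
  by (simp add: embed_T2 cbilinear_canonical)

lemma T1_linear: "clinear T1" and T2_linear: "clinear T2"
proof -
  have "T1 (s + t) = T1 s + T1 t" "T1 (c *\<^sub>C t) = c *\<^sub>C T1 t"
    "T2 (s + t) = T2 s + T2 t" "T2 (c *\<^sub>C t) = c *\<^sub>C T2 t" for c s t
    by (subst embed_inject[OF nondegenerate2, symmetric],
      simp only: embed_T1 embed_T2 tensor_lift_add tensor_lift_scale cbilinear_canonical
        clinear_add[OF clinear_embed] clinear_scale[OF clinear_embed])+
  then show "clinear T1" "clinear T2" by (simp_all add: clinear_iff)
qed

lemmas T1_add = clinear_add[OF T1_linear] and T2_add = clinear_add[OF T2_linear]

lemma T1_inverse: "\<exists>s. T1 s = t"
proof -
  have "embed t \<in> range (tensor_lift (\<lambda>a b. \<Delta> a * (1 \<otimes>\<^sub>M embed b)))"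
    using bij_betw_canonical(1) by (simp add: bij_betw_def)
  then show ?thesis
    by (auto simp: embed_T1[symmetric] embed_inject[OF nondegenerate2])
qed

lemma T1_injective: "T1 s = T1 t \<longleftrightarrow> s = t"
  using bij_betw_canonical(1)
  by (auto simp: bij_betw_def inj_eq embed_T1[symmetric] embed_inject[OF nondegenerate2]
      dest: injD[where x = s and y = t])

text \<open>\<open>\<Delta> a\<close> is accessible only after multiplication by 1 \<otimes> b,
  hence a product in the second leg.\<close>

lemma lact_coprod: "lact (\<Delta> a) (x \<otimes>\<^sub>t (b * y)) = T1 (a \<otimes>\<^sub>t b) * (x \<otimes>\<^sub>t y)"
  using arg_cong[OF embed_T1_tensor[of a b], of "\<lambda>m. lact m (x \<otimes>\<^sub>t y)"] by simp

lemma ract_coprod: "ract (\<Delta> b) ((x * a) \<otimes>\<^sub>t y) = (x \<otimes>\<^sub>t y) * T2 (a \<otimes>\<^sub>t b)"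
  using arg_cong[OF embed_T2_tensor[of a b], of "\<lambda>m. ract m (x \<otimes>\<^sub>t y)"] by simp

lemma counit_T1: "slice_left \<epsilon> (T1 (a \<otimes>\<^sub>t b)) = a * b"
  and counit_T2: "slice_right \<epsilon> (T2 (a \<otimes>\<^sub>t b)) = a * b"
  using counit by (simp_all add: is_counit_def embed_T1_tensor embed_T2_tensor unembed_embed[OF nondegenerate2])

text \<open>A zero counit would make all products vanish by the counit law, contrary to
  non-degeneracy of a nonzero algebra.\<close>

lemma eps_nonzero: obtains e where "\<epsilon> e = 1"
proof -
  have "\<exists>e. \<epsilon> e \<noteq> 0"
  proof (rule ccontr)
    assume "\<not> ?thesis"
    then have z: "\<epsilon> x = 0" for x by simp
    have "slice_left \<epsilon> t = 0" for t :: "('a, 'a) tensor"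
    proof (induct t rule: tensor_induct)
      case (tensor x y)
      show ?case by (subst tensor_lift_tensor[OF slice_eps_bilin(1)]) (simp add: z)
    qed (simp add: slice_eps_add)
    then have "a * b = 0" for a b :: 'a by (metis counit_T1)
    then show False using nontrivial nondegenerate_productD(1)[OF nondegenerate] by blast
  qed
  then obtain e where "\<epsilon> e \<noteq> 0" by blast
  then have "\<epsilon> (inverse (\<epsilon> e) *\<^sub>C e) = 1"
    by (simp add: clinear_scale[OF eps_linear] scaleC_complex)
  then show ?thesis by (rule that)
qed

lemma counit_T1_lift: "tensor_lift (*) t = slice_left \<epsilon> (T1 t)"
  by (induct t rule: tensor_induct)
    (simp_all add: cbilinear_mult tensor_lift_add T1_add slice_eps_add counit_T1)

text \<open>A is spanned by products: with \<open>\<epsilon> e = 1\<close> and \<open>T1 t\<close>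
  equal to e \<otimes> y, the counit law shows that multiplying out t gives y.\<close>

lemma product_induct [case_names mult add]:
  assumes "\<And>a b::'a. P (a * b)" "\<And>a b. P a \<Longrightarrow> P b \<Longrightarrow> P (a + b)"
  shows "P y"
proof -
  obtain e where e: "\<epsilon> e = 1" by (rule eps_nonzero)
  obtain t where "T1 t = e \<otimes>\<^sub>t y" using T1_inverse by blast
  then have "y = tensor_lift (*) t" by (simp add: counit_T1_lift slice_eps_bilin e scaleC_one)
  moreover have "P (tensor_lift (*) t)"
    by (induct t rule: tensor_induct) (simp_all add: assms cbilinear_mult tensor_lift_add)
  ultimately show ?thesis by simp
qed

lemma tensor_right_product_induct [case_names mult add]:
  fixes t :: "('a, 'a) tensor"
  assumes T: "\<And>x a b. P (x \<otimes>\<^sub>t (a * b))" and A: "\<And>s t. P s \<Longrightarrow> P t \<Longrightarrow> P (s + t)"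
  shows "P t"
proof (induct t rule: tensor_induct)
  case (tensor x y)
  show ?case by (induct y rule: product_induct) (simp_all add: T A tensor_bilin)
qed (rule A)

lemma coprod_T1: "lact (\<Delta> a) (T1 (b \<otimes>\<^sub>t c)) = T1 ((a * b) \<otimes>\<^sub>t c)"
proof -
  have "embed (lact (\<Delta> a) (T1 (b \<otimes>\<^sub>t c))) = \<Delta> a * (\<Delta> b * (1 \<otimes>\<^sub>M embed c))"
    by (simp add: embed_T1_tensor times_embed)
  also have "\<dots> = embed (T1 ((a * b) \<otimes>\<^sub>t c))"
    by (simp add: embed_T1_tensor[symmetric] coprod_mult mult.assoc)
  finally show ?thesis by (simp add: embed_inject[OF nondegenerate2])
qed

text \<open>1 \<otimes> q and p \<otimes> 1 commute. Since p \<otimes> 1 is only a multiplier, right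
  multiplication by it is expressed as a \<open>tensor_map\<close>.\<close>

lemma T1_mult_left: "tensor_map (\<lambda>z. z * p) (\<lambda>y. y) (T1 (a \<otimes>\<^sub>t q)) = lact (\<Delta> a) (p \<otimes>\<^sub>t q)"
proof (rule nondegenerate_product_eqI(1)[OF nondegenerate2])
  fix s :: "('a, 'a) tensor"
  note l = tensor_map_linear[OF clinear_mult_right[of p] clinear_id]
  show "tensor_map (\<lambda>z. z * p) (\<lambda>y. y) (T1 (a \<otimes>\<^sub>t q)) * s = lact (\<Delta> a) (p \<otimes>\<^sub>t q) * s"
  proof (induct s rule: tensor_induct)
    case (tensor x y)
    have "tensor_map (\<lambda>z. z * p) (\<lambda>y. y) t * (x \<otimes>\<^sub>t y) = t * ((p * x) \<otimes>\<^sub>t y)" for t :: "('a, 'a) tensor"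
      by (induct t rule: tensor_induct)
        (simp_all add: clinear_mult_right clinear_id mult.assoc clinear_add[OF l] distrib_right)
    then show ?case by (simp add: lact_coprod[symmetric] lact_mult[symmetric])
  qed (simp add: distrib_left)
qed

text \<open>In a Hopf algebra \<open>left_antipode (a \<otimes> b) = S(a) b\<close>; it is defined without reference to
  an antipode, because \<open>T1\<close> maps \<open>a\<^sub>1 \<otimes> S(a\<^sub>2) b\<close> to \<open>a \<otimes> b\<close>.\<close>

definition left_antipode :: "('a, 'a) tensor \<Rightarrow> 'a"
  where "left_antipode t = slice_left \<epsilon> (inv_into UNIV T1 t)"

lemma left_antipode_T1: "left_antipode (T1 t) = slice_left \<epsilon> t"
  unfolding left_antipode_def by (subst inv_f_f) (auto simp: inj_def T1_injective)

lemma left_antipode_linear: "clinear left_antipode"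
  unfolding clinear_iff
proof (intro conjI allI)
  fix s t and c
  obtain s' t' where "T1 s' = s" "T1 t' = t" using T1_inverse by blast
  then show "left_antipode (s + t) = left_antipode s + left_antipode t"
    "left_antipode (c *\<^sub>C t) = c *\<^sub>C left_antipode t"
    by (auto simp flip: T1_add clinear_scale[OF T1_linear]
        simp: left_antipode_T1 slice_eps_add tensor_lift_scale[OF slice_eps_bilin(1)])
qed

lemmas left_antipode_add = clinear_add[OF left_antipode_linear]

text \<open>In Sweedler notation, S(a_1 b) a_2 c = S(b) S(a_1) a_2 c. On the image of
  \<open>T1\<close> it is multiplicativity of the counit.\<close>

lemma left_antipode_coprod: "left_antipode (lact (\<Delta> a) t) = \<epsilon> a *\<^sub>C left_antipode t"
proof -
  obtain s where s: "t = T1 s" using T1_inverse by metis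
  show ?thesis unfolding s
    by (induct s rule: tensor_induct)
      (simp_all add: T1_add lact_add left_antipode_add scaleC_add_right coprod_T1 left_antipode_T1
        slice_eps_bilin eps_mult scaleC_scaleC)
qed

text \<open>For x \<otimes> q equal to \<open>T1\<close> of a \<otimes> b, the left side is the
  value of \<open>\<psi>\<close> at \<Delta>(a)(p \<otimes> b), which invariance turns into the
  counit of a times the value at p \<otimes> b, while \<open>left_antipode\<close> sends x \<otimes>
  q to that same multiple of b. Linearity and surjectivity of \<open>T1\<close> do the rest. It
  serves for the Drinfeld multiplier and for both halves of \<open>bij_antipode\<close>.\<close>

lemma invariant_shift:
  fixes \<psi> :: "('a, 'a) tensor \<Rightarrow> 'v::complex_vector"
  assumes \<psi>: "clinear \<psi>" "\<And>a t. \<psi> (lact (\<Delta> a) t) = \<epsilon> a *\<^sub>C \<psi> t"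
  shows "\<psi> ((x * p) \<otimes>\<^sub>t q) = \<psi> (p \<otimes>\<^sub>t left_antipode (x \<otimes>\<^sub>t q))"
proof -
  note l = tensor_map_linear[OF clinear_mult_right[of p] clinear_id]
  have *: "\<psi> (tensor_map (\<lambda>z. z * p) (\<lambda>y. y) (T1 t)) = \<psi> (p \<otimes>\<^sub>t left_antipode (T1 t))" for t
    by (induct t rule: tensor_induct)
      (simp_all add: T1_mult_left \<psi> left_antipode_T1 slice_eps_bilin slice_eps_add T1_add
        left_antipode_add
        clinear_add[OF l] clinear_add[OF \<psi>(1)] clinear_scale[OF \<psi>(1)] tensor_bilin)
  obtain t where t: "T1 t = x \<otimes>\<^sub>t q" using T1_inverse by blast
  show ?thesis using *[of t] by (simp add: t clinear_mult_right clinear_id)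
qed

lemma left_antipode_surj: "\<exists>t. left_antipode t = y"
proof -
  obtain e where "\<epsilon> e = 1" by (rule eps_nonzero)
  then have "left_antipode (T1 (e \<otimes>\<^sub>t y)) = y"
    by (simp add: left_antipode_T1 slice_eps_bilin scaleC_one)
  then show ?thesis by blast
qed

text \<open>The coassociativity axiom with all embeddings into multiplier algebras removed, so that
  linear maps on the triple tensor product can be applied to it.\<close>

lemma coassociative:
  "tensor_map (\<lambda>x. T2 (a \<otimes>\<^sub>t x)) (\<lambda>y. y) (T1 (b \<otimes>\<^sub>t c))
    = tensor_reassoc (tensor_map (\<lambda>x. x) (\<lambda>y. T1 (y \<otimes>\<^sub>t c)) (T2 (a \<otimes>\<^sub>t b)))"
proof -
  have l2: "clinear (\<lambda>x. T2 (a \<otimes>\<^sub>t x))" for a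
    by (simp add: clinear_iff tensor_bilin T2_add clinear_scale[OF T2_linear])
  have l1: "clinear (\<lambda>y. T1 (y \<otimes>\<^sub>t c))" for c
    by (simp add: clinear_iff tensor_bilin T1_add clinear_scale[OF T1_linear])
  have b1: "cbilinear (\<lambda>x y. \<Delta> x \<otimes>\<^sub>M embed y)" and b2: "cbilinear (\<lambda>x y. embed x \<otimes>\<^sub>M \<Delta> y)"
    by (simp_all add: cbilinear_iff multiplier_tensor_bilin clinear_add[OF coprod_linear] clinear_scale[OF coprod_linear]
        clinear_add[OF clinear_embed] clinear_scale[OF clinear_embed])
  have mult_tensor: "(m \<otimes>\<^sub>M n) * (m' \<otimes>\<^sub>M n') = (m * m') \<otimes>\<^sub>M (n * n')"
    for m m' :: "'b::complex_algebra multiplier" and n n' :: "'c::complex_algebra multiplier"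
    by (rule multiplier_tensor_eqI) simp_all
  have L: "((embed a \<otimes>\<^sub>M 1) \<otimes>\<^sub>M 1) * mult_tensor_map \<Delta> embed t
      = embed (tensor_map (\<lambda>x. T2 (a \<otimes>\<^sub>t x)) (\<lambda>y. y) t)" for t
    by (induct t rule: tensor_induct)
      (simp_all add: mult_tensor_map_def b1 tensor_lift_add distrib_left mult_tensor embed_T2_tensor
        embed_tensor tensor_map_tensor[OF l2 clinear_id]
        clinear_add[OF tensor_map_linear[OF l2 clinear_id]] clinear_add[OF clinear_embed])
  note ext = mult_ext_hom[OF nondegenerate3 algebra_hom_tensor_reassoc bij_tensor_reassoc]
  note ll = tensor_map_linear[OF clinear_id l1]
  have "mult_tensor_map embed \<Delta> t * (1 \<otimes>\<^sub>M (1 \<otimes>\<^sub>M embed c))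
      = embed (tensor_map (\<lambda>x. x) (\<lambda>y. T1 (y \<otimes>\<^sub>t c)) t)" for t
    by (induct t rule: tensor_induct)
      (simp_all add: mult_tensor_map_def b2 tensor_lift_add distrib_right mult_tensor embed_T1_tensor
        embed_tensor tensor_map_tensor[OF clinear_id l1]
        clinear_add[OF ll] clinear_add[OF clinear_embed])
  then have act: "lact (mult_tensor_map embed \<Delta> t) (lact (1 \<otimes>\<^sub>M (1 \<otimes>\<^sub>M embed c)) z)
      = tensor_map (\<lambda>x. x) (\<lambda>y. T1 (y \<otimes>\<^sub>t c)) t * z" for t z
    by (metis lact_simps(7) lact_embed)
  have flat: "lact ((1 \<otimes>\<^sub>M 1) \<otimes>\<^sub>M embed c) (tensor_reassoc z)
      = tensor_reassoc (lact (1 \<otimes>\<^sub>M (1 \<otimes>\<^sub>M embed c)) z)" for z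
    by (induct z rule: tensor_induct_right) (simp_all add: lact_add tensor_reassoc_add)
  have R: "mult_reassoc (mult_tensor_map embed \<Delta> t) * ((1 \<otimes>\<^sub>M 1) \<otimes>\<^sub>M embed c)
      = embed (tensor_reassoc (tensor_map (\<lambda>x. x) (\<lambda>y. T1 (y \<otimes>\<^sub>t c)) t))"
    for t :: "('a, 'a) tensor"
  proof (rule multiplier_eq_lactI[OF nondegenerate3])
    fix w :: "(('a, 'a) tensor, 'a) tensor"
    \<comment> \<open>The extended reassociation can be evaluated only at reassociated elements, and
      these are all elements.\<close>
    obtain z where z: "w = tensor_reassoc z" using bij_tensor_reassoc by (metis bij_pointE)
    have "lact (mult_reassoc (mult_tensor_map embed \<Delta> t) * ((1 \<otimes>\<^sub>M 1) \<otimes>\<^sub>M embed c)) w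
        = tensor_reassoc (tensor_map (\<lambda>x. x) (\<lambda>y. T1 (y \<otimes>\<^sub>t c)) t * z)"
      unfolding z by (simp add: flat ext act)
    also have "\<dots> = lact (embed (tensor_reassoc (tensor_map (\<lambda>x. x) (\<lambda>y. T1 (y \<otimes>\<^sub>t c)) t))) w"
      by (simp add: z tensor_reassoc_mult)
    finally show "lact (mult_reassoc (mult_tensor_map embed \<Delta> t) * ((1 \<otimes>\<^sub>M 1) \<otimes>\<^sub>M embed c)) w
        = lact (embed (tensor_reassoc (tensor_map (\<lambda>x. x) (\<lambda>y. T1 (y \<otimes>\<^sub>t c)) t))) w" .
  qed
  have "((embed a \<otimes>\<^sub>M 1) \<otimes>\<^sub>M 1) * mult_tensor_map \<Delta> embed (unembed (\<Delta> b * (1 \<otimes>\<^sub>M embed c)))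
      = mult_reassoc (mult_tensor_map embed \<Delta> (unembed ((embed a \<otimes>\<^sub>M 1) * \<Delta> b)))
        * ((1 \<otimes>\<^sub>M 1) \<otimes>\<^sub>M embed c)"
    using mha by (simp add: multiplier_hopf_algebra_def)
  then show ?thesis
    by (simp only: embed_T1_tensor embed_T2_tensor unembed_embed[OF nondegenerate2] L R
        embed_inject[OF nondegenerate3])
qed

text \<open>The Sweedler identity behind it is a e_1 S(e_2) c = a c for
  \<open>\<epsilon> e = 1\<close>. It is derived from coassociativity alone, so that it also holds
  for the co-opposite structure, where no antipode is available yet.\<close>

lemma left_antipode_nondegenerate:
  assumes c: "\<And>y. left_antipode (y \<otimes>\<^sub>t c) = 0"
  shows "c = 0"
proof (rule nondegenerate_productD(2)[OF nondegenerate])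
  fix a
  \<comment> \<open>\<open>\<mu>\<close> stands for (x \<otimes> y) \<otimes> z \<mapsto> x S(y)
    z.\<close>
  define \<mu> where "\<mu> = tensor_lift (\<lambda>s z. tensor_lift (\<lambda>x y. x * left_antipode (y \<otimes>\<^sub>t z)) s)"
  note lin = left_antipode_add clinear_scale[OF left_antipode_linear]
  have b: "cbilinear (\<lambda>x y. x * left_antipode (y \<otimes>\<^sub>t z))" for z
    by (simp add: cbilinear_iff tensor_bilin lin distrib_left distrib_right mult_scaleC_left mult_scaleC_right)
  have b': "cbilinear (\<lambda>s z. tensor_lift (\<lambda>x y. x * left_antipode (y \<otimes>\<^sub>t z)) s)"
    unfolding cbilinear_def
    by (intro conjI allI clinear_tensor_lift_param tensor_lift_linear b)
      (simp add: clinear_iff tensor_bilin lin distrib_left mult_scaleC_right)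
  have \<mu>: "\<mu> (s \<otimes>\<^sub>t z) = tensor_lift (\<lambda>x y. x * left_antipode (y \<otimes>\<^sub>t z)) s" for s z
    by (simp add: \<mu>_def b')
  have \<mu>_lin: "clinear \<mu>" unfolding \<mu>_def by (rule tensor_lift_linear[OF b'])
  have reassoc: "\<mu> (tensor_reassoc (x \<otimes>\<^sub>t t)) = x * left_antipode t" for x t
    by (induct t rule: tensor_induct)
      (simp_all add: \<mu> b tensor_bilin tensor_reassoc_add clinear_add[OF \<mu>_lin] lin distrib_left)
  have l1: "clinear (\<lambda>y. T1 (y \<otimes>\<^sub>t c))" for c
    by (simp add: clinear_iff tensor_bilin T1_add clinear_scale[OF T1_linear])
  have l2: "clinear (\<lambda>x. T2 (a \<otimes>\<^sub>t x))"
    by (simp add: clinear_iff tensor_bilin T2_add clinear_scale[OF T2_linear])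
  have 1: "\<mu> (tensor_reassoc (tensor_map (\<lambda>x. x) (\<lambda>y. T1 (y \<otimes>\<^sub>t c)) s)) = slice_right \<epsilon> s * c" for s c
    by (induct s rule: tensor_induct)
      (simp_all add: tensor_map_tensor[OF clinear_id l1] reassoc left_antipode_T1 slice_eps_bilin
        mult_scaleC_left mult_scaleC_right clinear_add[OF tensor_map_linear[OF clinear_id l1]]
        tensor_reassoc_add clinear_add[OF \<mu>_lin] slice_eps_add distrib_right)
  \<comment> \<open>Coassociativity moves to the form of fact 1, and the counit law for
    \<open>T2\<close> then collapses the remaining coproduct.\<close>
  have 2: "\<mu> (tensor_map (\<lambda>x. T2 (a \<otimes>\<^sub>t x)) (\<lambda>y. y) (T1 W)) = a * tensor_lift (*) W" for W
    by (induct W rule: tensor_induct)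
      (simp_all add: coassociative 1 counit_T2 cbilinear_mult tensor_lift_add T1_add mult.assoc
        clinear_add[OF tensor_map_linear[OF l2 clinear_id]] clinear_add[OF \<mu>_lin] distrib_left)
  obtain e where e: "\<epsilon> e = 1" by (rule eps_nonzero)
  obtain W where W: "T1 W = e \<otimes>\<^sub>t c" using T1_inverse by blast
  have "tensor_lift (\<lambda>x y. x * left_antipode (y \<otimes>\<^sub>t c)) s = 0" for s
  proof (induct s rule: tensor_induct)
    case (tensor x y)
    show ?case by (subst tensor_lift_tensor[OF b]) (simp add: c)
  qed (simp add: tensor_lift_add[OF b])
  then have "\<mu> (T2 (a \<otimes>\<^sub>t e) \<otimes>\<^sub>t c) = 0" by (simp add: \<mu>)
  moreover have "\<mu> (T2 (a \<otimes>\<^sub>t e) \<otimes>\<^sub>t c) = a * c"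
    using 2[of W] by (simp add: W tensor_map_tensor[OF l2 clinear_id] counit_T1_lift slice_eps_bilin e scaleC_one)
  ultimately show "a * c = 0" by simp
qed

text \<open>The counit axiom gives this slice only after left multiplication by y \<otimes> 1. A
  test factor x y from the left supplies that y, and w of counit 1 fills the other leg.\<close>

lemma slice_right_coprod: "slice_right \<epsilon> (lact (\<Delta> a) t) = a * slice_right \<epsilon> t"
proof (rule nondegenerate_product_eqI(2)[OF nondegenerate])
  fix z
  obtain w where w: "\<epsilon> w = 1" by (rule eps_nonzero)
  show "z * slice_right \<epsilon> (lact (\<Delta> a) t) = z * (a * slice_right \<epsilon> t)"
  proof (induct z rule: product_induct)
    case (mult x y)
    have "(x * y) * slice_right \<epsilon> (lact (\<Delta> a) t) = slice_right \<epsilon> (((x * y) \<otimes>\<^sub>t w) * lact (\<Delta> a) t)"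
      by (simp add: slice_eps_mult slice_eps_bilin w scaleC_one)
    also have "\<dots> = slice_right \<epsilon> ((x \<otimes>\<^sub>t w) * T2 (y \<otimes>\<^sub>t a) * t)"
      by (simp add: lact_ract ract_coprod)
    also have "\<dots> = (x * y) * (a * slice_right \<epsilon> t)"
      by (simp add: slice_eps_mult slice_eps_bilin w scaleC_one counit_T2 mult.assoc)
    finally show ?case .
  qed (simp add: distrib_right)
qed

lemma slice_left_coprod: "slice_left \<epsilon> (ract (\<Delta> a) t) = slice_left \<epsilon> t * a"
proof (rule nondegenerate_product_eqI(1)[OF nondegenerate])
  fix z
  obtain w where w: "\<epsilon> w = 1" by (rule eps_nonzero)
  show "slice_left \<epsilon> (ract (\<Delta> a) t) * z = slice_left \<epsilon> t * a * z"
  proof (induct z rule: product_induct)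
    case (mult x y)
    have "slice_left \<epsilon> (ract (\<Delta> a) t) * (x * y) = slice_left \<epsilon> (ract (\<Delta> a) t * (w \<otimes>\<^sub>t (x * y)))"
      by (simp add: slice_eps_mult slice_eps_bilin w scaleC_one)
    also have "\<dots> = slice_left \<epsilon> (t * (T1 (a \<otimes>\<^sub>t x) * (w \<otimes>\<^sub>t y)))"
      by (simp add: lact_ract[symmetric] lact_coprod)
    also have "\<dots> = slice_left \<epsilon> t * a * (x * y)"
      by (simp add: slice_eps_mult slice_eps_bilin w scaleC_one counit_T1 mult.assoc)
    finally show ?case .
  qed (simp add: distrib_left)
qed

lemma slice_flip: "slice_left \<epsilon> (tensor_flip t) = slice_right \<epsilon> t"
  "slice_right \<epsilon> (tensor_flip t) = slice_left \<epsilon> t"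
  for t :: "('a, 'a) tensor"
  by (induct t rule: tensor_induct) (simp_all add: slice_eps_bilin slice_eps_add tensor_flip_add)

text \<open>Flipping exchanges the two slices, so each law becomes a statement on the slice for
  which the axiom offers only the opposite-sided covering; the two preceding slice lemmas provide
  it.\<close>

lemma is_counit_cop:
  assumes "multiplier_hopf_algebra (coproduct_cop \<Delta>)"
  shows "is_counit (coproduct_cop \<Delta>) \<epsilon>"
  unfolding is_counit_def
proof (intro conjI allI)
  obtain w where w: "\<epsilon> w = 1" by (rule eps_nonzero)
  show "algebra_hom \<epsilon>" using counit by (simp add: is_counit_def)
  fix a b
  \<comment> \<open>The bijectivity axiom concerns a \<open>tensor_lift\<close>, which evaluates at
    a \<otimes> b only for a bilinear map; linearity is supplied below.\<close>
  have "coproduct_cop \<Delta> a * (1 \<otimes>\<^sub>M embed b) \<in> range embed" if "clinear (coproduct_cop \<Delta>)"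
  proof -
    have "cbilinear (\<lambda>a b. coproduct_cop \<Delta> a * (1 \<otimes>\<^sub>M embed b))"
      by (simp add: cbilinear_iff multiplier_tensor_bilin clinear_add[OF that] clinear_scale[OF that]
          clinear_add[OF clinear_embed] clinear_scale[OF clinear_embed] distrib_left distrib_right
          mult_scaleC_left mult_scaleC_right)
    then have "coproduct_cop \<Delta> a * (1 \<otimes>\<^sub>M embed b)
        = tensor_lift (\<lambda>a b. coproduct_cop \<Delta> a * (1 \<otimes>\<^sub>M embed b)) (a \<otimes>\<^sub>t b)" by simp
    then show ?thesis
      using assms unfolding multiplier_hopf_algebra_def bij_betw_def by blast
  qed
  moreover have "(embed a \<otimes>\<^sub>M 1) * coproduct_cop \<Delta> b \<in> range embed" if "clinear (coproduct_cop \<Delta>)"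
  proof -
    have "cbilinear (\<lambda>a b. (embed a \<otimes>\<^sub>M 1) * coproduct_cop \<Delta> b)"
      by (simp add: cbilinear_iff multiplier_tensor_bilin clinear_add[OF that] clinear_scale[OF that]
          clinear_add[OF clinear_embed] clinear_scale[OF clinear_embed] distrib_left distrib_right
          mult_scaleC_left mult_scaleC_right)
    then have "(embed a \<otimes>\<^sub>M 1) * coproduct_cop \<Delta> b
        = tensor_lift (\<lambda>a b. (embed a \<otimes>\<^sub>M 1) * coproduct_cop \<Delta> b) (a \<otimes>\<^sub>t b)" by simp
    then show ?thesis
      using assms unfolding multiplier_hopf_algebra_def bij_betw_def by blast
  qed
  moreover have "clinear (coproduct_cop \<Delta>)"
    using assms by (simp add: multiplier_hopf_algebra_def algebra_hom_def)
  ultimately obtain s t where s: "coproduct_cop \<Delta> a * (1 \<otimes>\<^sub>M embed b) = embed s"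
    and t: "(embed a \<otimes>\<^sub>M 1) * coproduct_cop \<Delta> b = embed t" by blast
  have "slice_left \<epsilon> s * y = a * b * y" for y
  proof -
    have "slice_left \<epsilon> s * y = slice_left \<epsilon> (lact (embed s) (w \<otimes>\<^sub>t y))"
      by (simp add: slice_eps_mult slice_eps_bilin w scaleC_one)
    also have "\<dots> = a * b * y"
      by (simp add: s[symmetric] coproduct_cop_act(1)[OF nondegenerate] slice_flip slice_right_coprod slice_eps_bilin
          w scaleC_one mult.assoc)
    finally show ?thesis .
  qed
  then show "slice_left \<epsilon> (unembed (coproduct_cop \<Delta> a * (1 \<otimes>\<^sub>M embed b))) = a * b"
    by (simp add: s unembed_embed[OF nondegenerate2] nondegenerate_product_eqI(1)[OF nondegenerate])
  have "y * slice_right \<epsilon> t = y * (a * b)" for y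
  proof -
    have "y * slice_right \<epsilon> t = slice_right \<epsilon> (ract (embed t) (y \<otimes>\<^sub>t w))"
      by (simp add: slice_eps_mult slice_eps_bilin w scaleC_one)
    also have "\<dots> = y * (a * b)"
      by (simp add: t[symmetric] coproduct_cop_act(2)[OF nondegenerate] slice_flip slice_left_coprod slice_eps_bilin
          w scaleC_one mult.assoc)
    finally show ?thesis .
  qed
  then show "slice_right \<epsilon> (unembed ((embed a \<otimes>\<^sub>M 1) * coproduct_cop \<Delta> b)) = a * b"
    by (simp add: t unembed_embed[OF nondegenerate2] nondegenerate_product_eqI(2)[OF nondegenerate])
qed

end

locale regular_mult_hopf = mult_hopf +
  fixes S :: "'a::complex_algebra \<Rightarrow> 'a"
  assumes regular: "multiplier_hopf_algebra (coproduct_cop \<Delta>)"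
    and antipode: "is_antipode \<Delta> \<epsilon> S"

text \<open>In this instance \<open>cop.left_antipode\<close> takes the place of S'(a) b, where S'
  is the co-opposite antipode, without S'(a) having to lie in A.\<close>

sublocale regular_mult_hopf \<subseteq> cop: mult_hopf "coproduct_cop \<Delta>" \<epsilon>
  by unfold_locales (use regular is_counit_cop nontrivial in auto)

context regular_mult_hopf
begin

lemma S_linear: "clinear S" and S_mult: "S (a * b) = S b * S a"
  using antipode by (simp_all add: is_antipode_def algebra_antihom_def)

text \<open>Both sides have the same composite with \<open>T1\<close>, one by the antipode axiom,
  and \<open>T1\<close> is surjective.\<close>

lemma left_antipode_eq: "left_antipode (a \<otimes>\<^sub>t b) = S a * b"
proof -
  have b: "cbilinear (\<lambda>x y. S x * y)"
    by (simp add: cbilinear_iff clinear_add[OF S_linear] clinear_scale[OF S_linear]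
        distrib_left distrib_right mult_scaleC_left mult_scaleC_right)
  have *: "tensor_lift (\<lambda>x y. S x * y) (T1 (x \<otimes>\<^sub>t y)) = \<epsilon> x *\<^sub>C y" for x y
    using antipode by (simp add: is_antipode_def embed_T1_tensor unembed_embed[OF nondegenerate2])
  have "tensor_lift (\<lambda>x y. S x * y) (T1 t) = slice_left \<epsilon> t" for t
    by (induct t rule: tensor_induct)
      (simp_all add: * slice_eps_bilin slice_eps_add T1_add tensor_lift_add[OF b])
  then have "left_antipode t = tensor_lift (\<lambda>x y. S x * y) t" for t
    using T1_inverse left_antipode_T1 by metis
  then show ?thesis by (simp add: b)
qed

lemma bij_antipode: "bij S"
proof (rule bijI)
  have "left_antipode t \<in> range S" for t
  proof (induct t rule: tensor_induct)
    case (tensor q x)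
    \<comment> \<open>After the flip, \<open>left_antipode\<close> is invariant under the
      co-opposite coproduct, so the shift lemma applies in that instance.\<close>
    have "clinear (\<lambda>t. left_antipode (tensor_flip t))"
      by (simp add: clinear_iff tensor_flip_add left_antipode_add
          clinear_scale[OF tensor_flip_linear] clinear_scale[OF left_antipode_linear])
    then have "left_antipode (q \<otimes>\<^sub>t (x * p)) = left_antipode (cop.left_antipode (x \<otimes>\<^sub>t q) \<otimes>\<^sub>t p)" for p
      using cop.invariant_shift[of "\<lambda>t. left_antipode (tensor_flip t)" x p q]
      by (simp add: coproduct_cop_act(1)[OF nondegenerate] left_antipode_coprod)
    then have "S q * x * p = S (cop.left_antipode (x \<otimes>\<^sub>t q)) * p" for p
      by (simp add: left_antipode_eq mult.assoc)
    then have "S q * x = S (cop.left_antipode (x \<otimes>\<^sub>t q))"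
      by (rule nondegenerate_product_eqI(1)[OF nondegenerate])
    then show ?case by (metis left_antipode_eq rangeI)
  next
    case (add s t)
    then show ?case by (auto simp: left_antipode_add simp flip: clinear_add[OF S_linear])
  qed
  then show "surj S" using left_antipode_surj by (metis surj_def rangeE)
  have "x = 0" if "S x = 0" for x
  \<comment> \<open>It suffices that x p vanishes for every p, and this is tested with the
    co-opposite left antipode, whose value the shift expresses through S x.\<close>
  proof (rule nondegenerate_productD(1)[OF nondegenerate], rule cop.left_antipode_nondegenerate)
    fix p q
    have "clinear (\<lambda>t. cop.left_antipode (tensor_flip t))"
      by (simp add: clinear_iff tensor_flip_add cop.left_antipode_add
          clinear_scale[OF tensor_flip_linear] clinear_scale[OF cop.left_antipode_linear])
    moreover have "cop.left_antipode (tensor_flip (lact (\<Delta> a) t))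
        = \<epsilon> a *\<^sub>C cop.left_antipode (tensor_flip t)" for a t
      using cop.left_antipode_coprod[of a "tensor_flip t"] by (simp add: coproduct_cop_act(1)[OF nondegenerate])
    ultimately have "cop.left_antipode (q \<otimes>\<^sub>t (x * p)) = cop.left_antipode (left_antipode (x \<otimes>\<^sub>t q) \<otimes>\<^sub>t p)"
      using invariant_shift[of "\<lambda>t. cop.left_antipode (tensor_flip t)" x p q] by simp
    then show "cop.left_antipode (q \<otimes>\<^sub>t (x * p)) = 0"
      by (simp add: left_antipode_eq that clinear_zero[OF cop.left_antipode_linear])
  qed
  then show "inj S"
    unfolding inj_def by (metis clinear_diff[OF S_linear] eq_iff_diff_eq_0)
qed

end

section \<open>Gradings, crossings and the deformed coproduct\<close>

locale crossed_mult_hopf = regular_mult_hopf +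
  fixes G :: "('g, 'm) monoid_scheme" and A :: "'g \<Rightarrow> 'a::complex_algebra set"
    and \<pi> :: "'g \<Rightarrow> 'a \<Rightarrow> 'a"
  assumes group: "group G" and cograded: "cograded G \<Delta> A" and crossing: "crossing G \<Delta> A \<pi>"
begin

section \<open>Homogeneous components\<close>

lemma component_subspace: "p \<in> carrier G \<Longrightarrow> csubspace (A p)"
  and component_orthogonal:
    "p \<in> carrier G \<Longrightarrow> q \<in> carrier G \<Longrightarrow> p \<noteq> q \<Longrightarrow> a \<in> A p \<Longrightarrow> b \<in> A q \<Longrightarrow> a * b = 0"
  and component_mult: "p \<in> carrier G \<Longrightarrow> a \<in> A p \<Longrightarrow> b \<in> A p \<Longrightarrow> a * b \<in> A p"
  and T1_component: "p \<in> carrier G \<Longrightarrow> q \<in> carrier G \<Longrightarrow>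
    cspan {\<Delta> a * (1 \<otimes>\<^sub>M embed b) | a b. a \<in> A (p \<otimes>\<^bsub>G\<^esub> q) \<and> b \<in> A q}
      = embed ` cspan {x \<otimes>\<^sub>t y | x y. x \<in> A p \<and> y \<in> A q}"
  using cograded by (simp_all only: cograded_def, simp_all)

lemma component_0: "p \<in> carrier G \<Longrightarrow> 0 \<in> A p"
  and component_add: "p \<in> carrier G \<Longrightarrow> a \<in> A p \<Longrightarrow> b \<in> A p \<Longrightarrow> a + b \<in> A p"
  and component_scale: "p \<in> carrier G \<Longrightarrow> a \<in> A p \<Longrightarrow> c *\<^sub>C a \<in> A p"
  using component_subspace complex_vector.subspace_0 complex_vector.subspace_add
    complex_vector.subspace_scale by blast+

definition decomposes :: "'a \<Rightarrow> ('g \<Rightarrow> 'a) \<Rightarrow> bool"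
  where "decomposes a f \<longleftrightarrow> (\<forall>p\<in>carrier G. f p \<in> A p) \<and> (\<forall>p. p \<notin> carrier G \<longrightarrow> f p = 0)
    \<and> finite {p. f p \<noteq> 0} \<and> a = (\<Sum>p | f p \<noteq> 0. f p)"

definition part :: "'a \<Rightarrow> 'g \<Rightarrow> 'a"
  where "part a = (THE f. decomposes a f)"

lemma decomposes_ex1: "\<exists>!f. decomposes a f"
  using cograded by (simp only: cograded_def decomposes_def)

lemma decomposes_part: "decomposes a (part a)"
  unfolding part_def by (rule theI'[OF decomposes_ex1])

lemma part_eq: "decomposes a f \<Longrightarrow> part a = f"
  using decomposes_ex1 decomposes_part by blast

lemma part_in: "p \<in> carrier G \<Longrightarrow> part a p \<in> A p"
  and part_outside: "p \<notin> carrier G \<Longrightarrow> part a p = 0"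
  and part_finite: "finite {p. part a p \<noteq> 0}"
  and part_sum: "(\<Sum>p | part a p \<noteq> 0. part a p) = a"
  using decomposes_part[of a] by (simp_all add: decomposes_def)

lemma decomposesI:
  assumes "finite K" "\<And>p. p \<in> carrier G \<Longrightarrow> f p \<in> A p" "\<And>p. p \<notin> carrier G \<Longrightarrow> f p = 0"
    "{p. f p \<noteq> 0} \<subseteq> K" "a = sum f K"
  shows "decomposes a f"
  unfolding decomposes_def using assms finite_subset[OF assms(4,1)]
  by (auto intro!: sum.mono_neutral_right)

lemma part_sum_superset: "finite K \<Longrightarrow> {p. part a p \<noteq> 0} \<subseteq> K \<Longrightarrow> sum (part a) K = a"
  by (subst (2) part_sum[symmetric]) (auto intro!: sum.mono_neutral_right)

lemma part_add: "part (a + b) p = part a p + part b p"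
proof -
  let ?K = "{p. part a p \<noteq> 0} \<union> {p. part b p \<noteq> 0}"
  have "finite ?K" by (simp add: part_finite)
  then have "decomposes (a + b) (\<lambda>p. part a p + part b p)"
    by (intro decomposesI[of ?K])
      (auto simp: component_add part_in part_outside sum.distrib part_sum_superset)
  then show ?thesis by (simp add: part_eq)
qed

lemma part_scale: "part (c *\<^sub>C a) p = c *\<^sub>C part a p"
proof -
  have "decomposes (c *\<^sub>C a) (\<lambda>p. c *\<^sub>C part a p)"
    by (intro decomposesI[of "{p. part a p \<noteq> 0}"])
      (auto simp: component_scale part_in part_outside part_finite part_sum
        complex_vector.scale_sum_right[symmetric])
  then show ?thesis by (simp add: part_eq)
qed

lemma part_homogeneous: "p \<in> carrier G \<Longrightarrow> a \<in> A p \<Longrightarrow> part a q = (if q = p then a else 0)"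
proof -
  assume "p \<in> carrier G" "a \<in> A p"
  then have "decomposes a (\<lambda>q. if q = p then a else 0)"
    by (intro decomposesI[of "{p}"]) (auto simp: component_0)
  then show ?thesis by (simp add: part_eq)
qed

lemma component_iff: "p \<in> carrier G \<Longrightarrow> (\<And>q. q \<in> carrier G \<Longrightarrow> q \<noteq> p \<Longrightarrow> part a q = 0) \<Longrightarrow> a \<in> A p"
  using part_sum_superset[of "{p}" a] part_in[of p a] part_outside[of _ a] by fastforce

sublocale G: group G by (rule group)

lemma homogeneous_induct [case_names homogeneous add]:
  assumes H: "\<And>p a. p \<in> carrier G \<Longrightarrow> a \<in> A p \<Longrightarrow> P a" and add: "\<And>a b. P a \<Longrightarrow> P b \<Longrightarrow> P (a + b)"
  shows "P a"
proof -
  have "P (sum (part a) K)" if "finite K" "K \<subseteq> carrier G" for K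
    using that
    \<comment> \<open>The empty sum is covered by 0 as an element of the unit component.\<close>
    by (induct K) (auto intro: H[OF G.one_closed component_0[OF G.one_closed]] add H part_in)
  moreover have "{p. part a p \<noteq> 0} \<subseteq> carrier G" using part_outside by auto
  ultimately show ?thesis by (metis part_finite part_sum)
qed

lemma tensor_homogeneous_induct [case_names homogeneous add]:
  fixes t :: "('a, 'a) tensor"
  assumes H: "\<And>p q x y. p \<in> carrier G \<Longrightarrow> q \<in> carrier G \<Longrightarrow> x \<in> A p \<Longrightarrow> y \<in> A q \<Longrightarrow> P (x \<otimes>\<^sub>t y)"
    and add: "\<And>s t. P s \<Longrightarrow> P t \<Longrightarrow> P (s + t)"
  shows "P t"
proof (induct t rule: tensor_induct)
  case (tensor x y)
  show ?case
  proof (induct x rule: homogeneous_induct)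
    case (homogeneous p x)
    then show ?case
      by (induct y rule: homogeneous_induct) (auto simp: tensor_bilin intro: H add)
  qed (simp add: tensor_bilin add)
qed (rule add)

text \<open>Glues one linear map per component to a map on A. The deformed antipode, the twists and
  their inverses are all of this form.\<close>

definition graded_sum :: "('g \<Rightarrow> 'a \<Rightarrow> 'b::complex_vector) \<Rightarrow> 'a \<Rightarrow> 'b"
  where "graded_sum F a = (\<Sum>p | part a p \<noteq> 0. F p (part a p))"

lemma graded_sum_superset:
  assumes "\<And>p. p \<in> carrier G \<Longrightarrow> clinear (F p)" "finite K" "{p. part a p \<noteq> 0} \<subseteq> K" "K \<subseteq> carrier G"
  shows "graded_sum F a = (\<Sum>p\<in>K. F p (part a p))"
  unfolding graded_sum_def using assms
  by (intro sum.mono_neutral_left) (auto simp: clinear_zero subset_iff)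

lemma graded_sum_linear:
  assumes F: "\<And>p. p \<in> carrier G \<Longrightarrow> clinear (F p)"
  shows "clinear (graded_sum F)"
  unfolding clinear_iff
proof (intro conjI allI)
  fix a b c
  have C: "{p. part a p \<noteq> 0} \<subseteq> carrier G" for a using part_outside by auto
  let ?K = "{p. part a p \<noteq> 0} \<union> {p. part b p \<noteq> 0}"
  have K: "finite ?K" "?K \<subseteq> carrier G" using C by (simp_all add: part_finite)
  have "{p. part (a + b) p \<noteq> 0} \<subseteq> ?K" by (auto simp: part_add)
  then have "graded_sum F (a + b) = (\<Sum>p\<in>?K. F p (part a p) + F p (part b p))"
    using K by (subst graded_sum_superset[where K = ?K, OF F])
      (auto simp: part_add clinear_add[OF F] subset_iff intro!: sum.cong)
  then show "graded_sum F (a + b) = graded_sum F a + graded_sum F b"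
    using K by (simp add: sum.distrib graded_sum_superset[where K = ?K, OF F])
  have "graded_sum F (c *\<^sub>C a) = (\<Sum>p | part a p \<noteq> 0. c *\<^sub>C F p (part a p))"
    using C[of a] by (subst graded_sum_superset[where K = "{p. part a p \<noteq> 0}", OF F])
      (auto simp: part_finite part_scale clinear_scale[OF F] subset_iff intro!: sum.cong)
  then show "graded_sum F (c *\<^sub>C a) = c *\<^sub>C graded_sum F a"
    by (simp add: graded_sum_def complex_vector.scale_sum_right)
qed

lemma graded_sum_homogeneous:
  assumes "\<And>p. p \<in> carrier G \<Longrightarrow> clinear (F p)" "p \<in> carrier G" "a \<in> A p"
  shows "graded_sum F a = F p a"
  using assms by (subst graded_sum_superset[where K = "{p}", OF assms(1)]) (auto simp: part_homogeneous)

lemma mult_component: "p \<in> carrier G \<Longrightarrow> b \<in> A p \<Longrightarrow> a * b = part a p * b"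
proof (induct a rule: homogeneous_induct)
  case (homogeneous q a)
  then show ?case by (auto simp: part_homogeneous component_orthogonal)
qed (simp add: part_add distrib_right)

lemma component_mult_left: "p \<in> carrier G \<Longrightarrow> b \<in> A p \<Longrightarrow> b * a \<in> A p"
proof (induct a rule: homogeneous_induct)
  case (homogeneous q a)
  then show ?case by (cases "p = q") (auto simp: component_mult component_orthogonal component_0)
qed (simp add: distrib_left component_add)



section \<open>Compatibility of the crossing with coproduct, counit and antipode\<close>

lemma pi_linear: "p \<in> carrier G \<Longrightarrow> clinear (\<pi> p)"
  and pi_mult: "p \<in> carrier G \<Longrightarrow> \<pi> p (a * b) = \<pi> p a * \<pi> p b"
  and pi_hom: "p \<in> carrier G \<Longrightarrow> algebra_hom (\<pi> p)"
  and pi_bij: "p \<in> carrier G \<Longrightarrow> bij (\<pi> p)"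
  and pi_comp: "p \<in> carrier G \<Longrightarrow> q \<in> carrier G \<Longrightarrow> \<pi> (p \<otimes>\<^bsub>G\<^esub> q) a = \<pi> p (\<pi> q a)"
  and pi_component_conj: "p \<in> carrier G \<Longrightarrow> q \<in> carrier G \<Longrightarrow> a \<in> A q \<Longrightarrow>
    \<pi> p a \<in> A (p \<otimes>\<^bsub>G\<^esub> q \<otimes>\<^bsub>G\<^esub> inv\<^bsub>G\<^esub> p)"
  and coprod_pi: "p \<in> carrier G \<Longrightarrow> \<Delta> (\<pi> p a) = mult_diag (\<pi> p) (\<Delta> a)"
  using crossing unfolding crossing_def algebra_hom_def fun_eq_iff comp_apply by blast+

text \<open>\<open>crossing\<close> states only multiplicativity; an injective idempotent map is the
  identity.\<close>

lemma pi_one: "\<pi> \<one>\<^bsub>G\<^esub> a = a"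
proof -
  have "\<pi> \<one>\<^bsub>G\<^esub> (\<pi> \<one>\<^bsub>G\<^esub> a) = \<pi> \<one>\<^bsub>G\<^esub> a"
    using pi_comp[of "\<one>\<^bsub>G\<^esub>" "\<one>\<^bsub>G\<^esub>" a] by simp
  then show ?thesis using bij_is_inj[OF pi_bij[of "\<one>\<^bsub>G\<^esub>"]] by (simp add: inj_eq)
qed

lemma pi_inv [simp]: "p \<in> carrier G \<Longrightarrow> \<pi> (inv\<^bsub>G\<^esub> p) (\<pi> p a) = a"
  "p \<in> carrier G \<Longrightarrow> \<pi> p (\<pi> (inv\<^bsub>G\<^esub> p) a) = a"
  by (simp_all add: pi_comp[symmetric] pi_one)

lemma pi_component: "p \<in> carrier G \<Longrightarrow> a \<in> A p \<Longrightarrow> \<pi> p a \<in> A p"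
  using pi_component_conj[of p p a] by (simp add: G.m_assoc)

lemma pi_inv_component: "p \<in> carrier G \<Longrightarrow> a \<in> A p \<Longrightarrow> \<pi> (inv\<^bsub>G\<^esub> p) a \<in> A p"
  using pi_component_conj[of "inv\<^bsub>G\<^esub> p" p a] by simp

lemma lact_coprod_pi:
  assumes p: "p \<in> carrier G"
  shows "lact (\<Delta> (\<pi> p a)) (tensor_map (\<pi> p) (\<pi> p) t) = tensor_map (\<pi> p) (\<pi> p) (lact (\<Delta> a) t)"
proof -
  have "bij (tensor_map (\<pi> p) (\<pi> p))"
    using p by (intro o_bij[of "tensor_map (\<pi> (inv\<^bsub>G\<^esub> p)) (\<pi> (inv\<^bsub>G\<^esub> p))"] ext)
      (simp_all add: tensor_map_inverse pi_linear)
  from mult_ext_hom(1)[OF nondegenerate2 tensor_map_hom[OF pi_hom[OF p] pi_hom[OF p]] this]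
  show ?thesis by (simp add: coprod_pi p)
qed

lemma T1_pi:
  assumes p: "p \<in> carrier G"
  shows "T1 (tensor_map (\<pi> p) (\<pi> p) t) = tensor_map (\<pi> p) (\<pi> p) (T1 t)"
proof (induct t rule: tensor_induct)
  note l = tensor_map_linear[OF pi_linear[OF p] pi_linear[OF p]]
  case (tensor a b)
  show ?case
  proof (rule nondegenerate_product_eqI(1)[OF nondegenerate2])
    fix s :: "('a, 'a) tensor"
    show "T1 (tensor_map (\<pi> p) (\<pi> p) (a \<otimes>\<^sub>t b)) * s = tensor_map (\<pi> p) (\<pi> p) (T1 (a \<otimes>\<^sub>t b)) * s"
    proof (induct s rule: tensor_induct)
      case (tensor x y)
      obtain x' y' where "x = \<pi> p x'" "y = \<pi> p y'" using pi_bij[OF p] by (metis bij_pointE)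
      then have xy: "x \<otimes>\<^sub>t y = tensor_map (\<pi> p) (\<pi> p) (x' \<otimes>\<^sub>t y')"
        and xby: "x \<otimes>\<^sub>t (\<pi> p b * y) = tensor_map (\<pi> p) (\<pi> p) (x' \<otimes>\<^sub>t (b * y'))"
        by (simp_all add: pi_linear p pi_mult)
      have "T1 (tensor_map (\<pi> p) (\<pi> p) (a \<otimes>\<^sub>t b)) * (x \<otimes>\<^sub>t y) = lact (\<Delta> (\<pi> p a)) (x \<otimes>\<^sub>t (\<pi> p b * y))"
        by (simp add: lact_coprod pi_linear p)
      also have "\<dots> = tensor_map (\<pi> p) (\<pi> p) (T1 (a \<otimes>\<^sub>t b) * (x' \<otimes>\<^sub>t y'))"
        unfolding xby lact_coprod_pi[OF p] by (simp add: lact_coprod)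
      also have "\<dots> = tensor_map (\<pi> p) (\<pi> p) (T1 (a \<otimes>\<^sub>t b)) * (x \<otimes>\<^sub>t y)"
        using tensor_map_hom[OF pi_hom[OF p] pi_hom[OF p]] by (simp add: algebra_hom_def xy)
      finally show ?case .
    qed (simp add: distrib_left)
  qed
qed (simp add: T1_add clinear_add[OF tensor_map_linear[OF pi_linear[OF p] pi_linear[OF p]]])

text \<open>Uniqueness of the counit: composing it with the automorphism satisfies the same left
  counit law, and surjectivity of \<open>T1\<close> makes the slices equal. A nonzero y then
  separates the scalars.\<close>

lemma eps_pi:
  assumes p: "p \<in> carrier G"
  shows "\<epsilon> (\<pi> p a) = \<epsilon> a"
proof -
  note l = tensor_map_linear[OF pi_linear[OF p] pi_linear[OF p]]
  have "clinear (\<lambda>a. \<epsilon> (\<pi> p a))"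
    by (simp add: clinear_iff clinear_add[OF eps_linear] clinear_scale[OF eps_linear]
        clinear_add[OF pi_linear[OF p]] clinear_scale[OF pi_linear[OF p]])
  note b = slice_bilin(1)[OF this]
  have 1: "\<pi> p (slice_left (\<lambda>a. \<epsilon> (\<pi> p a)) t) = slice_left \<epsilon> (tensor_map (\<pi> p) (\<pi> p) t)"
    for t :: "('a, 'a) tensor"
    by (induct t rule: tensor_induct)
      (simp_all add: b slice_eps_bilin slice_eps_add tensor_lift_add[OF b] clinear_add[OF l]
        clinear_add[OF pi_linear[OF p]] clinear_scale[OF pi_linear[OF p]] pi_linear p)
  have "\<pi> p (slice_left (\<lambda>a. \<epsilon> (\<pi> p a)) (T1 t)) = \<pi> p (slice_left \<epsilon> (T1 t))" for t
    unfolding 1 T1_pi[OF p, symmetric]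
    by (induct t rule: tensor_induct)
      (simp_all add: counit_T1 pi_linear p pi_mult clinear_add[OF l] T1_add slice_eps_add
        clinear_add[OF pi_linear[OF p]])
  then have "slice_left (\<lambda>a. \<epsilon> (\<pi> p a)) (T1 t) = slice_left \<epsilon> (T1 t)" for t
    using bij_is_inj[OF pi_bij[OF p]] by (simp add: inj_eq)
  then have "slice_left (\<lambda>a. \<epsilon> (\<pi> p a)) t = slice_left \<epsilon> t" for t :: "('a, 'a) tensor"
    using T1_inverse by metis
  from this[of "a \<otimes>\<^sub>t _"] have "\<epsilon> (\<pi> p a) *\<^sub>C y = \<epsilon> a *\<^sub>C y" for y :: 'a
    by (simp add: b slice_eps_bilin)
  then show ?thesis using nontrivial complex_vector.scale_right_imp_eq by metis
qed

text \<open>The automorphism commutes with \<open>T1\<close> and preserves the counit, hence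
  commutes with \<open>left_antipode\<close>.\<close>

lemma S_pi:
  assumes p: "p \<in> carrier G"
  shows "S (\<pi> p a) = \<pi> p (S a)"
proof -
  note l = tensor_map_linear[OF pi_linear[OF p] pi_linear[OF p]]
  have 1: "slice_left \<epsilon> (tensor_map (\<pi> p) (\<pi> p) t) = \<pi> p (slice_left \<epsilon> t)"
    for t :: "('a, 'a) tensor"
    by (induct t rule: tensor_induct)
      (simp_all add: slice_eps_bilin slice_eps_add clinear_add[OF l] eps_pi
        clinear_add[OF pi_linear[OF p]] clinear_scale[OF pi_linear[OF p]] pi_linear p)
  have 2: "left_antipode (tensor_map (\<pi> p) (\<pi> p) t) = \<pi> p (left_antipode t)" for t
  proof -
    obtain s where "t = T1 s" using T1_inverse by metis
    then show ?thesis by (simp add: left_antipode_T1 T1_pi[OF p, symmetric] 1)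
  qed
  have "S (\<pi> p a) * b = \<pi> p (S a) * b" for b
  proof -
    obtain b' where "b = \<pi> p b'" using pi_bij[OF p] by (metis bij_pointE)
    then show ?thesis using 2[of "a \<otimes>\<^sub>t b'"] by (simp add: left_antipode_eq pi_linear p pi_mult)
  qed
  then show ?thesis by (rule nondegenerate_product_eqI(1)[OF nondegenerate])
qed

section \<open>Counit and antipode on the components\<close>

lemma T1_preimage:
  assumes pq: "p \<in> carrier G" "q \<in> carrier G" and x: "x \<in> A p" "y \<in> A q"
  shows "\<exists>t \<in> cspan {a \<otimes>\<^sub>t b | a b. a \<in> A (p \<otimes>\<^bsub>G\<^esub> q) \<and> b \<in> A q}. T1 t = x \<otimes>\<^sub>t y"
proof -
  let ?Y = "{a \<otimes>\<^sub>t b | a b. a \<in> A (p \<otimes>\<^bsub>G\<^esub> q) \<and> b \<in> A q}"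
  have *: "\<exists>t \<in> cspan ?Y. embed (T1 t) = m"
    if "m \<in> cspan {\<Delta> a * (1 \<otimes>\<^sub>M embed b) | a b. a \<in> A (p \<otimes>\<^bsub>G\<^esub> q) \<and> b \<in> A q}" for m
    using that
  proof (induct m rule: complex_vector.span_induct_alt)
    case base
    have "embed (T1 0) = 0" by (simp add: clinear_zero[OF T1_linear] clinear_zero[OF clinear_embed])
    then show ?case using complex_vector.span_zero by blast
  next
    case (step c m n)
    then obtain a b t where m: "m = \<Delta> a * (1 \<otimes>\<^sub>M embed b)" "a \<in> A (p \<otimes>\<^bsub>G\<^esub> q)" "b \<in> A q"
      and t: "t \<in> cspan ?Y" "embed (T1 t) = n" by blast
    have "embed (T1 (c *\<^sub>C (a \<otimes>\<^sub>t b) + t)) = c *\<^sub>C m + n"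
      by (simp add: m t T1_add clinear_scale[OF T1_linear] clinear_add[OF clinear_embed]
          clinear_scale[OF clinear_embed] embed_T1_tensor)
    moreover have "c *\<^sub>C (a \<otimes>\<^sub>t b) + t \<in> cspan ?Y"
      using m(2,3)
      by (intro complex_vector.span_add[OF complex_vector.span_scale[OF complex_vector.span_base] t(1)]) auto
    ultimately show ?case by blast
  qed
  have "embed (x \<otimes>\<^sub>t y)
      \<in> cspan {\<Delta> a * (1 \<otimes>\<^sub>M embed b) | a b. a \<in> A (p \<otimes>\<^bsub>G\<^esub> q) \<and> b \<in> A q}"
    unfolding T1_component[OF pq] using x by (intro imageI complex_vector.span_base) auto
  from *[OF this] show ?thesis by (simp add: embed_inject[OF nondegenerate2])
qed

lemma T1_image:
  assumes pq: "p \<in> carrier G" "q \<in> carrier G" and a: "a \<in> A (p \<otimes>\<^bsub>G\<^esub> q)" "b \<in> A q"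
  shows "T1 (a \<otimes>\<^sub>t b) \<in> cspan {x \<otimes>\<^sub>t y | x y. x \<in> A p \<and> y \<in> A q}"
proof -
  have "embed (T1 (a \<otimes>\<^sub>t b)) \<in> embed ` cspan {x \<otimes>\<^sub>t y | x y. x \<in> A p \<and> y \<in> A q}"
    unfolding T1_component[OF pq, symmetric] embed_T1_tensor[symmetric]
    using a by (intro complex_vector.span_base) auto
  then show ?thesis by (auto simp: embed_inject[OF nondegenerate2])
qed

lemma span_zero_on:
  assumes "clinear f" "\<And>x. x \<in> X \<Longrightarrow> f x = 0" "t \<in> cspan X"
  shows "f t = 0"
  using assms(3)
  by (induct rule: complex_vector.span_induct_alt)
    (simp_all add: clinear_zero[OF assms(1)] clinear_add[OF assms(1)] clinear_scale[OF assms(1)] assms(2))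

text \<open>For nonzero y in A_q, the preimage of x \<otimes> y under \<open>T1\<close> lies in
  A_{pq} \<otimes> A_q. Since pq differs from q, multiplying it out gives zero, which the counit law
  identifies with the counit of x times y.\<close>

lemma eps_component:
  assumes p: "p \<in> carrier G" "p \<noteq> \<one>\<^bsub>G\<^esub>" "x \<in> A p"
  shows "\<epsilon> x = 0"
proof -
  have "\<exists>q\<in>carrier G. \<exists>y\<in>A q. y \<noteq> 0"
  proof (rule ccontr)
    assume "\<not> ?thesis"
    then have "a = 0" for a :: 'a by (induct a rule: homogeneous_induct) auto
    then show False using nontrivial by blast
  qed
  then obtain q y where q: "q \<in> carrier G" "y \<in> A q" "y \<noteq> 0" by blast
  obtain t where t: "t \<in> cspan {a \<otimes>\<^sub>t b | a b. a \<in> A (p \<otimes>\<^bsub>G\<^esub> q) \<and> b \<in> A q}" "T1 t = x \<otimes>\<^sub>t y"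
    using T1_preimage[OF p(1) q(1) p(3) q(2)] by blast
  have "p \<otimes>\<^bsub>G\<^esub> q \<noteq> q" using p q by simp
  then have "a * b = 0" if "a \<in> A (p \<otimes>\<^bsub>G\<^esub> q)" "b \<in> A q" for a b
    using p q that by (intro component_orthogonal[of "p \<otimes>\<^bsub>G\<^esub> q" q]) simp_all
  then have "tensor_lift (*) t = 0"
    by (intro span_zero_on[OF tensor_lift_linear[OF cbilinear_mult] _ t(1)])
      (auto simp: cbilinear_mult)
  then show ?thesis using q by (simp add: counit_T1_lift t slice_eps_bilin)
qed

text \<open>S(a) b is the counit slice of an element of A_{pq} \<otimes> A_q when b is in A_q. The
  counit vanishes there unless pq is the unit, so S(a) annihilates every component except that of
  p^-1.\<close>

lemma S_component:
  assumes p: "p \<in> carrier G" "a \<in> A p"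
  shows "S a \<in> A (inv\<^bsub>G\<^esub> p)"
proof (rule component_iff)
  show "inv\<^bsub>G\<^esub> p \<in> carrier G" using p by simp
  fix q assume q: "q \<in> carrier G" "q \<noteq> inv\<^bsub>G\<^esub> p"
  have pq: "p \<otimes>\<^bsub>G\<^esub> q \<noteq> \<one>\<^bsub>G\<^esub>" using p q G.inv_equality G.inv_comm by metis
  have "S a * b = 0" if b: "b \<in> A q" for b
  proof -
    obtain t where t: "t \<in> cspan {a \<otimes>\<^sub>t b | a b. a \<in> A (p \<otimes>\<^bsub>G\<^esub> q) \<and> b \<in> A q}" "T1 t = a \<otimes>\<^sub>t b"
      using T1_preimage[OF p(1) q(1) p(2) b] by blast
    have "slice_left \<epsilon> t = 0"
      using p q pq by (intro span_zero_on[OF tensor_lift_linear[OF slice_eps_bilin(1)] _ t(1)])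
        (auto simp: slice_eps_bilin eps_component[of "p \<otimes>\<^bsub>G\<^esub> q"])
    then show ?thesis using left_antipode_T1[of t] by (simp add: t left_antipode_eq)
  qed
  then have *: "part (S a) q * b = 0" if "b \<in> A q" for b
    using mult_component[OF q(1) that, of "S a"] that by simp
  have "part (S a) q * b = 0" for b
  proof (induct b rule: homogeneous_induct)
    case (homogeneous r b)
    then show ?case using q(1) part_in * component_orthogonal by (cases "r = q") blast+
  qed (simp add: distrib_left)
  then show "part (S a) q = 0" by (rule nondegenerate_productD(1)[OF nondegenerate])
qed

section \<open>The deformed antipode\<close>

abbreviation T :: "'a \<Rightarrow> 'a"
  where "T \<equiv> deformed_antipode G A \<pi> S"

lemma deformed_antipode_eq: "T = graded_sum (\<lambda>p a. \<pi> (inv\<^bsub>G\<^esub> p) (S a))"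
proof -
  have l: "clinear (\<lambda>a. \<pi> (inv\<^bsub>G\<^esub> p) (S a))" if "p \<in> carrier G" for p
    using that by (simp add: clinear_iff clinear_add[OF S_linear] clinear_scale[OF S_linear]
        clinear_add[OF pi_linear] clinear_scale[OF pi_linear])
  show ?thesis
    unfolding deformed_antipode_def
  proof (rule the_equality)
    show "clinear (graded_sum (\<lambda>p a. \<pi> (inv\<^bsub>G\<^esub> p) (S a))) \<and> (\<forall>p\<in>carrier G. \<forall>a\<in>A p.
        graded_sum (\<lambda>p a. \<pi> (inv\<^bsub>G\<^esub> p) (S a)) a = \<pi> (inv\<^bsub>G\<^esub> p) (S a))"
      by (simp add: graded_sum_linear[OF l] graded_sum_homogeneous[OF l])
    fix f assume f: "clinear f \<and> (\<forall>p\<in>carrier G. \<forall>a\<in>A p. f a = \<pi> (inv\<^bsub>G\<^esub> p) (S a))"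
    show "f = graded_sum (\<lambda>p a. \<pi> (inv\<^bsub>G\<^esub> p) (S a))"
    proof
      fix a show "f a = graded_sum (\<lambda>p a. \<pi> (inv\<^bsub>G\<^esub> p) (S a)) a"
        by (induct a rule: homogeneous_induct)
          (use f in \<open>simp_all add: graded_sum_homogeneous[OF l] clinear_add[OF graded_sum_linear[OF l]] clinear_add\<close>)
    qed
  qed
qed

lemma T_linear: "clinear T"
  and T_homogeneous: "p \<in> carrier G \<Longrightarrow> a \<in> A p \<Longrightarrow> T a = \<pi> (inv\<^bsub>G\<^esub> p) (S a)"
proof -
  have l: "clinear (\<lambda>a. \<pi> (inv\<^bsub>G\<^esub> p) (S a))" if "p \<in> carrier G" for p
    using that by (simp add: clinear_iff clinear_add[OF S_linear] clinear_scale[OF S_linear]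
        clinear_add[OF pi_linear] clinear_scale[OF pi_linear])
  show "clinear T" unfolding deformed_antipode_eq by (rule graded_sum_linear[OF l])
  show "p \<in> carrier G \<Longrightarrow> a \<in> A p \<Longrightarrow> T a = \<pi> (inv\<^bsub>G\<^esub> p) (S a)"
    unfolding deformed_antipode_eq by (rule graded_sum_homogeneous[OF l])
qed

lemmas T_add = clinear_add[OF T_linear]

lemma T_component: "p \<in> carrier G \<Longrightarrow> a \<in> A p \<Longrightarrow> T a \<in> A (inv\<^bsub>G\<^esub> p)"
  using pi_component[of "inv\<^bsub>G\<^esub> p" "S a"] by (simp add: T_homogeneous S_component)

text \<open>Inside one component a single automorphism is involved; for different components both
  sides vanish, because T sends them to different components.\<close>

lemma T_mult: "T (a * b) = T b * T a"
proof (induct a rule: homogeneous_induct)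
  case (homogeneous p a)
  show ?case
  proof (induct b rule: homogeneous_induct)
    case hb: (homogeneous q b)
    show ?case
    proof (cases "p = q")
      case True
      then show ?thesis using homogeneous hb
        by (simp add: T_homogeneous component_mult S_mult pi_mult)
    next
      case False
      then have "inv\<^bsub>G\<^esub> q \<noteq> inv\<^bsub>G\<^esub> p" using homogeneous hb G.inv_inv by metis
      then have "T b * T a = 0"
        using homogeneous hb by (intro component_orthogonal[OF _ _ _ T_component T_component]) auto
      moreover have "a * b = 0" using homogeneous hb False by (intro component_orthogonal)
      ultimately show ?thesis by (simp add: clinear_zero[OF T_linear])
    qed
  qed (simp add: distrib_left distrib_right T_add)
qed (simp add: distrib_left distrib_right T_add)

lemma T_antihom: "algebra_antihom T"
  by (simp add: algebra_antihom_def T_linear T_mult)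

text \<open>T factors as S after the bijection \<open>?g\<close> acting on A_p by pi_{p^-1}. The
  inverse \<open>?f\<close> acts by pi_p, and both preserve A_p.\<close>

lemma bij_T: "bij T"
proof -
  let ?f = "graded_sum \<pi>" and ?g = "graded_sum (\<lambda>p. \<pi> (inv\<^bsub>G\<^esub> p))"
  have lg: "\<And>p. p \<in> carrier G \<Longrightarrow> clinear (\<pi> (inv\<^bsub>G\<^esub> p))" by (simp add: pi_linear)
  note add = clinear_add[OF graded_sum_linear[OF pi_linear]] clinear_add[OF graded_sum_linear[OF lg]]
  note hom = graded_sum_homogeneous[OF pi_linear] graded_sum_homogeneous[OF lg]
  have "?f (?g a) = a" for a
    by (induct a rule: homogeneous_induct) (simp_all add: add hom pi_component pi_inv_component)
  moreover have "?g (?f a) = a" for a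
    by (induct a rule: homogeneous_induct) (simp_all add: add hom pi_component pi_inv_component)
  ultimately have g: "bij ?g" by (intro o_bij[of ?f]) (auto simp: fun_eq_iff)
  have "T a = S (?g a)" for a
    by (induct a rule: homogeneous_induct)
      (simp_all add: T_add add hom T_homogeneous S_pi clinear_add[OF S_linear])
  then have "T = S \<circ> ?g" by auto
  then show ?thesis using bij_comp[OF g bij_antipode] by simp
qed

text \<open>\<open>twist \<rho>\<close> acts as \<open>\<rho>\<^sub>q \<otimes> \<iota>\<close> on \<open>A \<otimes> A\<^sub>q\<close>; the deformed coproduct is
  \<open>twist (\<pi>\<^bsub>q\<inverse>\<^esub>)\<close> applied to \<open>\<Delta>\<close>.\<close>

definition twist :: "('g \<Rightarrow> 'a \<Rightarrow> 'a) \<Rightarrow> ('a, 'a) tensor \<Rightarrow> ('a, 'a) tensor"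
  where "twist \<rho> = tensor_lift (\<lambda>x. graded_sum (\<lambda>q y. \<rho> q x \<otimes>\<^sub>t y))"

lemma
  assumes \<rho>: "\<And>q. q \<in> carrier G \<Longrightarrow> clinear (\<rho> q)"
  shows twist_linear: "clinear (twist \<rho>)"
    and twist_tensor: "q \<in> carrier G \<Longrightarrow> y \<in> A q \<Longrightarrow> twist \<rho> (x \<otimes>\<^sub>t y) = \<rho> q x \<otimes>\<^sub>t y"
proof -
  have l: "clinear (\<lambda>y. z \<otimes>\<^sub>t y)" for z :: 'a by (simp add: clinear_iff tensor_bilin)
  note gl = graded_sum_linear[OF l] and gh = graded_sum_homogeneous[OF l]
  have "graded_sum (\<lambda>q y. \<rho> q (x + x') \<otimes>\<^sub>t y) y
      = graded_sum (\<lambda>q y. \<rho> q x \<otimes>\<^sub>t y) y + graded_sum (\<lambda>q y. \<rho> q x' \<otimes>\<^sub>t y) y"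
    "graded_sum (\<lambda>q y. \<rho> q (c *\<^sub>C x) \<otimes>\<^sub>t y) y = c *\<^sub>C graded_sum (\<lambda>q y. \<rho> q x \<otimes>\<^sub>t y) y" for x x' c y
    by (induct y rule: homogeneous_induct)
      (simp_all add: gh clinear_add[OF gl] clinear_add[OF \<rho>] clinear_scale[OF \<rho>] tensor_bilin
        scaleC_add_right)
  then have b: "cbilinear (\<lambda>x. graded_sum (\<lambda>q y. \<rho> q x \<otimes>\<^sub>t y))"
    unfolding cbilinear_def by (simp add: gl) (simp add: clinear_iff)
  show "clinear (twist \<rho>)" unfolding twist_def by (rule tensor_lift_linear[OF b])
  show "q \<in> carrier G \<Longrightarrow> y \<in> A q \<Longrightarrow> twist \<rho> (x \<otimes>\<^sub>t y) = \<rho> q x \<otimes>\<^sub>t y"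
    by (simp add: twist_def b gh)
qed

section \<open>The deformed coproduct as a conjugate of \<open>\<Delta>\<close>\<close>

abbreviation deform :: "('a, 'a) tensor \<Rightarrow> ('a, 'a) tensor"
  where "deform \<equiv> twist (\<lambda>q. \<pi> (inv\<^bsub>G\<^esub> q))"

lemma deform_linear: "clinear deform"
  by (rule twist_linear) (simp add: pi_linear)

lemmas deform_add = clinear_add[OF deform_linear]

lemma deform_tensor: "q \<in> carrier G \<Longrightarrow> y \<in> A q \<Longrightarrow> deform (x \<otimes>\<^sub>t y) = \<pi> (inv\<^bsub>G\<^esub> q) x \<otimes>\<^sub>t y"
  by (rule twist_tensor) (simp_all add: pi_linear)

text \<open>The automorphism applied depends only on the component of the second leg, and second
  legs from different components annihilate each other.\<close>

lemma deform_mult: "deform (s * t) = deform s * deform t"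
proof (induct s rule: tensor_homogeneous_induct)
  case (homogeneous p q x y)
  show ?case
  proof (induct t rule: tensor_homogeneous_induct)
    case h: (homogeneous p' q' x' y')
    show ?case
    proof (cases "q = q'")
      case True
      then show ?thesis using homogeneous h by (simp add: deform_tensor component_mult pi_mult)
    next
      case False
      then have "y * y' = 0" using homogeneous h by (intro component_orthogonal[of q q'])
      then show ?thesis using homogeneous h by (simp add: deform_tensor clinear_zero[OF deform_linear])
    qed
  qed (simp add: deform_add distrib_left)
qed (simp add: deform_add distrib_right)

lemma bij_deform: "bij deform"
proof -
  note l = twist_linear[of \<pi>, OF pi_linear]
  note t = twist_tensor[of \<pi>, OF pi_linear]
  have "twist \<pi> (deform s) = s" for s
    by (induct s rule: tensor_homogeneous_induct) (simp_all add: deform_tensor t deform_add clinear_add[OF l])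
  moreover have "deform (twist \<pi> s) = s" for s
    by (induct s rule: tensor_homogeneous_induct) (simp_all add: deform_tensor t deform_add clinear_add[OF l])
  ultimately show ?thesis by (intro o_bij[of "twist \<pi>"]) (auto simp: fun_eq_iff)
qed

abbreviation D :: "'a coproduct"
  where "D \<equiv> deformed_coproduct G \<Delta> A \<pi>"

text \<open>For a in A_r the grading axiom is applied to the factorization r = (r q^-1) q.\<close>

lemma T1_component_right:
  assumes "q \<in> carrier G" "b \<in> A q"
  shows "T1 (a \<otimes>\<^sub>t b) \<in> cspan {x \<otimes>\<^sub>t y | x y. y \<in> A q}"
proof (induct a rule: homogeneous_induct)
  case (homogeneous r a)
  have "T1 (a \<otimes>\<^sub>t b) \<in> cspan {x \<otimes>\<^sub>t y | x y. x \<in> A (r \<otimes>\<^bsub>G\<^esub> inv\<^bsub>G\<^esub> q) \<and> y \<in> A q}"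
    using homogeneous assms by (intro T1_image) (simp_all add: G.m_assoc)
  also have "\<dots> \<subseteq> cspan {x \<otimes>\<^sub>t y | x y. y \<in> A q}"
    by (rule complex_vector.span_mono) auto
  finally show ?case .
qed (simp add: tensor_bilin T1_add complex_vector.span_add)

lemma deform_span:
  assumes q: "q \<in> carrier G" and t: "t \<in> cspan {x \<otimes>\<^sub>t y | x y. y \<in> A q}"
  shows "deform (t * (x \<otimes>\<^sub>t y)) = tensor_map (\<pi> (inv\<^bsub>G\<^esub> q)) id t * (\<pi> (inv\<^bsub>G\<^esub> q) x \<otimes>\<^sub>t y)"
proof -
  have iq: "inv\<^bsub>G\<^esub> q \<in> carrier G" using q by simp
  have ci: "clinear id" by (simp add: clinear_iff)
  note l = tensor_map_linear[OF pi_linear[OF iq] ci]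
  let ?f = "\<lambda>t. deform (t * (x \<otimes>\<^sub>t y)) - tensor_map (\<pi> (inv\<^bsub>G\<^esub> q)) id t * (\<pi> (inv\<^bsub>G\<^esub> q) x \<otimes>\<^sub>t y)"
  have "?f t = 0"
  proof (rule span_zero_on[OF _ _ t])
    show "clinear ?f"
      by (simp add: clinear_iff distrib_right deform_add clinear_add[OF l] clinear_scale[OF l]
          clinear_scale[OF deform_linear] mult_scaleC_left complex_vector.scale_right_diff_distrib)
    fix s :: "('a, 'a) tensor" assume "s \<in> {x \<otimes>\<^sub>t y | x y. y \<in> A q}"
    then obtain z w where "s = z \<otimes>\<^sub>t w" "w \<in> A q" by blast
    then show "?f s = 0"
      using q by (simp add: component_mult_left deform_tensor pi_mult tensor_map_tensor[OF pi_linear[OF iq] ci])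
  qed
  then show ?thesis by simp
qed

text \<open>The extension of the automorphism \<open>deform\<close> to multipliers sends
  \<open>\<Delta> a\<close> to a solution of the defining equations of \<open>D a\<close>: on A
  \<otimes> A_q, which contains \<Delta>(a)(1 \<otimes> b) for b in A_q, it acts as pi_{q^-1}
  \<otimes> id. A = A A makes the solution unique.\<close>

lemma lact_deformed_coproduct: "lact (D a) (deform t) = deform (lact (\<Delta> a) t)"
proof -
  have h: "algebra_hom deform" by (simp add: algebra_hom_def deform_linear deform_mult)
  define n where "n = mult_ext (\<lambda>t. embed (deform t)) (\<Delta> a)"
  have n: "lact n (deform t) = deform (lact (\<Delta> a) t)" for t
    unfolding n_def by (rule mult_ext_hom(1)[OF nondegenerate2 h bij_deform])
  have spec: "n * (1 \<otimes>\<^sub>M embed b)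
      = embed (tensor_map (\<pi> (inv\<^bsub>G\<^esub> q)) id (unembed (\<Delta> a * (1 \<otimes>\<^sub>M embed b))))"
    if q: "q \<in> carrier G" and b: "b \<in> A q" for q b
  proof (rule multiplier_eq_lactI[OF nondegenerate2])
    fix t :: "('a, 'a) tensor"
    show "lact (n * (1 \<otimes>\<^sub>M embed b)) t
      = lact (embed (tensor_map (\<pi> (inv\<^bsub>G\<^esub> q)) id (unembed (\<Delta> a * (1 \<otimes>\<^sub>M embed b))))) t"
    proof (induct t rule: tensor_induct)
      case (tensor x y)
      have "x \<otimes>\<^sub>t (b * y) = deform (\<pi> q x \<otimes>\<^sub>t (b * y))"
        using q b by (simp add: deform_tensor component_mult_left)
      then have "lact (n * (1 \<otimes>\<^sub>M embed b)) (x \<otimes>\<^sub>t y) = deform (T1 (a \<otimes>\<^sub>t b) * (\<pi> q x \<otimes>\<^sub>t y))"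
        by (simp add: n lact_coprod)
      also have "\<dots> = tensor_map (\<pi> (inv\<^bsub>G\<^esub> q)) id (T1 (a \<otimes>\<^sub>t b)) * (x \<otimes>\<^sub>t y)"
        using q b by (simp add: deform_span[OF q T1_component_right[OF q b]])
      finally show ?case by (simp add: embed_T1_tensor unembed_embed[OF nondegenerate2] id_def)
    qed (simp add: lact_add distrib_left)
  qed
  have "D a = n"
    unfolding deformed_coproduct_def
  proof (rule the_equality)
    show "\<forall>q\<in>carrier G. \<forall>b\<in>A q. n * (1 \<otimes>\<^sub>M embed b)
      = embed (tensor_map (\<pi> (inv\<^bsub>G\<^esub> q)) id (unembed (\<Delta> a * (1 \<otimes>\<^sub>M embed b))))"
      using spec by blast
    fix m assume "\<forall>q\<in>carrier G. \<forall>b\<in>A q. m * (1 \<otimes>\<^sub>M embed b)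
      = embed (tensor_map (\<pi> (inv\<^bsub>G\<^esub> q)) id (unembed (\<Delta> a * (1 \<otimes>\<^sub>M embed b))))"
    then have *: "m * (1 \<otimes>\<^sub>M embed b) = n * (1 \<otimes>\<^sub>M embed b)" if "q \<in> carrier G" "b \<in> A q" for q b
      using spec that by simp
    have "m * (1 \<otimes>\<^sub>M embed b) = n * (1 \<otimes>\<^sub>M embed b)" for b :: 'a
      by (induct b rule: homogeneous_induct)
        (auto simp: * clinear_add[OF clinear_embed] multiplier_tensor_bilin distrib_left)
    from arg_cong[OF this, of "\<lambda>k. lact k (_ \<otimes>\<^sub>t _)"]
    have "lact m (x \<otimes>\<^sub>t (b * y)) = lact n (x \<otimes>\<^sub>t (b * y))" for x b y by simp
    then have "lact m t = lact n t" for t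
      by (induct t rule: tensor_right_product_induct) (simp_all add: lact_add)
    then show "m = n" by (rule multiplier_eq_lactI[OF nondegenerate2])
  qed
  then show ?thesis by (simp add: n)
qed

text \<open>On A_p the left side involves the component of g p g^-1, and (g p g^-1)^-1 g = g
  p^-1.\<close>

lemma T_pi:
  assumes g: "g \<in> carrier G"
  shows "T (\<pi> g a) = \<pi> g (T a)"
proof (induct a rule: homogeneous_induct)
  case (homogeneous p a)
  have "\<pi> (inv\<^bsub>G\<^esub> (g \<otimes>\<^bsub>G\<^esub> p \<otimes>\<^bsub>G\<^esub> inv\<^bsub>G\<^esub> g)) (\<pi> g (S a)) = \<pi> g (\<pi> (inv\<^bsub>G\<^esub> p) (S a))"
    using g homogeneous by (simp add: pi_comp[symmetric] G.inv_mult_group G.m_assoc)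
  then show ?case
    using g homogeneous T_homogeneous[OF _ pi_component_conj[of g p a]]
    by (simp add: T_homogeneous S_pi)
qed (simp add: T_add clinear_add[OF pi_linear[OF g]])

definition \<Theta> :: "('a, 'a) tensor \<Rightarrow> 'a"
  where "\<Theta> = tensor_lift (\<lambda>x y. T y * x)"

lemma \<Theta>_bilin: "cbilinear (\<lambda>x y. T y * x)"
  by (simp add: cbilinear_iff T_add clinear_scale[OF T_linear] distrib_left distrib_right
      mult_scaleC_left mult_scaleC_right)

lemma \<Theta>_tensor [simp]: "\<Theta> (x \<otimes>\<^sub>t y) = T y * x"
  by (simp add: \<Theta>_def \<Theta>_bilin)

lemma \<Theta>_linear: "clinear \<Theta>"
  unfolding \<Theta>_def by (rule tensor_lift_linear[OF \<Theta>_bilin])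

lemmas \<Theta>_add = clinear_add[OF \<Theta>_linear]

text \<open>On A_r \<otimes> A_q the left side is pi_{q^-1}(T x) y. If q = r^-1, then T x = pi_q(S
  x) and the automorphisms cancel; otherwise both sides are products of elements of different
  components.\<close>

lemma \<Theta>_flip_deform: "\<Theta> (tensor_flip (deform t)) = left_antipode t"
proof (induct t rule: tensor_homogeneous_induct)
  case (homogeneous r q x y)
  have "\<pi> (inv\<^bsub>G\<^esub> q) (T x) * y = S x * y"
  proof (cases "inv\<^bsub>G\<^esub> r = q")
    case True
    then show ?thesis using homogeneous by (auto simp: T_homogeneous)
  next
    case False
    let ?s = "inv\<^bsub>G\<^esub> q \<otimes>\<^bsub>G\<^esub> inv\<^bsub>G\<^esub> r \<otimes>\<^bsub>G\<^esub> inv\<^bsub>G\<^esub> (inv\<^bsub>G\<^esub> q)"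
    \<comment> \<open>q^-1 r^-1 q = q would force r^-1 = q.\<close>
    have "?s \<noteq> q"
    proof
      assume "?s = q"
      then have "q \<otimes>\<^bsub>G\<^esub> ?s = q \<otimes>\<^bsub>G\<^esub> q" by simp
      then have "inv\<^bsub>G\<^esub> r \<otimes>\<^bsub>G\<^esub> q = q \<otimes>\<^bsub>G\<^esub> q" using homogeneous by (simp add: G.m_assoc[symmetric])
      then show False using False homogeneous by simp
    qed
    moreover have "\<pi> (inv\<^bsub>G\<^esub> q) (T x) \<in> A ?s"
      using homogeneous by (intro pi_component_conj T_component) auto
    ultimately have "\<pi> (inv\<^bsub>G\<^esub> q) (T x) * y = 0"
      using homogeneous by (intro component_orthogonal[of ?s q]) auto
    moreover have "S x * y = 0"
      using homogeneous False by (intro component_orthogonal[of "inv\<^bsub>G\<^esub> r" q] S_component) auto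
    ultimately show ?thesis by simp
  qed
  then show ?case using homogeneous by (simp add: deform_tensor left_antipode_eq T_pi)
qed (simp add: deform_add tensor_flip_add \<Theta>_add left_antipode_add)

end

section \<open>The Drinfeld multiplier\<close>

locale quasitriangular_hopf = crossed_mult_hopf +
  fixes R :: "('a::complex_algebra, 'a) tensor multiplier"
  assumes matrix: "generalized_matrix G \<Delta> A \<pi> R"
begin

section \<open>The invariant map \<open>\<psi>\<close>\<close>

lemma R_intertwines: "R * \<Delta> a = coproduct_cop D a * R"
  and R_half: "R * (embed a \<otimes>\<^sub>M 1) \<in> range half_embed"
  using matrix by (simp_all add: generalized_matrix_def)

lemma R_inverse: obtains Q where "\<And>t. lact R (lact Q t) = t"
proof -
  obtain Q where "R * Q = 1"
    using matrix unfolding generalized_matrix_def invertible_def by blast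
  then have "lact R (lact Q t) = t" for t by (metis lact_simps(2,7))
  then show ?thesis by (rule that)
qed

definition \<psi> :: "('a, 'a) tensor \<Rightarrow> 'a"
  where "\<psi> t = \<Theta> (lact R t)"

lemma \<psi>_linear: "clinear \<psi>"
  by (simp add: clinear_iff \<psi>_def lact_add lact_scale \<Theta>_add clinear_scale[OF \<Theta>_linear])

lemmas \<psi>_add = clinear_add[OF \<psi>_linear]

text \<open>\<open>R\<close> exchanges \<open>\<Delta> a\<close> for the flipped \<open>D a\<close>,
  which is \<open>\<Delta> a\<close> seen through flip and \<open>deform\<close>. Composing
  \<open>\<Theta>\<close> with these gives \<open>left_antipode\<close>, whose invariance is
  known.\<close>

lemma \<psi>_coprod: "\<psi> (lact (\<Delta> a) t) = \<epsilon> a *\<^sub>C \<psi> t"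
proof -
  \<comment> \<open>The flip and \<open>deform\<close> are undone on \<open>lact R t\<close>, so
    that \<open>\<Delta> a\<close> acts directly on s.\<close>
  obtain s where s: "tensor_flip (lact R t) = deform s" using bij_deform by (metis bij_pointE)
  then have s': "lact R t = tensor_flip (deform s)" by (metis tensor_flip_flip)
  have "lact R (lact (\<Delta> a) t) = lact (coproduct_cop D a) (lact R t)"
    using arg_cong[OF R_intertwines, of "\<lambda>m. lact m t"] by simp
  also have "\<dots> = tensor_flip (deform (lact (\<Delta> a) s))"
    by (simp add: coproduct_cop_act(1)[OF nondegenerate] s lact_deformed_coproduct)
  finally show ?thesis
    by (simp add: \<psi>_def s' \<Theta>_flip_deform left_antipode_coprod)
qed

lemma \<psi>_shift: "\<psi> ((x * p) \<otimes>\<^sub>t q) = \<psi> (p \<otimes>\<^sub>t (S x * q))"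
  using invariant_shift[OF \<psi>_linear \<psi>_coprod] by (simp add: left_antipode_eq)

lemma \<Theta>_mult_tensor: "\<Theta> (t * (z \<otimes>\<^sub>t w)) = T w * \<Theta> t * z"
  by (induct t rule: tensor_induct) (simp_all add: T_mult \<Theta>_add distrib_left distrib_right mult.assoc)

lemma \<psi>_mult_tensor: "\<psi> ((x * z) \<otimes>\<^sub>t (y * w)) = T w * \<psi> (x \<otimes>\<^sub>t y) * z"
proof -
  have "\<psi> ((x * z) \<otimes>\<^sub>t (y * w)) = \<psi> ((x \<otimes>\<^sub>t y) * (z \<otimes>\<^sub>t w))" by simp
  then show ?thesis by (simp only: \<psi>_def lact_mult \<Theta>_mult_tensor)
qed

section \<open>From \<open>\<psi>\<close> to the defining contraction of u\<close>

lemma T_surj: obtains a where "T a = b"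
  using bij_T by (metis bij_pointE)

lemma T_cancel: assumes "\<And>w. T w * x = T w * y" shows "x = y"
proof (rule nondegenerate_product_eqI(2)[OF nondegenerate])
  fix b obtain w where "T w = b" by (rule T_surj)
  then show "b * x = b * y" using assms[of w] by simp
qed

definition contract :: "('a, 'a multiplier) tensor \<Rightarrow> 'a"
  where "contract = tensor_lift (\<lambda>x m. lact (mult_antiext T m) x)"

text \<open>The factor \<open>T y\<close> absorbs the extended antipode, since T(y) T(m) = T(m y); z
  gives \<open>half_embed t\<close> something to act on in the first leg.\<close>

lemma contract_half_embed: "T y * contract t * z = \<Theta> (lact (half_embed t) (z \<otimes>\<^sub>t y))"
proof (induct t rule: tensor_induct)
  note m = mult_antiext_linear[OF T_antihom bij_T]
  have b: "cbilinear (\<lambda>x m. lact (mult_antiext T m) x)"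
    by (simp add: cbilinear_iff lact_add lact_scale clinear_add[OF m] clinear_scale[OF m])
  have b': "cbilinear (\<lambda>a m. embed a \<otimes>\<^sub>M m)"
    by (simp add: cbilinear_iff multiplier_tensor_bilin clinear_add[OF clinear_embed] clinear_scale[OF clinear_embed])
  {
    case (tensor x m)
    have "T y * contract (x \<otimes>\<^sub>t m) = T (lact m y) * x"
      by (simp add: contract_def b lact_ract mult_antiext_antihom[OF T_antihom bij_T])
    then show ?case by (simp add: half_embed_def b' mult.assoc)
  next
    case (add s t)
    then show ?case
      by (simp add: contract_def half_embed_def tensor_lift_add[OF b] tensor_lift_add[OF b'] \<Theta>_add
          distrib_left distrib_right)
  }
qed

lemma contract_R: "half_embed t = R * (embed a \<otimes>\<^sub>M 1) \<Longrightarrow> T y * contract t = \<psi> (a \<otimes>\<^sub>t y)"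
proof -
  assume t: "half_embed t = R * (embed a \<otimes>\<^sub>M 1)"
  have *: "T y * contract t * z = \<psi> ((a * z) \<otimes>\<^sub>t y)" for y z
    by (simp add: contract_half_embed t \<psi>_def)
  have "T w * (T y * contract t) = T w * \<psi> (a \<otimes>\<^sub>t y)" for w
  proof (rule nondegenerate_product_eqI(1)[OF nondegenerate])
    \<comment> \<open>The second factor w creates the product in the second leg through which
      \<open>\<psi>_mult_tensor\<close> extracts z.\<close>
    fix z
    have "T w * (T y * contract t) * z = \<psi> ((a * z) \<otimes>\<^sub>t (y * w))"
      using *[of "y * w" z] by (simp add: T_mult mult.assoc)
    then show "T w * (T y * contract t) * z = T w * \<psi> (a \<otimes>\<^sub>t y) * z" by (simp add: \<psi>_mult_tensor)
  qed
  then show ?thesis by (rule T_cancel)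
qed

text \<open>The choice of t is harmless: by \<open>contract_R\<close>, every admissible t gives the
  same products T(y) \<open>contract t\<close>, and these determine it.\<close>

definition drinfeld :: "'a \<Rightarrow> 'a"
  where "drinfeld a = contract (SOME t. half_embed t = R * (embed a \<otimes>\<^sub>M 1))"

lemma drinfeld_eq: "half_embed t = R * (embed a \<otimes>\<^sub>M 1) \<Longrightarrow> contract t = drinfeld a"
  and drinfeld_\<psi>: "T y * drinfeld a = \<psi> (a \<otimes>\<^sub>t y)"
proof -
  obtain s where "half_embed s = R * (embed a \<otimes>\<^sub>M 1)" using R_half[of a] by (metis imageE)
  then have "half_embed (SOME t. half_embed t = R * (embed a \<otimes>\<^sub>M 1)) = R * (embed a \<otimes>\<^sub>M 1)"
    by (rule someI)
  from contract_R[OF this] show *: "T y * drinfeld a = \<psi> (a \<otimes>\<^sub>t y)" for y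
    by (simp add: drinfeld_def)
  show "half_embed t = R * (embed a \<otimes>\<^sub>M 1) \<Longrightarrow> contract t = drinfeld a"
    by (rule T_cancel) (simp add: contract_R *)
qed

lemma drinfeld_linear: "clinear drinfeld"
  unfolding clinear_iff
  by (intro conjI allI; rule T_cancel)
    (simp_all add: drinfeld_\<psi> distrib_left mult_scaleC_right tensor_bilin \<psi>_add clinear_scale[OF \<psi>_linear])

lemma drinfeld_shift: "drinfeld (a * x) = T (S a) * drinfeld x"
proof (rule T_cancel)
  fix w
  have "T w * drinfeld (a * x) = T (S a * w) * drinfeld x"
    by (simp add: drinfeld_\<psi> \<psi>_shift)
  then show "T w * drinfeld (a * x) = T w * (T (S a) * drinfeld x)" by (simp add: T_mult mult.assoc)
qed

lemma drinfeld_mult: "drinfeld (x * z) = drinfeld x * z"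
proof (rule T_cancel, rule T_cancel)
  fix w y
  have "T w * (T y * drinfeld (x * z)) = \<psi> ((x * z) \<otimes>\<^sub>t (y * w))"
    by (simp add: drinfeld_\<psi>[symmetric] T_mult mult.assoc del: tensor_times_tensor)
  also have "\<dots> = T w * (T y * (drinfeld x * z))"
    unfolding \<psi>_mult_tensor by (simp add: drinfeld_\<psi>[symmetric] mult.assoc)
  finally show "T w * (T y * drinfeld (x * z)) = T w * (T y * (drinfeld x * z))" .
qed

lemma TS_bij: "bij (\<lambda>a. T (S a))"
  using bij_comp[OF bij_antipode bij_T] by (simp add: comp_def)

lemma TS_surj: obtains a where "T (S a) = b"
  using TS_bij by (metis bij_pointE)

text \<open>\<open>\<psi>\<close> and \<open>\<Theta>\<close> differ by \<open>R\<close>, so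
  invertibility transfers the question to \<open>\<Theta>\<close>, whose values T(a) c span
  A.\<close>

lemma bij_drinfeld: "bij drinfeld"
proof (rule bijI)
  obtain Q where Q: "\<And>t. lact R (lact Q t) = t" using R_inverse by blast
  have \<psi>Q: "\<psi> (lact Q t) = \<Theta> t" for t by (simp add: \<psi>_def Q)
  have "\<psi> t \<in> range drinfeld" for t
  proof (induct t rule: tensor_induct)
    case (tensor x y)
    \<comment> \<open>This writes T(y) u x in the form u (a x).\<close>
    obtain a where "T (S a) = T y" by (rule TS_surj)
    then have "\<psi> (x \<otimes>\<^sub>t y) = drinfeld (a * x)" by (simp add: drinfeld_\<psi>[symmetric] drinfeld_shift)
    then show ?case by simp
  qed (auto simp: \<psi>_add simp flip: clinear_add[OF drinfeld_linear])
  from this[of "lact Q _"] have \<Theta>: "\<Theta> t \<in> range drinfeld" for t by (simp add: \<psi>Q)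
  have "y \<in> range drinfeld" for y
  proof (induct y rule: product_induct)
    case (mult b c)
    obtain a where "T a = b" by (rule T_surj)
    then show ?case using \<Theta>[of "c \<otimes>\<^sub>t a"] by simp
  qed (auto simp flip: clinear_add[OF drinfeld_linear])
  then show "surj drinfeld" by blast
  have "x = 0" if x: "drinfeld x = 0" for x
  proof -
    have \<psi>0: "\<psi> (s * (x \<otimes>\<^sub>t w)) = 0" for s w
      by (induct s rule: tensor_induct)
        (simp_all add: drinfeld_\<psi>[symmetric] drinfeld_shift x distrib_right \<psi>_add)
    \<comment> \<open>The element \<open>s\<close> of the preceding fact is taken to be Q(a
      \<otimes> y), so that \<open>R\<close> cancels \<open>Q\<close> and \<open>\<Theta>\<close>
      exposes a x.\<close>
    have "T w * (T y * (a * x)) = T w * (T y * 0)" for w y a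
    proof -
      have "T w * (T y * (a * x)) = \<psi> (lact Q ((a \<otimes>\<^sub>t y) * (x \<otimes>\<^sub>t w)))"
        unfolding \<psi>Q by (simp add: T_mult mult.assoc)
      then show ?thesis by (simp only: lact_mult \<psi>0 mult_zero_right)
    qed
    then have "a * x = 0" for a by (metis T_cancel)
    then show "x = 0" by (rule nondegenerate_productD(2)[OF nondegenerate])
  qed
  then show "inj drinfeld"
    unfolding inj_def by (metis clinear_diff[OF drinfeld_linear] eq_iff_diff_eq_0)
qed

text \<open>The relation u a = T(S(a)) u dictates the right action b u = u g(b), with g the inverse
  of the automorphism T S; read backwards, it is the compatibility of the two actions.\<close>

lemma drinfeld_multiplier:
  obtains u where "lact u = drinfeld" "invertible u"
proof -
  define g where "g = inv_into UNIV (\<lambda>a. T (S a))"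
  have g: "T (S (g b)) = b" for b
    using surj_f_inv_f[OF bij_is_surj[OF TS_bij]] by (simp add: g_def)
  have gi: "g (T (S b)) = b" for b
    using inv_f_f[OF bij_is_inj[OF TS_bij]] by (simp add: g_def)
  have g_mult: "g (a * b) = g a * g b" for a b
    using gi[of "g a * g b"] by (simp add: S_mult T_mult g)
  have gl: "clinear g"
    unfolding g_def
    by (rule clinear_inv[OF _ TS_bij])
      (simp add: clinear_iff T_add clinear_add[OF S_linear] clinear_scale[OF S_linear] clinear_scale[OF T_linear])
  have shift: "drinfeld (g a * b) = a * drinfeld b" for a b by (simp add: drinfeld_shift g)
  obtain u where u: "lact u = drinfeld" "ract u = (\<lambda>b. drinfeld (g b))"
    by (rule multiplier_exists[of drinfeld "\<lambda>b. drinfeld (g b)"])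
      (simp_all add: drinfeld_linear clinear_iff clinear_add[OF gl] clinear_add[OF drinfeld_linear]
        clinear_scale[OF gl] clinear_scale[OF drinfeld_linear] drinfeld_mult g_mult shift
        flip: drinfeld_mult)
  have "bij g" unfolding g_def by (rule bij_imp_bij_inv[OF TS_bij])
  then have "bij (ract u)" using bij_comp[OF _ bij_drinfeld, of g] by (simp add: u comp_def)
  then show ?thesis using that u bij_drinfeld multiplier_invertible by metis
qed

lemma is_drinfeld_multiplier_iff: "is_drinfeld_multiplier G A \<pi> S R w \<longleftrightarrow> lact w = drinfeld"
proof
  assume w: "is_drinfeld_multiplier G A \<pi> S R w"
  show "lact w = drinfeld"
  proof
    fix a
    obtain t where "half_embed t = R * (embed a \<otimes>\<^sub>M 1)" using R_half[of a] by (auto simp: image_iff)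
    then show "lact w a = drinfeld a"
      using w drinfeld_eq unfolding is_drinfeld_multiplier_def contract_def by metis
  qed
next
  assume "lact w = drinfeld"
  then show "is_drinfeld_multiplier G A \<pi> S R w"
    using drinfeld_eq by (simp add: is_drinfeld_multiplier_def contract_def)
qed

lemma drinfeld_commutes:
  assumes "lact u = drinfeld"
  shows "u * embed a = embed (T (S a)) * u"
  by (rule multiplier_eq_lactI[OF nondegenerate]) (simp add: assms drinfeld_shift)

theorem antipode_fourth_power:
  assumes u: "lact u = drinfeld" "invertible u" and p: "p \<in> carrier G" "a \<in> A p"
  shows "embed ((S ^^ 4) a)
    = u * minverse (mult_antiext S u) * embed a * mult_antiext S u * minverse u"
proof -
  define U where "U = mult_antiext S u"
  have anti: "algebra_antihom S" using antipode by (simp add: is_antipode_def)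
  note ext = mult_antiext_hom[OF anti bij_antipode]
  obtain v where v: "u * v = 1" "v * u = 1" using u(2) unfolding invertible_def by blast
  define V where "V = mult_antiext S v"
  have V: "U * V = 1" "V * U = 1" by (simp_all only: U_def V_def ext(1)[symmetric] v ext(2))
  note mi = minverse_eq[OF v] minverse_eq[OF V]
  have iq: "inv\<^bsub>G\<^esub> p \<in> carrier G" using p by simp
  \<comment> \<open>Starting from a preimage b of a, S applied to u b = T(a) u puts a itself next to
    S(u).\<close>
  obtain b where b: "S b = a" using bij_antipode by (metis bij_pointE)
  have "mult_antiext S (u * embed b) = mult_antiext S (embed (T a) * u)"
    by (simp add: drinfeld_commutes[OF u(1)] b)
  then have *: "embed a * U = U * embed (\<pi> (inv\<^bsub>G\<^esub> p) (S (S a)))"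
    using p iq by (simp add: ext U_def b T_homogeneous S_pi)
  \<comment> \<open>d is S(u)^-1 a S(u). It lies in A_p, as S squared and pi_{p^-1} preserve
    A_p.\<close>
  define d where "d = \<pi> (inv\<^bsub>G\<^esub> p) (S (S a))"
  have "embed d = V * embed a * U"
    using * V(2) by (metis d_def mult.assoc mult_1_left)
  moreover have "d \<in> A p"
    using p S_component[OF iq S_component[OF p]] by (simp add: d_def pi_inv_component)
  \<comment> \<open>S(d) lies in the component of p^-1, so T(S(d)) = pi_p(S^2(d)), and pi_p cancels
    the pi_{p^-1} in d.\<close>
  then have "u * embed d = embed ((S ^^ 4) a) * u"
    using drinfeld_commutes[OF u(1), of d] p T_homogeneous[OF iq S_component[OF p(1), of d]]
    by (simp add: d_def S_pi numeral_eq_Suc)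
  ultimately have "embed ((S ^^ 4) a) = u * (V * embed a * U) * v"
    by (metis v(1) mult.assoc mult_1_right)
  then show ?thesis by (simp add: mi mult.assoc flip: U_def)
qed

end

theorem mainTheorem4:
  fixes G :: "('g, 'm) monoid_scheme"
    and \<Delta> :: "'a::complex_algebra coproduct"
    and \<epsilon> :: "'a \<Rightarrow> complex"
    and S :: "'a \<Rightarrow> 'a"
    and A :: "'g \<Rightarrow> 'a set"
    and \<pi> :: "'g \<Rightarrow> 'a \<Rightarrow> 'a"
    and R :: "('a, 'a) tensor multiplier"
  assumes "group G"
    and "regular_multiplier_hopf_algebra \<Delta>"
    and "is_counit \<Delta> \<epsilon>"
    and "is_antipode \<Delta> \<epsilon> S"
    and "cograded G \<Delta> A"
    and "crossing G \<Delta> A \<pi>"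
    and "generalized_matrix G \<Delta> A \<pi> R"
  shows "\<exists>u. (\<forall>w. is_drinfeld_multiplier G A \<pi> S R w \<longleftrightarrow> w = u)
    \<and> invertible u
    \<and> (\<forall>p\<in>carrier G. \<forall>a\<in>A p.
          embed ((S ^^ 4) a)
        = u * minverse (mult_antiext S u) * embed a * mult_antiext S u * minverse u)"
proof (cases "\<exists>x::'a. x \<noteq> 0")
  case True
  interpret quasitriangular_hopf \<Delta> \<epsilon> S G A \<pi> R
    using assms True
    by (intro quasitriangular_hopf.intro quasitriangular_hopf_axioms.intro crossed_mult_hopf.intro
        crossed_mult_hopf_axioms.intro regular_mult_hopf.intro regular_mult_hopf_axioms.intro
        mult_hopf.intro) (simp_all add: regular_multiplier_hopf_algebra_def)
  obtain u where u: "lact u = drinfeld" "invertible u" by (rule drinfeld_multiplier)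
  have "is_drinfeld_multiplier G A \<pi> S R w \<longleftrightarrow> w = u" for w
    using u(1) multiplier_eq_lactI[OF nondegenerate, of w u]
    by (auto simp: is_drinfeld_multiplier_iff)
  then show ?thesis using u antipode_fourth_power[OF u] by blast
next
  \<comment> \<open>In the zero algebra all multipliers coincide, so 0 = 1 is invertible and every
    claim is an equality between equal elements.\<close>
  case False
  then have z: "x = y" for x y :: 'a by metis
  have m: "m = n" for m n :: "'a multiplier"
    by (intro multiplier_eqI ext z)
  have "is_drinfeld_multiplier G A \<pi> S R w" for w
    unfolding is_drinfeld_multiplier_def by (intro allI impI z)
  moreover have "invertible (0 :: 'a multiplier)"
    unfolding invertible_def by (intro exI[of _ 0] conjI m)
  ultimately show ?thesis using m by blast
qed

end
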